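(* Let $f\in k[x,y]$ be a Newton non-degenerate polynomial defining a plane curve $\mathcal{C}=\{f=0\}$ singular at the origin. Let $f=f_1\cdots f_t$ be a tropical decomposition of $f$, and decompose each $f_i=\prod_{j=1}^{r_i}f_{(i,j)}$ into irreducible factors (branches). Then, for every $m\in\mathbf{N}$, the decomposition of $\mathcal{C}^0_m$ into irreducible components is $$\mathcal{C}^0_m=\bigcup_{\gamma\in B^*_m}\mathcal{H}^\gamma_m\ \cup\ \bigcup_{i=1}^t\ \bigcup_{\alpha\in A_m(i)}\ \bigcup_{j=1}^{r_i}\overline{\mathbf{A}^2_m\cap F^\alpha_{(i,j),k_{ij}}},$$ where $k_{ij}=\nu_\alpha(f_{(i,j)})+m-\nu_\alpha(f)$.
   Context: $k$ is an algebraically closed field; $\mathbf{N}=\{1,2,\dots\}$; $\le$ on $\mathbf{N}^2$ is the componentwise (product) order. Newton data. For a nonzero power series $h=\sum c_{ab}x^ay^b$ with $h(0)=0$ and $\omega\in\mathbf{R}^2_{\ge0}$ put $\nu_\omega(h)=\min\{\omega_1a+\omega_2b: c_{ab}\ne0\}$. The Newton polygon of $h$ is the union of the compact faces of $\mathrm{Conv}\bigl(\bigcup_{c_{ab}\neq0}((a,b)+\mathbf{R}^2_{\ge0})\bigr)$. The tropical variety $T(h)\subset\mathbf{R}_{\ge0}^2$ is the union, over the compact segments $\Phi$ of the Newton polygon, of the rays $C_\Phi=\{\omega\in\mathbf{R}_{\ge0}^2: \omega\cdot P=\nu_\omega(h)\ \forall P\in\Phi\}$. A reduced $f$ with $f(0)=0$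 is Newton non-degenerate if for every face $\Phi$ of its Newton polygon, with $f_\Phi=\sum_{(a,b)\in\Phi}c_{ab}x^ay^b$, the system $f_\Phi=\partial f_\Phi/\partial x=\partial f_\Phi/\partial y=0$ has no solution in $(k^\times)^2$. Branches. The branches of $f$ are its irreducible factors in $k[[x,y]]$; each is assumed to be, up to a unit, of the form $y^p-cx^q+\sum_{pa+qb>pq}c_{ab}x^ay^b$ with $p,q\ge1$ coprime and $c\neq0$ (so its tropical variety is the ray $\mathbf{R}_{\ge0}(p,q)$). Tropical decomposition: a factorization $f=f_1\cdots f_t$ such that each $T(f_i)$ is a semi-line in $\mathbf{R}_{\ge0}^2$ from the origin and $T(f_i)\cap T(f_j)=\{(0,0)\}$ for $i<j$. Jets. $\mathbf{A}^2_\infty$ has coordinates $x^{(j)},y^{(j)}$, $j\ge0$, and $\mathbf{A}^2_m=\{x^{(j)}=y^{(j)}=0,\ j>m\}\subset\mathbf{A}^2_\infty$, i.e. affine space with coordinates $x^{(0)},\dots,x^{(m)},y^{(0)},\dots,y^{(m)}$. For $h$ write $h(\sum_jx^{(j)}t^j,\sum_jy^{(j)}t^j)=\sum_{l\ge0}h^{(l)}t^l$. All sets are reduced algebraic sets. Put $\mathcal{C}^0_m=\mathbf{A}^2_m\cap\{x^{(0)}=y^{(0)}=0\}\cap\{f^{(l)}=0,\ 0\le l\le m\}$. For $\alpha\in\mathbf{N}^2$: $\mathcal{H}^\alpha_\infty=\{x^{(i)}=y^{(j)}=0: 0\le i<\alpha_1,\ 0\le j<\alpha_2\}\subset\mathbf{A}^2_\infty$,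 $\mathcal{H}^\alpha_m=\mathcal{H}^\alpha_\infty\cap\mathbf{A}^2_m$, and, for the factor $f_{(i,j)}$, $F^\alpha_{(i,j),l}=\mathcal{H}^\alpha_\infty\cap\{x^{(\alpha_1)}\ne0\}\cap\{y^{(\alpha_2)}\neq0\}\cap\{f_{(i,j)}^{(s)}=0,\ 0\le s\le l\}$. The bar denotes Zariski closure in $\mathbf{A}^2_m$. Index sets. $A_m(i)=\{\alpha\in T(f_i)\cap\mathbf{N}^2:\nu_\alpha(f)\le m\}$. $B_m$ is the set of minimal elements, for the product order, of $\{\gamma\in\mathbf{N}^2:\nu_\gamma(f)>m\}$. Let $\sigma$ be the convex hull of $T(f)$ and $\partial\sigma$ its boundary in $\mathbf{R}^2$ other than along nothing else than the extremal rays: $\partial\sigma$ is the union of the two extremal rays of $\sigma$ if $t\ge2$, and $\partial\sigma=\sigma=T(f)$ if $t=1$. Then $B^*_m$ is obtained from $B_m$ by removing every element of the form $\alpha+(1,1)$ with $\alpha\in B_{m-1}\cap\partial\sigma$ and $\nu_\alpha(f)=m$. *)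

theory Defs
  imports
    "HOL-Analysis.Analysis"
    "HOL-Computational_Algebra.Polynomial_FPS"
    "HOL-Computational_Algebra.Squarefree"
    "HOL-Library.Groups_Big_Fun"
    "HOL-Library.Product_Order"
begin

unbundle no vec_syntax
unbundle Formal_Power_Series.fps_syntax

section \<open>Polynomials and power series in two variables\<close>

text \<open>
  The outer variable is \<open>x\<close> and the inner one \<open>y\<close>: in \<open>h :: 'k fps fps\<close> the coefficient of
  \<open>x\<^sup>a y\<^sup>b\<close> is \<open>h $ a $ b\<close>, and likewise \<open>coeff (coeff f a) b\<close> for \<open>f :: 'k poly poly\<close>.
\<close>

definition fps2_of_poly2 :: "'k::comm_ring_1 poly poly \<Rightarrow> 'k fps fps" where
  "fps2_of_poly2 f = fps_of_poly (map_poly fps_of_poly f)"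

lemma fps2_of_poly2_nth [simp]: "fps2_of_poly2 f $ a $ b = coeff (coeff f a) b"
  by (simp add: fps2_of_poly2_def coeff_map_poly)

definition poly2 :: "'k::comm_ring_1 poly poly \<Rightarrow> 'k \<Rightarrow> 'k \<Rightarrow> 'k" where
  "poly2 f u v = poly (poly f [:u:]) v"

definition dx :: "'k::idom poly poly \<Rightarrow> 'k poly poly" where
  "dx = pderiv"

definition dy :: "'k::idom poly poly \<Rightarrow> 'k poly poly" where
  "dy = map_poly pderiv"

definition singular_at_origin :: "'k::idom poly poly \<Rightarrow> bool" where
  "singular_at_origin f \<longleftrightarrow> poly2 f 0 0 = 0 \<and> poly2 (dx f) 0 0 = 0 \<and> poly2 (dy f) 0 0 = 0"


section \<open>Newton data\<close>

abbreviation real_pair :: "nat \<times> nat \<Rightarrow> real \<times> real" where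
  "real_pair \<equiv> map_prod real real"

definition supp :: "'k::zero fps fps \<Rightarrow> (nat \<times> nat) set" where
  "supp h = {(a, b). h $ a $ b \<noteq> 0}"

text \<open>For \<open>h \<noteq> 0\<close> and \<open>\<omega>\<close> in the closed first quadrant the infimum is a minimum.\<close>

definition nu :: "real \<times> real \<Rightarrow> 'k::zero fps fps \<Rightarrow> real" where
  "nu \<omega> h = Inf ((\<lambda>p. \<omega> \<bullet> real_pair p) ` supp h)"

definition newton_polyhedron :: "'k::zero fps fps \<Rightarrow> (real \<times> real) set" where
  "newton_polyhedron h =
     convex hull (\<Union>p\<in>supp h. (+) (real_pair p) ` ({0..} \<times> {0..}))"

definition tropical_variety :: "'k::zero fps fps \<Rightarrow> (real \<times> real) set" where
  "tropical_variety h =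
     (\<Union>\<Phi>\<in>{\<Phi>. \<Phi> edge_of newton_polyhedron h \<and> compact \<Phi>}.
        {\<omega> \<in> {0..} \<times> {0..}. \<forall>P\<in>\<Phi>. \<omega> \<bullet> P = nu \<omega> h})"

text \<open>The sum is finite whenever \<open>\<Phi>\<close> is bounded.\<close>

definition face_poly :: "'k::comm_ring_1 fps fps \<Rightarrow> (real \<times> real) set \<Rightarrow> 'k poly poly" where
  "face_poly h \<Phi> = (\<Sum>(a, b)\<in>{p. real_pair p \<in> \<Phi>}. monom (monom (h $ a $ b) b) a)"

text \<open>Reducedness is understood in the power series ring. The empty set is a face in the sense of
  \<^const>\<open>face_of\<close> and has to be excluded.\<close>

definition newton_nondegenerate :: "'k::field fps fps \<Rightarrow> bool" where
  "newton_nondegenerate h \<longleftrightarrow>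
     squarefree h \<and> h $ 0 $ 0 = 0 \<and>
     (\<forall>\<Phi>. \<Phi> face_of newton_polyhedron h \<and> compact \<Phi> \<and> \<Phi> \<noteq> {} \<longrightarrow>
        \<not> (\<exists>u v. u \<noteq> 0 \<and> v \<noteq> 0 \<and>
             poly2 (face_poly h \<Phi>) u v = 0 \<and>
             poly2 (dx (face_poly h \<Phi>)) u v = 0 \<and>
             poly2 (dy (face_poly h \<Phi>)) u v = 0))"

text \<open>\<open>fps_X\<close> is \<open>x\<close>, \<open>fps_const fps_X\<close> is \<open>y\<close>, and \<open>u\<close> is a unit.\<close>

definition branch_form :: "'k::field fps fps \<Rightarrow> bool" where
  "branch_form g \<longleftrightarrow>
     (\<exists>u p q c R. u dvd 1 \<and> p \<ge> 1 \<and> q \<ge> 1 \<and> coprime p q \<and> c \<noteq> 0 \<and>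
        (\<forall>(a, b)\<in>supp R. p * a + q * b > p * q) \<and>
        g = u * (fps_const fps_X ^ p - fps_const (fps_const c) * fps_X ^ q + R))"

definition semi_line :: "(real \<times> real) set \<Rightarrow> bool" where
  "semi_line L \<longleftrightarrow> (\<exists>v. v \<noteq> 0 \<and> L = {s *\<^sub>R v |s. s \<ge> 0})"

definition tropical_decomposition ::
  "'k::comm_ring_1 fps fps \<Rightarrow> nat \<Rightarrow> (nat \<Rightarrow> 'k fps fps) \<Rightarrow> bool" where
  "tropical_decomposition f t fs \<longleftrightarrow>
     f = (\<Prod>i=1..t. fs i) \<and>
     (\<forall>i\<in>{1..t}. semi_line (tropical_variety (fs i))) \<and>
     (\<forall>i\<in>{1..t}. \<forall>j\<in>{1..t}. i < j \<longrightarrow>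
        tropical_variety (fs i) \<inter> tropical_variety (fs j) = {(0, 0)})"


section \<open>Arcs and jets\<close>

text \<open>
  Points of \<open>\<A>\<^sup>2\<^sub>\<infinity>\<close> are pairs of power series in \<open>t\<close>: the coordinates of \<open>(x, y)\<close> are
  \<open>x\<^sup>(\<^sup>j\<^sup>) = x $ j\<close> and \<open>y\<^sup>(\<^sup>j\<^sup>) = y $ j\<close>.
\<close>

type_synonym 'k arc = "'k fps \<times> 'k fps"

definition jet_space :: "nat \<Rightarrow> 'k::zero arc set" where
  "jet_space m = {(x, y). \<forall>j>m. x $ j = 0 \<and> y $ j = 0}"

text \<open>
  The coefficient of \<open>t\<^sup>l\<close> in \<open>h(x(t), y(t))\<close>. Only finitely many summands are nonzero if \<open>h\<close> is a
  polynomial or if \<open>x $ 0 = y $ 0 = 0\<close>, which covers all uses below.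
\<close>

definition jet_coeff :: "'k::comm_ring_1 fps fps \<Rightarrow> nat \<Rightarrow> 'k arc \<Rightarrow> 'k" where
  "jet_coeff h l = (\<lambda>(x, y). Sum_any (\<lambda>(a, b). h $ a $ b * (x ^ a * y ^ b) $ l))"

definition C0 :: "'k::comm_ring_1 fps fps \<Rightarrow> nat \<Rightarrow> 'k arc set" where
  "C0 f m = jet_space m \<inter> {(x, y). x $ 0 = 0 \<and> y $ 0 = 0} \<inter> {P. \<forall>l\<le>m. jet_coeff f l P = 0}"

definition H_inf :: "nat \<times> nat \<Rightarrow> 'k::zero arc set" where
  "H_inf \<alpha> = {(x, y). (\<forall>i<fst \<alpha>. x $ i = 0) \<and> (\<forall>j<snd \<alpha>. y $ j = 0)}"

definition H_fin :: "nat \<Rightarrow> nat \<times> nat \<Rightarrow> 'k::zero arc set" where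
  "H_fin m \<alpha> = H_inf \<alpha> \<inter> jet_space m"

text \<open>The level \<open>l\<close> is real because it will be an expression in values of \<^const>\<open>nu\<close>.\<close>

definition F_set :: "'k::comm_ring_1 fps fps \<Rightarrow> nat \<times> nat \<Rightarrow> real \<Rightarrow> 'k arc set" where
  "F_set g \<alpha> l = H_inf \<alpha> \<inter> {(x, y). x $ fst \<alpha> \<noteq> 0} \<inter> {(x, y). y $ snd \<alpha> \<noteq> 0} \<inter>
     {P. \<forall>s. real s \<le> l \<longrightarrow> jet_coeff g s P = 0}"


section \<open>The Zariski topology on the jet spaces\<close>

inductive_set poly_funs :: "('k::comm_ring_1 arc \<Rightarrow> 'k) set" where
  const: "(\<lambda>_. c) \<in> poly_funs"
| x_coord: "(\<lambda>(x, y). x $ j) \<in> poly_funs"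
| y_coord: "(\<lambda>(x, y). y $ j) \<in> poly_funs"
| add: "\<phi> \<in> poly_funs \<Longrightarrow> \<psi> \<in> poly_funs \<Longrightarrow> (\<lambda>P. \<phi> P + \<psi> P) \<in> poly_funs"
| mult: "\<phi> \<in> poly_funs \<Longrightarrow> \<psi> \<in> poly_funs \<Longrightarrow> (\<lambda>P. \<phi> P * \<psi> P) \<in> poly_funs"

definition zariski_open :: "nat \<Rightarrow> 'k::field arc set \<Rightarrow> bool" where
  "zariski_open m U \<longleftrightarrow> (\<exists>S\<subseteq>poly_funs. U = jet_space m - {P. \<forall>\<phi>\<in>S. \<phi> P = 0})"

definition zariski :: "nat \<Rightarrow> 'k::field arc topology" where
  "zariski m = topology (zariski_open m)"

lemma istopology_zariski_open: "istopology (zariski_open m :: 'k::field arc set \<Rightarrow> bool)"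
  unfolding istopology_def
proof (intro conjI allI impI)
  fix U V :: "'k arc set"
  assume "zariski_open m U" "zariski_open m V"
  then obtain S T where ST: "S \<subseteq> poly_funs" "U = jet_space m - {P. \<forall>\<phi>\<in>S. \<phi> P = 0}"
    "T \<subseteq> poly_funs" "V = jet_space m - {P. \<forall>\<phi>\<in>T. \<phi> P = 0}"
    by (auto simp: zariski_open_def)
  define R where "R = (\<Union>\<phi>\<in>S. (\<lambda>\<psi> P. \<phi> P * \<psi> P) ` T)"
  have "R \<subseteq> poly_funs"
    using ST(1,3) by (auto simp: R_def intro!: poly_funs.mult)
  moreover have "U \<inter> V = jet_space m - {P. \<forall>\<phi>\<in>R. \<phi> P = 0}"
  proof (rule set_eqI)
    fix P :: "'k arc"
    have "(\<exists>\<chi>\<in>R. \<chi> P \<noteq> 0) \<longleftrightarrow> (\<exists>\<phi>\<in>S. \<exists>\<psi>\<in>T. \<phi> P * \<psi> P \<noteq> 0)"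
      by (simp add: R_def)
    then have "(\<exists>\<chi>\<in>R. \<chi> P \<noteq> 0) \<longleftrightarrow> (\<exists>\<phi>\<in>S. \<phi> P \<noteq> 0) \<and> (\<exists>\<psi>\<in>T. \<psi> P \<noteq> 0)"
      by simp
    then show "P \<in> U \<inter> V \<longleftrightarrow> P \<in> jet_space m - {P. \<forall>\<chi>\<in>R. \<chi> P = 0}"
      unfolding ST(2,4) by blast
  qed
  ultimately show "zariski_open m (U \<inter> V)"
    unfolding zariski_open_def by blast
next
  fix \<U> :: "'k arc set set"
  assume "\<forall>U\<in>\<U>. zariski_open m U"
  then have "\<forall>U\<in>\<U>. \<exists>S. S \<subseteq> poly_funs \<and> U = jet_space m - {P. \<forall>\<phi>\<in>S. \<phi> P = 0}"
    by (simp add: zariski_open_def)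
  from bchoice[OF this] obtain S where
    S: "\<forall>U\<in>\<U>. S U \<subseteq> poly_funs \<and> U = jet_space m - {P. \<forall>\<phi>\<in>S U. \<phi> P = 0}" ..
  have "\<Union>\<U> = (\<Union>U\<in>\<U>. U)"
    by simp
  also have "\<dots> = (\<Union>U\<in>\<U>. jet_space m - {P. \<forall>\<phi>\<in>S U. \<phi> P = 0})"
    by (rule SUP_cong[OF refl bspec[OF S, THEN conjunct2]])
  also have "\<dots> = jet_space m - {P. \<forall>\<phi>\<in>(\<Union>U\<in>\<U>. S U). \<phi> P = 0}"
    by auto
  finally have "\<Union>\<U> = jet_space m - {P. \<forall>\<phi>\<in>(\<Union>U\<in>\<U>. S U). \<phi> P = 0}" .
  moreover have "(\<Union>U\<in>\<U>. S U) \<subseteq> poly_funs"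
    by (rule UN_least) (rule bspec[OF S, THEN conjunct1])
  ultimately show "zariski_open m (\<Union>\<U>)"
    unfolding zariski_open_def by (intro exI conjI)
qed

lemma openin_zariski: "openin (zariski m) = zariski_open m"
  by (simp add: zariski_def istopology_zariski_open)

lemma topspace_zariski [simp]: "topspace (zariski m :: 'k::field arc topology) = jet_space m"
proof
  show "topspace (zariski m) \<subseteq> (jet_space m :: 'k arc set)"
    by (auto simp: topspace_def openin_zariski zariski_open_def)
  have "zariski_open m (jet_space m :: 'k arc set)"
    unfolding zariski_open_def
    by (rule exI[of _ "{\<lambda>_. 1}"]) (auto intro: poly_funs.const)
  then show "(jet_space m :: 'k arc set) \<subseteq> topspace (zariski m)"
    by (auto simp: topspace_def openin_zariski)
qed

lemma closedin_zariski:
  "closedin (zariski m) Z \<longleftrightarrow> (\<exists>S\<subseteq>poly_funs. Z = {P \<in> jet_space m. \<forall>\<phi>\<in>S. \<phi> P = 0})"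
  (is "_ \<longleftrightarrow> ?R")
proof
  assume "closedin (zariski m) Z"
  then obtain S where "Z \<subseteq> jet_space m" "S \<subseteq> poly_funs"
    "jet_space m - Z = jet_space m - {P. \<forall>\<phi>\<in>S. \<phi> P = 0}"
    by (auto simp: closedin_def openin_zariski zariski_open_def)
  then show ?R
    by (intro exI[of _ S]) blast
next
  assume ?R
  then show "closedin (zariski m) Z"
    unfolding closedin_def openin_zariski zariski_open_def by auto
qed

definition F_bar :: "'k::field fps fps \<Rightarrow> 'k fps fps \<Rightarrow> nat \<Rightarrow> nat \<times> nat \<Rightarrow> 'k arc set" where
  "F_bar f g m \<alpha> = zariski m closure_of (jet_space m \<inter>
     F_set g \<alpha> (nu (real_pair \<alpha>) g + real m - nu (real_pair \<alpha>) f))"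

definition irreducible_subset :: "'a topology \<Rightarrow> 'a set \<Rightarrow> bool" where
  "irreducible_subset X S \<longleftrightarrow> S \<subseteq> topspace X \<and> S \<noteq> {} \<and>
     (\<forall>A B. closedin X A \<and> closedin X B \<and> S \<subseteq> A \<union> B \<longrightarrow> S \<subseteq> A \<or> S \<subseteq> B)"

definition irreducible_components :: "'a topology \<Rightarrow> 'a set \<Rightarrow> 'a set set" where
  "irreducible_components X C =
     {Z. Z \<subseteq> C \<and> irreducible_subset X Z \<and>
         (\<forall>Z'. Z \<subseteq> Z' \<and> Z' \<subseteq> C \<and> irreducible_subset X Z' \<longrightarrow> Z' = Z)}"


section \<open>Index sets\<close>

definition pos_pairs :: "(nat \<times> nat) set" where
  "pos_pairs = {1..} \<times> {1..}"

definition A_idx :: "'k::zero fps fps \<Rightarrow> 'k fps fps \<Rightarrow> nat \<Rightarrow> (nat \<times> nat) set" where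
  "A_idx f fi m = {\<alpha> \<in> pos_pairs. real_pair \<alpha> \<in> tropical_variety fi \<and> nu (real_pair \<alpha>) f \<le> real m}"

definition B_idx :: "'k::zero fps fps \<Rightarrow> nat \<Rightarrow> (nat \<times> nat) set" where
  "B_idx f m = (let S = {\<gamma> \<in> pos_pairs. nu (real_pair \<gamma>) f > real m}
            in {\<gamma> \<in> S. \<forall>\<delta>\<in>S. \<delta> \<le> \<gamma> \<longrightarrow> \<delta> = \<gamma>})"

text \<open>
  For a cone \<open>\<sigma>\<close> spanned by finitely many rays of the plane, the topological boundary is the union
  of the two extremal rays of \<open>\<sigma>\<close> if there are at least two rays, and \<open>\<sigma>\<close> itself if there is
  just one.
\<close>

definition B_star :: "'k::zero fps fps \<Rightarrow> nat \<Rightarrow> (nat \<times> nat) set" where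
  "B_star f m = B_idx f m -
     {\<alpha> + (1, 1) |\<alpha>. \<alpha> \<in> B_idx f (m - 1) \<and>
        real_pair \<alpha> \<in> frontier (convex hull (tropical_variety f)) \<and>
        nu (real_pair \<alpha>) f = real m}"

end

theory Submission
  imports Defs "HOL-Library.Function_Algebras"
begin

text \<open>
  Let \<open>\<alpha>\<close> be the pair of orders of an arc \<open>(x, y)\<close>. Each branch \<open>f\<^sub>k\<close> not vanishing to higher order along
  the arc contributes exactly \<open>\<nu>\<^sub>\<alpha>(f\<^sub>k)\<close> to the order of \<open>f(x, y)\<close>, and by non-degeneracy at most one branch
  vanishes to higher order, with \<open>\<alpha>\<close> on its ray. Hence \<open>\<C>\<^sup>0\<^sub>m\<close> is the union of the sets \<open>\<H>\<^sup>\<gamma>\<close> with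
  \<open>\<nu>\<^sub>\<gamma>(f) > m\<close> and of the sets \<open>F\<^sup>\<alpha>\<close>. On \<open>F\<^sup>\<alpha>\<close> the leading coefficients are \<open>\<tau>\<^sup>p\<close> and \<open>\<kappa>\<tau>\<^sup>q\<close>, and
  the remaining equations are successively linear in the coefficients of \<open>y\<close> (or of \<open>x\<close>) with a nonzero
  slope; this parametrizes \<open>F\<^sup>\<alpha>\<close> by an open subset of an affine space, so \<open>F\<^sup>\<alpha>\<close> is irreducible.

  Most inclusions between these sets are excluded by comparing orders along a branch. The others,
  \<open>\<H>\<^sup>\<gamma>\<close> in the closure of \<open>F\<^sup>\<alpha>\<close> and \<open>F\<^sup>\<alpha>\<close> in the closure of \<open>F\<^sup>\<beta>\<close> for a single branch, are excluded by
  dimension, in the elementary form that more functions than parameters are algebraically dependent.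
  The only inclusion that survives is \<open>\<gamma> = \<alpha> + (1, 1)\<close> with \<open>\<nu>\<^sub>\<alpha>(f) = m\<close>. Minimality of such a \<open>\<gamma>\<close> forces
  all branches onto the ray of \<open>\<alpha>\<close>, so this is exactly what \<open>B\<^sup>*\<^sub>m\<close> removes.
\<close>

section \<open>Weighted orders and arcs\<close>

text \<open>The characteristic of the field is arbitrary, so neither variable can be preferred in
  solving the equations on F. Coprimality of p and q only ensures that p or q is nonzero in the
  field, hence that one partial derivative of y^p - c x^q has no zero on the torus; this decides
  which variable is solved for. The dimension counts rest on pq - p - q >= 1 for coprime p, q >= 2.
  When there is only one branch, singularity at the origin excludes p = 1 and q = 1. When there are
  several, the orders of the remaining branches grow strictly as soon as both coordinates of
  \<alpha> grow; this strict growth replaces the dimension count between two F-sets and settles the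
  case p = 1 or q = 1 for H-sets. Newton polyhedra enter only at the end, for three facts:
  non-degeneracy makes the constants c of branches on a common ray distinct, each T(f_i) is the ray
  of any of its branches, and a point lying on the rays of all branches lies on the boundary of the
  cone.\<close>

definition ev :: "'k::comm_ring_1 fps fps \<Rightarrow> 'k arc \<Rightarrow> 'k fps" where
  "ev h P = Abs_fps (\<lambda>l. jet_coeff h l P)"

lemma ev_nth [simp]: "ev h P $ l = jet_coeff h l P"
  by (simp add: ev_def)

definition centered :: "'k::zero arc \<Rightarrow> bool" where
  "centered P \<longleftrightarrow> fst P $ 0 = 0 \<and> snd P $ 0 = 0"

lemma H_inf_centered: "P \<in> H_inf \<alpha> \<Longrightarrow> \<alpha> \<in> pos_pairs \<Longrightarrow> centered P"
  by (auto simp: H_inf_def pos_pairs_def centered_def)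

lemma fps_shift_factor:
  fixes x :: "'k::comm_ring_1 fps"
  assumes "\<And>i. i < n \<Longrightarrow> x $ i = 0"
  shows "x = fps_X ^ n * fps_shift n x"
  using assms by (intro fps_ext) (simp add: fps_X_power_mult_nth)

lemma shifted_monomial_nth:
  fixes x' y' :: "'k::comm_ring_1 fps"
  assumes "x = fps_X ^ v * x'" "y = fps_X ^ w * y'"
  shows "(x ^ a * y ^ b) $ n =
    (if n < v * a + w * b then 0 else (x' ^ a * y' ^ b) $ (n - (v * a + w * b)))"
proof -
  have "x ^ a = fps_X ^ (v * a) * x' ^ a" "y ^ b = fps_X ^ (w * b) * y' ^ b"
    by (simp_all add: assms power_mult_distrib power_mult)
  then have "x ^ a * y ^ b = fps_X ^ (v * a + w * b) * (x' ^ a * y' ^ b)"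
    by (simp add: power_add mult_ac)
  then show ?thesis by (simp add: fps_X_power_mult_nth)
qed

lemma monomial_nth_eq_0:
  fixes x y :: "'k::comm_ring_1 fps"
  assumes "(x, y) \<in> H_inf \<alpha>" "n < fst \<alpha> * a + snd \<alpha> * b"
  shows "(x ^ a * y ^ b) $ n = 0"
  using shifted_monomial_nth[OF fps_shift_factor fps_shift_factor, of "fst \<alpha>" x "snd \<alpha>" y a b n] assms
  by (auto simp: H_inf_def)

lemma centered_H_inf: "centered P \<longleftrightarrow> P \<in> H_inf (1, 1)"
  by (cases P) (auto simp: H_inf_def centered_def)

text \<open>Along a centered arc the monomial with exponents a, b has order at least a + b, so the
  formally infinite sum stops at l. The two bounds stay free so that one box can serve several
  levels or contain a given exponent.\<close>

lemma jet_coeff_box: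
  fixes h :: "'k::comm_ring_1 fps fps"
  assumes "centered (x, y)" "l \<le> M" "l \<le> N"
  shows "jet_coeff h l (x, y) = (\<Sum>a\<le>M. \<Sum>b\<le>N. h $ a $ b * (x ^ a * y ^ b) $ l)"
proof -
  have z: "(x ^ a * y ^ b) $ l = 0" if "l < a + b" for a b
    using monomial_nth_eq_0[of x y "(1,1)" l a b] that assms(1) by (simp add: centered_H_inf)
  have "jet_coeff h l (x, y) = (\<Sum>(a, b)\<in>{..M} \<times> {..N}. h $ a $ b * (x ^ a * y ^ b) $ l)"
    unfolding jet_coeff_def prod.case
  proof (rule Sum_any.expand_superset)
    show "{p. (case p of (a, b) \<Rightarrow> h $ a $ b * (x ^ a * y ^ b) $ l) \<noteq> 0} \<subseteq> {..M} \<times> {..N}"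
    proof clarify
      fix a b assume "h $ a $ b * (x ^ a * y ^ b) $ l \<noteq> 0"
      then have "(x ^ a * y ^ b) $ l \<noteq> 0" by auto
      with z[of a b] have "\<not> l < a + b" by blast
      with assms show "a \<in> {..M} \<and> b \<in> {..N}" by auto
    qed
  qed simp
  then show ?thesis by (simp add: sum.cartesian_product)
qed

lemma jet_coeff_add:
  assumes "centered P" shows "jet_coeff (h + h') l P = jet_coeff h l P + jet_coeff h' l P"
  using assms by (cases P) (simp add: jet_coeff_box[where M=l and N=l] sum.distrib algebra_simps)

lemma jet_coeff_diff:
  assumes "centered P" shows "jet_coeff (h - h') l P = jet_coeff h l P - jet_coeff h' l P"
  using assms by (cases P) (simp add: jet_coeff_box[where M=l and N=l] sum_subtractf algebra_simps)

lemma jet_coeff_cmult: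
  assumes "centered P" shows "jet_coeff (fps_const (fps_const c) * h) l P = c * jet_coeff h l P"
  using assms by (cases P) (simp add: jet_coeff_box[where M=l and N=l] sum_distrib_left algebra_simps)

text \<open>Summing over the exponent of y first turns each row of \<open>h\<close> into an ordinary
  composition with the series y, for which multiplicativity is known.\<close>

lemma ev_nth_compose:
  assumes "centered (x, y)" "l \<le> M"
  shows "ev h (x, y) $ l = (\<Sum>a\<le>M. (x ^ a * (h $ a oo y)) $ l)"
proof -
  have "(x ^ a * (h $ a oo y)) $ l = (\<Sum>b\<le>l. h $ a $ b * (x ^ a * y ^ b) $ l)" for a
  proof -
    have y: "(y ^ b) $ i = 0" if "i < b" for i b
      using assms(1) that startsby_zero_power_prefix[of y b] by (auto simp: centered_def)
    have "(h $ a oo y) $ i = (\<Sum>b\<le>l. h $ a $ b * (y ^ b) $ i)" if "i \<le> l" for i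
      unfolding fps_compose_nth using that y
      by (intro sum.mono_neutral_left) (auto simp: not_le)
    then have "(x ^ a * (h $ a oo y)) $ l = (\<Sum>i\<le>l. \<Sum>b\<le>l. (x ^ a) $ i * (h $ a $ b * (y ^ b) $ (l - i)))"
      by (simp add: fps_mult_nth atLeast0AtMost sum_distrib_left)
    also have "\<dots> = (\<Sum>b\<le>l. h $ a $ b * (x ^ a * y ^ b) $ l)"
      by (subst sum.swap) (simp add: fps_mult_nth atLeast0AtMost sum_distrib_left algebra_simps)
    finally show ?thesis .
  qed
  then show ?thesis
    using jet_coeff_box[OF assms(1,2) order.refl, of h] by simp
qed

lemma fps_mult_nth_cong:
  assumes "\<And>i. i \<le> l \<Longrightarrow> f $ i = f' $ i" "\<And>i. i \<le> l \<Longrightarrow> g $ i = g' $ i"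
  shows "(f * g) $ l = (f' * g') $ l"
  unfolding fps_mult_nth by (intro sum.cong) (auto simp: assms)

text \<open>Substitution of an arc is a ring homomorphism. With it, orders of vanishing along an arc
  become subdegrees that add over the factors of f.\<close>

lemma ev_mult:
  fixes h h' :: "'k::idom fps fps"
  assumes "centered P"
  shows "ev (h * h') P = ev h P * ev h' P"
proof (cases P)
  case (Pair x y)
  have c: "centered (x, y)" using assms Pair by simp
  have y0: "y $ 0 = 0" and x0: "x $ 0 = 0" using c by (auto simp: centered_def)
  have "ev (h * h') (x, y) $ l = (ev h (x, y) * ev h' (x, y)) $ l" for l
  proof -
    define H where "H a = x ^ a * (h $ a oo y)" for a
    define H' where "H' a = x ^ a * (h' $ a oo y)" for a
    have vanish: "(H i * H' j) $ l = 0" if "l < i + j" for i j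
    proof -
      have "H i * H' j = x ^ (i + j) * ((h $ i oo y) * (h' $ j oo y))"
        by (simp add: H_def H'_def power_add algebra_simps)
      moreover have "(x ^ (i + j)) $ n = 0" if "n \<le> l" for n
        using startsby_zero_power_prefix[OF x0, of "i + j"] that \<open>l < i + j\<close> by simp
      ultimately show ?thesis by (simp add: fps_mult_nth)
    qed
    have "ev (h * h') (x, y) $ l = (\<Sum>n\<le>l. (\<Sum>i\<le>n. H i * H' (n - i)) $ l)"
      unfolding ev_nth_compose[OF c order.refl]
    proof (intro sum.cong refl, goal_cases)
      case (1 n)
      have "x ^ n * ((h * h') $ n oo y) = (\<Sum>i\<le>n. H i * H' (n - i))"
        unfolding fps_mult_nth fps_compose_sum_distrib sum_distrib_left atLeast0AtMost
      proof (intro sum.cong refl, goal_cases)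
        case (1 i)
        then have "x ^ n = x ^ i * x ^ (n - i)" by (simp flip: power_add)
        then show ?case by (simp only: H_def H'_def fps_compose_mult_distrib[OF y0] mult_ac)
      qed
      then show ?case by simp
    qed
    also have "\<dots> = (\<Sum>n\<le>l. \<Sum>i\<le>n. (H i * H' (n - i)) $ l)" by (simp add: fps_sum_nth)
    also have "\<dots> = (\<Sum>(i, j)\<in>{(i, j). i + j \<le> l}. (H i * H' j) $ l)"
      by (rule sum.triangle_reindex_eq[symmetric])
    \<comment> \<open>The triangle may be enlarged to a square because the added products have order
      above l; the square then factors.\<close>
    also have "\<dots> = (\<Sum>(i, j)\<in>{..l} \<times> {..l}. (H i * H' j) $ l)"
      using vanish by (intro sum.mono_neutral_left) (auto simp: not_le[symmetric])
    also have "\<dots> = ((\<Sum>i\<le>l. H i) * (\<Sum>j\<le>l. H' j)) $ l"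
      by (simp add: sum_product fps_sum_nth flip: sum.cartesian_product)
    also have "\<dots> = (ev h (x, y) * ev h' (x, y)) $ l"
      by (rule fps_mult_nth_cong)
         (simp_all add: fps_sum_nth H_def H'_def ev_nth_compose[OF c, where M=l, symmetric] del: ev_nth)
    finally show ?thesis .
  qed
  then show ?thesis by (simp add: Pair fps_eq_iff del: ev_nth)
qed

lemma jet_coeff_1: "centered P \<Longrightarrow> jet_coeff (1 :: 'k::comm_ring_1 fps fps) l P = (if l = 0 then 1 else 0)"
proof (cases P)
  case (Pair x y)
  assume "centered P"
  then have "jet_coeff (1 :: 'k fps fps) l P = (\<Sum>a\<le>l. \<Sum>b\<le>l. (if a = 0 \<and> b = 0 then 1 else 0) * (x ^ a * y ^ b) $ l)"
    unfolding Pair jet_coeff_box[OF \<open>centered P\<close>[unfolded Pair] order.refl order.refl]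
    by (intro sum.cong refl) (auto)
  also have "\<dots> = (\<Sum>a\<le>l. if a = 0 then (\<Sum>b\<le>l. if b = 0 then (x ^ a * y ^ b) $ l else 0) else 0)"
    by (intro sum.cong refl) (simp add: if_distrib[of "\<lambda>c. c * _"] cong: if_cong)
  also have "\<dots> = (if l = 0 then 1 else 0)"
    unfolding sum.delta[OF finite_atMost] by simp
  finally show ?thesis .
qed

section \<open>Weighted orders and initial forms\<close>

definition wt :: "nat \<times> nat \<Rightarrow> nat \<times> nat \<Rightarrow> nat" where
  "wt w e = fst w * fst e + snd w * snd e"

text \<open>The image of \<open>h\<close> under \<open>x \<mapsto> x t\<^bsup>w\<^sub>1\<^esup>\<close>, \<open>y \<mapsto> y t\<^bsup>w\<^sub>2\<^esup>\<close>, as a power series in \<open>t\<close>: weighted orders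
  and initial forms become orders and leading coefficients over an integral domain.\<close>

definition wt_fps :: "nat \<times> nat \<Rightarrow> 'k::comm_ring_1 fps fps \<Rightarrow> 'k poly poly fps" where
  "wt_fps w h = Abs_fps (\<lambda>n. \<Sum>a\<le>n. \<Sum>b\<le>n. monom (monom (if wt w (a, b) = n then h $ a $ b else 0) b) a)"

text \<open>Positive weights bound both exponents of a monomial of weight n by n, so the finite box
  in the definition loses nothing.\<close>

lemma coeff_wt_fps:
  assumes "w \<in> pos_pairs"
  shows "coeff (coeff (wt_fps w h $ n) a) b = (if wt w (a, b) = n then h $ a $ b else 0)"
proof -
  have "coeff (coeff (wt_fps w h $ n) a) b =
     (\<Sum>a'\<le>n. \<Sum>b'\<le>n. if a' = a \<and> b' = b then (if wt w (a', b') = n then h $ a' $ b' else 0) else 0)"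
    unfolding wt_fps_def
    by (auto simp: coeff_sum intro!: sum.cong)
  also have "\<dots> = (\<Sum>a'\<le>n. if a' = a then (\<Sum>b'\<le>n. if b' = b then (if wt w (a', b') = n then h $ a' $ b' else 0) else 0) else 0)"
    by (intro sum.cong refl) (auto intro!: sum.cong)
  also have "\<dots> = (if a \<le> n \<and> b \<le> n then (if wt w (a, b) = n then h $ a $ b else 0) else 0)"
    by (simp add: sum.delta)
  also have "\<dots> = (if wt w (a, b) = n then h $ a $ b else 0)"
  proof -
    have "a \<le> fst w * a" "b \<le> snd w * b" using assms by (auto simp: pos_pairs_def)
    then have "a \<le> wt w (a, b)" "b \<le> wt w (a, b)" unfolding wt_def fst_conv snd_conv by linarith+
    then show ?thesis by auto
  qed
  finally show ?thesis .
qed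

lemma wt_fps_mult:
  assumes "w \<in> pos_pairs"
  shows "wt_fps w (h * h') = wt_fps w h * wt_fps w h'"
proof (rule fps_ext, rule poly_eqI, rule poly_eqI)
  fix n a b
  have "coeff (coeff ((wt_fps w h * wt_fps w h') $ n) a) b =
     (\<Sum>i\<le>n. \<Sum>a'\<le>a. \<Sum>b'\<le>b. (if wt w (a', b') = i then h $ a' $ b' else 0) *
        (if wt w (a - a', b - b') = n - i then h' $ (a - a') $ (b - b') else 0))"
    by (simp add: fps_mult_nth atLeast0AtMost coeff_sum coeff_mult coeff_wt_fps[OF assms])
  also have "\<dots> = (\<Sum>a'\<le>a. \<Sum>b'\<le>b. \<Sum>i\<le>n. (if wt w (a', b') = i then h $ a' $ b' else 0) *
        (if wt w (a - a', b - b') = n - i then h' $ (a - a') $ (b - b') else 0))"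
    by (simp only: sum.swap[of _ "{..n}"])
  also have "\<dots> = (\<Sum>a'\<le>a. \<Sum>b'\<le>b. if wt w (a, b) = n then h $ a' $ b' * h' $ (a - a') $ (b - b') else 0)"
  proof (intro sum.cong refl, goal_cases)
    case (1 a' b')
    have "fst w * a = fst w * a' + fst w * (a - a')" "snd w * b = snd w * b' + snd w * (b - b')"
      using 1 by (simp_all flip: distrib_left)
    then have s: "wt w (a, b) = wt w (a', b') + wt w (a - a', b - b')"
      by (simp add: wt_def)
    have "(\<Sum>i\<le>n. (if wt w (a', b') = i then h $ a' $ b' else 0) *
        (if wt w (a - a', b - b') = n - i then h' $ (a - a') $ (b - b') else 0)) =
        (\<Sum>i\<le>n. if wt w (a', b') = i then h $ a' $ b' *
        (if wt w (a - a', b - b') = n - i then h' $ (a - a') $ (b - b') else 0) else 0)"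
      by (intro sum.cong) auto
    also have "\<dots> = (if wt w (a, b) = n then h $ a' $ b' * h' $ (a - a') $ (b - b') else 0)"
      using s by (auto simp: sum.delta)
    finally show ?case .
  qed
  also have "\<dots> = (if wt w (a, b) = n then (h * h') $ a $ b else 0)"
    by (simp add: fps_mult_nth fps_sum_nth atLeast0AtMost)
  finally show "coeff (coeff (wt_fps w (h * h') $ n) a) b = coeff (coeff ((wt_fps w h * wt_fps w h') $ n) a) b"
    by (simp add: coeff_wt_fps[OF assms])
qed

lemma wt_fps_1: 
  assumes "w \<in> pos_pairs"
  shows "wt_fps w 1 = 1"
proof (rule fps_ext, rule poly_eqI, rule poly_eqI)
  fix n a b
  have "wt w (a, b) = 0 \<longleftrightarrow> a = 0 \<and> b = 0" using assms by (auto simp: wt_def pos_pairs_def)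
  then show "coeff (coeff (wt_fps w 1 $ n) a) b = coeff (coeff (1 $ n) a) b"
    by (auto simp: coeff_wt_fps[OF assms] wt_def)
qed

lemma wt_fps_prod:
  assumes "w \<in> pos_pairs"
  shows "wt_fps w (\<Prod>j\<in>J. g j) = (\<Prod>j\<in>J. wt_fps w (g j))"
  by (induction J rule: infinite_finite_induct) (simp_all add: wt_fps_1 wt_fps_mult assms)

lemma wt_fps_eq_0_iff:
  assumes "w \<in> pos_pairs"
  shows "wt_fps w h = 0 \<longleftrightarrow> h = 0"
proof
  assume "wt_fps w h = 0"
  then have "coeff (coeff (wt_fps w h $ (wt w (a, b))) a) b = 0" for a b by simp
  then show "h = 0" by (intro fps_ext) (simp add: coeff_wt_fps[OF assms])
next
  assume "h = 0" then show "wt_fps w h = 0" by (intro fps_ext poly_eqI) (simp add: coeff_wt_fps[OF assms])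
qed

definition wt_order :: "nat \<times> nat \<Rightarrow> 'k::comm_ring_1 fps fps \<Rightarrow> nat" where
  "wt_order w h = subdegree (wt_fps w h)"

definition init_form :: "nat \<times> nat \<Rightarrow> 'k::comm_ring_1 fps fps \<Rightarrow> 'k poly poly" where
  "init_form w h = wt_fps w h $ wt_order w h"

lemma wt_order_prod:
  fixes g :: "'j \<Rightarrow> 'k::idom fps fps"
  assumes "w \<in> pos_pairs" "\<And>j. j \<in> J \<Longrightarrow> g j \<noteq> 0"
  shows "wt_order w (\<Prod>j\<in>J. g j) = (\<Sum>j\<in>J. wt_order w (g j))"
  using assms by (simp add: wt_order_def wt_fps_prod subdegree_prod wt_fps_eq_0_iff)

lemma wt_order_mult:
  fixes h h' :: "'k::idom fps fps"
  assumes "w \<in> pos_pairs" "h \<noteq> 0" "h' \<noteq> 0"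
  shows "wt_order w (h * h') = wt_order w h + wt_order w h'"
  using assms by (simp add: wt_order_def wt_fps_mult wt_fps_eq_0_iff)

lemma init_form_mult:
  fixes h h' :: "'k::idom fps fps"
  assumes "w \<in> pos_pairs" "h \<noteq> 0" "h' \<noteq> 0"
  shows "init_form w (h * h') = init_form w h * init_form w h'"
  using assms wt_order_mult[OF assms] by (simp add: init_form_def wt_fps_mult wt_order_def)

lemma wt_order_le:
  assumes "w \<in> pos_pairs" "h $ a $ b \<noteq> 0"
  shows "wt_order w h \<le> wt w (a, b)"
proof -
  have "coeff (coeff (wt_fps w h $ wt w (a, b)) a) b \<noteq> 0" using assms by (simp add: coeff_wt_fps)
  then have "wt_fps w h $ wt w (a, b) \<noteq> 0" by auto
  then show ?thesis unfolding wt_order_def by (rule subdegree_leI)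
qed

lemma wt_order_eqI:
  assumes w: "w \<in> pos_pairs" and "h $ a $ b \<noteq> 0" "wt w (a, b) = n"
    and ge: "\<And>a b. h $ a $ b \<noteq> 0 \<Longrightarrow> n \<le> wt w (a, b)"
  shows "wt_order w h = n"
  unfolding wt_order_def
proof (rule subdegreeI)
  show "wt_fps w h $ n \<noteq> 0"
    using coeff_wt_fps[OF w, of h n a b] assms by auto
  show "wt_fps w h $ i = 0" if "i < n" for i
    using ge that by (intro poly_eqI) (force simp: coeff_wt_fps[OF w])
qed

lemma wt_order_attained:
  assumes "w \<in> pos_pairs" "h \<noteq> 0"
  obtains a b where "h $ a $ b \<noteq> 0" "wt w (a, b) = wt_order w h"
proof -
  have "wt_fps w h $ wt_order w h \<noteq> 0" using assms by (simp add: wt_order_def wt_fps_eq_0_iff)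
  then obtain a where "coeff (wt_fps w h $ wt_order w h) a \<noteq> 0" by (auto simp: poly_eq_iff)
  then obtain b where "coeff (coeff (wt_fps w h $ wt_order w h) a) b \<noteq> 0" by (auto simp: poly_eq_iff)
  then show thesis using that[of a b] by (auto simp: coeff_wt_fps[OF assms(1)] split: if_splits)
qed

lemma inner_real_pair: "real_pair w \<bullet> real_pair e = real (wt w e)"
  by (cases w; cases e) (simp add: wt_def inner_prod_def)

text \<open>Replaces the real infimum by a natural number, so that the later comparisons of orders
  are arithmetic in \<open>nat\<close>.\<close>

lemma nu_eq_wt_order:
  assumes "w \<in> pos_pairs" "h \<noteq> 0"
  shows "nu (real_pair w) h = real (wt_order w h)"
proof -
  obtain a b where ab: "h $ a $ b \<noteq> 0" "wt w (a, b) = wt_order w h"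
    using wt_order_attained[OF assms] .
  show ?thesis unfolding nu_def
  proof (rule cInf_eq_minimum)
    show "real (wt_order w h) \<in> (\<lambda>p. real_pair w \<bullet> real_pair p) ` supp h"
      using ab by (intro image_eqI[of _ _ "(a, b)"]) (auto simp: inner_real_pair supp_def simp del: map_prod_simp)
  next
    fix x assume "x \<in> (\<lambda>p. real_pair w \<bullet> real_pair p) ` supp h"
    then obtain a b where "h $ a $ b \<noteq> 0" "x = real_pair w \<bullet> real_pair (a, b)" by (auto simp: supp_def)
    then show "real (wt_order w h) \<le> x"
      using wt_order_le[OF assms(1), of h a b] by (simp add: inner_real_pair del: map_prod_simp)
  qed
qed

section \<open>Leading coefficients along arcs as values of initial forms\<close>

lemma poly_eq_sum_atMost:
  fixes p :: "'k::comm_ring_1 poly"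
  assumes "degree p \<le> n"
  shows "poly p x = (\<Sum>i\<le>n. coeff p i * x ^ i)"
  unfolding poly_altdef using assms
  by (intro sum.mono_neutral_left ballI) (auto simp: not_le coeff_eq_0)

lemma poly2_eq_sum:
  assumes "degree F \<le> A" "\<And>a. degree (coeff F a) \<le> B"
  shows "poly2 F u v = (\<Sum>a\<le>A. \<Sum>b\<le>B. coeff (coeff F a) b * (u ^ a * v ^ b))"
proof -
  have "poly2 F u v = (\<Sum>a\<le>A. poly (coeff F a) v * u ^ a)"
    unfolding poly2_def poly_eq_sum_atMost[OF assms(1)] by (simp add: poly_sum poly_power mult.commute)
  also have "\<dots> = (\<Sum>a\<le>A. \<Sum>b\<le>B. coeff (coeff F a) b * (u ^ a * v ^ b))"
    unfolding poly_eq_sum_atMost[OF assms(2)] by (simp add: sum_distrib_left sum_distrib_right algebra_simps)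
  finally show ?thesis .
qed

lemma poly2_mult [simp]: "poly2 (F * G) u v = poly2 F u v * poly2 G u v"
  by (simp add: poly2_def)

lemma poly2_add [simp]: "poly2 (F + G) u v = poly2 F u v + poly2 G u v"
  by (simp add: poly2_def)

lemma jet_coeff_H_inf:
  fixes h :: "'k::comm_ring_1 fps fps"
  assumes "(x, y) \<in> H_inf \<alpha>" "\<alpha> \<in> pos_pairs" "l \<le> N"
  shows "jet_coeff h l (x, y) = (\<Sum>a\<le>N. \<Sum>b\<le>N. if wt \<alpha> (a, b) \<le> l then
    h $ a $ b * (fps_shift (fst \<alpha>) x ^ a * fps_shift (snd \<alpha>) y ^ b) $ (l - wt \<alpha> (a, b)) else 0)"
  unfolding jet_coeff_box[OF H_inf_centered[OF assms(1,2)] assms(3,3)]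
  using assms(1)
  by (intro sum.cong refl, subst shifted_monomial_nth[OF fps_shift_factor[of "fst \<alpha>"] fps_shift_factor[of "snd \<alpha>"]])
     (auto simp: H_inf_def wt_def not_less)

lemma jet_coeff_below:
  assumes "P \<in> H_inf \<alpha>" "\<alpha> \<in> pos_pairs" "l < wt_order \<alpha> h"
  shows "jet_coeff h l P = 0"
proof (cases P)
  case (Pair x y)
  show ?thesis unfolding Pair jet_coeff_H_inf[OF assms(1)[unfolded Pair] assms(2) order.refl]
  proof (intro sum.neutral ballI, goal_cases)
    case (1 a b)
    then show ?case using wt_order_le[OF assms(2), of h a b] assms(3) by force
  qed
qed

text \<open>At the lowest possible level only monomials of minimal weight contribute, and each
  through the constant terms of the shifted series, which are the leading coefficients of the
  arc.\<close>

lemma jet_coeff_initial: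
  assumes "(x, y) \<in> H_inf \<alpha>" "\<alpha> \<in> pos_pairs"
  shows "jet_coeff h (wt_order \<alpha> h) (x, y) = poly2 (init_form \<alpha> h) (x $ fst \<alpha>) (y $ snd \<alpha>)"
proof -
  let ?n = "wt_order \<alpha> h"
  have b: "a \<le> ?n" "b \<le> ?n" if "coeff (coeff (init_form \<alpha> h) a) b \<noteq> 0" for a b
  proof -
    have "wt \<alpha> (a, b) = ?n" using that by (auto simp: init_form_def coeff_wt_fps[OF assms(2)] split: if_splits)
    moreover have "a \<le> fst \<alpha> * a" "b \<le> snd \<alpha> * b" using assms(2) by (auto simp: pos_pairs_def)
    ultimately show "a \<le> ?n" "b \<le> ?n" unfolding wt_def fst_conv snd_conv by linarith+
  qed
  have "poly2 (init_form \<alpha> h) (x $ fst \<alpha>) (y $ snd \<alpha>) = (\<Sum>a\<le>?n. \<Sum>b\<le>?n. coeff (coeff (init_form \<alpha> h) a) b *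
     ((x $ fst \<alpha>) ^ a * (y $ snd \<alpha>) ^ b))"
  proof (rule poly2_eq_sum)
    show "degree (coeff (init_form \<alpha> h) a) \<le> ?n" for a
      using b by (intro degree_le allI impI) (meson not_less)
    show "degree (init_form \<alpha> h) \<le> ?n"
      using b by (intro degree_le allI impI poly_eqI) (metis coeff_0 not_less)
  qed
  also have "\<dots> = jet_coeff h ?n (x, y)"
    unfolding jet_coeff_H_inf[OF assms order.refl]
  proof (intro sum.cong refl, goal_cases)
    case (1 a b)
    show ?case
    proof (cases "wt \<alpha> (a, b) = ?n")
      case True
      then show ?thesis by (simp add: init_form_def coeff_wt_fps[OF assms(2)] fps_power_zeroth)
    next
      case False
      have "wt \<alpha> (a, b) \<le> ?n \<Longrightarrow> h $ a $ b = 0"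
        using False wt_order_le[OF assms(2), of h a b] by force
      then show ?thesis using False by (auto simp: init_form_def coeff_wt_fps[OF assms(2)])
    qed
  qed
  finally show ?thesis ..
qed

lemma power_nth_cong:
  assumes "\<And>i. i \<le> (l::nat) \<Longrightarrow> x $ i = x' $ i" "i \<le> l"
  shows "(x ^ n) $ i = (x' ^ n) $ i"
  using assms(2)
  by (induction n arbitrary: i) (auto intro!: fps_mult_nth_cong simp: assms(1))

text \<open>A monomial of weight at least M uses up M powers of t, so level n sees the arc only up
  to offset n - M beyond \<alpha>. This makes the jet equations triangular.\<close>

lemma jet_coeff_cong:
  assumes "(x, y) \<in> H_inf \<alpha>" "(x', y') \<in> H_inf \<alpha>" "\<alpha> \<in> pos_pairs"
    and "\<And>a b. h $ a $ b \<noteq> 0 \<Longrightarrow> M \<le> wt \<alpha> (a, b)"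
    and "\<And>i. i + M \<le> n \<Longrightarrow> x $ (fst \<alpha> + i) = x' $ (fst \<alpha> + i)"
    and "\<And>i. i + M \<le> n \<Longrightarrow> y $ (snd \<alpha> + i) = y' $ (snd \<alpha> + i)"
  shows "jet_coeff h n (x, y) = jet_coeff h n (x', y')"
  unfolding jet_coeff_H_inf[OF assms(1,3) order.refl] jet_coeff_H_inf[OF assms(2,3) order.refl]
proof (intro sum.cong refl, goal_cases)
  case (1 a b)
  show ?case
  proof (cases "wt \<alpha> (a, b) \<le> n \<and> h $ a $ b \<noteq> 0")
    case True
    then have M: "M \<le> wt \<alpha> (a, b)" using assms(4) by simp
    have "(fps_shift (fst \<alpha>) x ^ a * fps_shift (snd \<alpha>) y ^ b) $ (n - wt \<alpha> (a, b)) =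
      (fps_shift (fst \<alpha>) x' ^ a * fps_shift (snd \<alpha>) y' ^ b) $ (n - wt \<alpha> (a, b))"
      using True M by (intro fps_mult_nth_cong power_nth_cong[where l="n - wt \<alpha> (a, b)"])
        (auto intro!: assms(5,6) simp: add.commute[of _ "fst \<alpha>"] add.commute[of _ "snd \<alpha>"])
    then show ?thesis by simp
  qed auto
qed


section \<open>The Zariski topology on jets\<close>

lemma infinite_UNIV_alg_closed: "infinite (UNIV :: 'k::alg_closed_field set)"
proof
  assume fin: "finite (UNIV :: 'k set)"
  define q :: "'k poly" where "q = (\<Prod>a\<in>UNIV. [:-a, 1:])"
  have "degree q = card (UNIV :: 'k set)" unfolding q_def by (subst degree_prod_eq_sum_degree) auto
  then have "degree q > 0" using fin by (simp add: card_gt_0_iff)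
  then have "degree (q + 1) > 0" by (subst degree_add_eq_left) auto
  then obtain x where "poly (q + 1) x = 0" using alg_closed_imp_poly_has_root by blast
  moreover have "poly q x = 0" using fin by (auto simp: q_def poly_prod)
  ultimately show False by simp
qed

lemma poly_eq_0_of_infinite:
  fixes p :: "'k::alg_closed_field poly"
  assumes "\<And>x. x \<noteq> 0 \<Longrightarrow> poly p x = 0"
  shows "p = 0"
proof (rule ccontr)
  assume "p \<noteq> 0"
  then have "finite {x. poly p x = 0}" by (rule poly_roots_finite)
  moreover have "UNIV \<subseteq> insert 0 {x. poly p x = 0}" using assms by auto
  ultimately show False using infinite_UNIV_alg_closed finite_subset by blast
qed

subsection \<open>Localized function algebras\<close>

inductive_set alg :: "('p \<Rightarrow> 'k::comm_ring_1) set \<Rightarrow> ('p \<Rightarrow> 'k) set" for Z where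
  const: "(\<lambda>_. c) \<in> alg Z"
| gen: "z \<in> Z \<Longrightarrow> z \<in> alg Z"
| add: "F \<in> alg Z \<Longrightarrow> G \<in> alg Z \<Longrightarrow> (\<lambda>P. F P + G P) \<in> alg Z"
| mult: "F \<in> alg Z \<Longrightarrow> G \<in> alg Z \<Longrightarrow> (\<lambda>P. F P * G P) \<in> alg Z"

lemma alg_power: "F \<in> alg Z \<Longrightarrow> (\<lambda>P. F P ^ n) \<in> alg Z"
  by (induction n) (auto intro: alg.intros)

lemma alg_subset_poly_funs: "Z \<subseteq> poly_funs \<Longrightarrow> alg Z \<subseteq> poly_funs"
proof
  fix F assume "Z \<subseteq> poly_funs" "F \<in> alg Z"
  from this(2,1) show "F \<in> poly_funs" by induction (auto intro: poly_funs.intros)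
qed

text \<open>Regular functions on the principal open set where \<tau> is nonzero: polynomials in
  \<open>Z\<close> divided by a power of \<tau>. Nothing is required where \<tau> vanishes, so the
  value of a division by zero is irrelevant.\<close>

definition local_alg :: "('p \<Rightarrow> 'k::field) set \<Rightarrow> ('p \<Rightarrow> 'k) \<Rightarrow> ('p \<Rightarrow> 'k) set" where
  "local_alg Z \<tau> = {F. \<exists>N. \<exists>G\<in>alg Z. \<forall>P. \<tau> P \<noteq> 0 \<longrightarrow> \<tau> P ^ N * F P = G P}"

lemma local_algI: "G \<in> alg Z \<Longrightarrow> (\<And>P. \<tau> P \<noteq> 0 \<Longrightarrow> \<tau> P ^ N * F P = G P) \<Longrightarrow> F \<in> local_alg Z \<tau>"
  unfolding local_alg_def by blast

lemma local_alg_alg: "F \<in> alg Z \<Longrightarrow> F \<in> local_alg Z \<tau>"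
  by (rule local_algI[of F _ _ 0]) auto

lemma local_alg_const: "(\<lambda>_. c) \<in> local_alg Z \<tau>"
  by (intro local_alg_alg alg.const)

lemma local_alg_add:
  assumes "\<tau> \<in> Z" "F \<in> local_alg Z \<tau>" "G \<in> local_alg Z \<tau>"
  shows "(\<lambda>P. F P + G P) \<in> local_alg Z \<tau>"
proof -
  from assms obtain M N F' G' where *: "F' \<in> alg Z" "G' \<in> alg Z"
    "\<And>P. \<tau> P \<noteq> 0 \<Longrightarrow> \<tau> P ^ M * F P = F' P" "\<And>P. \<tau> P \<noteq> 0 \<Longrightarrow> \<tau> P ^ N * G P = G' P"
    unfolding local_alg_def by blast
  show ?thesis
  proof (rule local_algI)
    show "(\<lambda>P. \<tau> P ^ N * F' P + \<tau> P ^ M * G' P) \<in> alg Z"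
      using * assms(1) by (auto intro!: alg.add alg.mult alg_power intro: alg.gen)
    show "\<tau> P ^ (M + N) * (F P + G P) = \<tau> P ^ N * F' P + \<tau> P ^ M * G' P" if "\<tau> P \<noteq> 0" for P
      by (simp add: *(3,4)[OF that, symmetric] power_add algebra_simps)
  qed
qed

lemma local_alg_mult:
  assumes "F \<in> local_alg Z \<tau>" "G \<in> local_alg Z \<tau>"
  shows "(\<lambda>P. F P * G P) \<in> local_alg Z \<tau>"
proof -
  from assms obtain M N F' G' where *: "F' \<in> alg Z" "G' \<in> alg Z"
    "\<And>P. \<tau> P \<noteq> 0 \<Longrightarrow> \<tau> P ^ M * F P = F' P" "\<And>P. \<tau> P \<noteq> 0 \<Longrightarrow> \<tau> P ^ N * G P = G' P"
    unfolding local_alg_def by blast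
  show ?thesis
  proof (rule local_algI)
    show "(\<lambda>P. F' P * G' P) \<in> alg Z"
      using * by (intro alg.mult)
    show "\<tau> P ^ (M + N) * (F P * G P) = F' P * G' P" if "\<tau> P \<noteq> 0" for P
      by (simp add: *(3,4)[OF that, symmetric] power_add algebra_simps)
  qed
qed

lemma local_alg_divide:
  assumes "F \<in> local_alg Z \<tau>" "c \<noteq> 0"
  shows "(\<lambda>P. F P / (c * \<tau> P ^ e)) \<in> local_alg Z \<tau>"
proof -
  from assms obtain N F' where *: "F' \<in> alg Z" "\<And>P. \<tau> P \<noteq> 0 \<Longrightarrow> \<tau> P ^ N * F P = F' P"
    unfolding local_alg_def by blast
  show ?thesis
  proof (rule local_algI)
    show "(\<lambda>P. inverse c * F' P) \<in> alg Z"
      using * by (intro alg.mult alg.const)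
    show "\<tau> P ^ (N + e) * (F P / (c * \<tau> P ^ e)) = inverse c * F' P" if "\<tau> P \<noteq> 0" for P
      using that assms(2) by (simp add: *(2)[OF that, symmetric] power_add field_simps)
  qed
qed

section \<open>Polynomial functions on parameter spaces and on curves\<close>

lemma poly_funs_compose:
  assumes "\<phi> \<in> poly_funs" "\<tau> \<in> Z"
    and "\<And>i. (\<lambda>P. fst (\<Psi> P) $ i) \<in> local_alg Z \<tau>" "\<And>i. (\<lambda>P. snd (\<Psi> P) $ i) \<in> local_alg Z \<tau>"
  shows "(\<lambda>P. \<phi> (\<Psi> P)) \<in> local_alg Z \<tau>"
  using assms(1)
  by induction (auto simp: case_prod_beta intro: local_alg_const local_alg_add local_alg_mult assms(2-4))

lemma poly_funs_power: "F \<in> poly_funs \<Longrightarrow> (\<lambda>P. F P ^ n) \<in> poly_funs"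
  by (induction n) (auto intro: poly_funs.intros)

lemma poly_funs_sum: "(\<And>i. i \<in> I \<Longrightarrow> F i \<in> poly_funs) \<Longrightarrow> (\<lambda>P. \<Sum>i\<in>I. F i P) \<in> poly_funs"
  by (induction I rule: infinite_finite_induct) (auto intro: poly_funs.intros)

lemma poly_funs_prod: "(\<And>i. i \<in> I \<Longrightarrow> F i \<in> poly_funs) \<Longrightarrow> (\<lambda>P. \<Prod>i\<in>I. F i P) \<in> poly_funs"
  by (induction I rule: infinite_finite_induct) (auto intro: poly_funs.intros)

lemma poly_funs_coords: "(\<lambda>P. fst P $ i) \<in> poly_funs" "(\<lambda>P. snd P $ i) \<in> poly_funs"
  using poly_funs.x_coord[of i] poly_funs.y_coord[of i] by (simp_all add: case_prod_beta')

lemma poly_funs_curve: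
  assumes "\<phi> \<in> poly_funs"
    and "\<And>i. \<exists>p. \<forall>s. fst (\<Gamma> s) $ i = poly p s" "\<And>i. \<exists>p. \<forall>s. snd (\<Gamma> s) $ i = poly p s"
  shows "\<exists>p. \<forall>s. \<phi> (\<Gamma> s) = poly p s"
  using assms(1)
proof induction
  case (const c)
  show ?case by (rule exI[of _ "[:c:]"]) simp
next
  case (add \<phi> \<psi>)
  then show ?case by (metis poly_add)
next
  case (mult \<phi> \<psi>)
  then show ?case by (metis poly_mult)
qed (use assms(2,3) in \<open>auto simp: case_prod_beta\<close>)

text \<open>Restrict both factors to a line joining two points where they do not vanish.\<close>

lemma poly_funs_no_zero_divisors:
  fixes \<phi> \<psi> :: "'k::alg_closed_field arc \<Rightarrow> 'k"
  assumes "\<phi> \<in> poly_funs" "\<psi> \<in> poly_funs" "\<phi> P \<noteq> 0" "\<psi> Q \<noteq> 0"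
  shows "\<exists>R. \<phi> R * \<psi> R \<noteq> 0"
proof (rule ccontr)
  assume neg: "\<nexists>R. \<phi> R * \<psi> R \<noteq> 0"
  define \<Gamma> where "\<Gamma> s = (fst P + fps_const s * (fst Q - fst P), snd P + fps_const s * (snd Q - snd P))" for s
  have "\<exists>p. \<forall>s. fst (\<Gamma> s) $ i = poly p s" "\<exists>p. \<forall>s. snd (\<Gamma> s) $ i = poly p s" for i
    by (rule exI[of _ "[:fst P $ i, (fst Q - fst P) $ i:]"], simp add: \<Gamma>_def)
       (rule exI[of _ "[:snd P $ i, (snd Q - snd P) $ i:]"], simp add: \<Gamma>_def)
  then obtain p q where pq: "\<And>s. \<phi> (\<Gamma> s) = poly p s" "\<And>s. \<psi> (\<Gamma> s) = poly q s"
    using poly_funs_curve[OF assms(1), of \<Gamma>] poly_funs_curve[OF assms(2), of \<Gamma>] by metis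
  have "poly (p * q) s = 0" for s using neg by (metis pq poly_mult)
  then have "p * q = 0" by (intro poly_eq_0_of_infinite)
  moreover have "poly p 0 \<noteq> 0" "poly q 1 \<noteq> 0"
    using assms(3,4) by (simp_all add: \<Gamma>_def flip: pq)
  ultimately show False by auto
qed

subsection \<open>Irreducibility and closures\<close>

lemma in_closure_zariski:
  assumes "S \<subseteq> jet_space m"
  shows "P \<in> zariski m closure_of S \<longleftrightarrow>
    P \<in> jet_space m \<and> (\<forall>\<phi>\<in>poly_funs. (\<forall>Q\<in>S. \<phi> Q = 0) \<longrightarrow> \<phi> P = 0)"
proof
  assume P: "P \<in> zariski m closure_of S"
  have "P \<in> jet_space m" using P closure_of_subset_topspace[of "zariski m" S] by auto
  moreover have "\<phi> P = 0" if \<phi>: "\<phi> \<in> poly_funs" "\<forall>Q\<in>S. \<phi> Q = 0" for \<phi>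
  proof -
    have "closedin (zariski m) {P \<in> jet_space m. \<forall>\<phi>\<in>{\<phi>}. \<phi> P = 0}"
      unfolding closedin_zariski using \<phi>(1) by blast
    then have "zariski m closure_of S \<subseteq> {P \<in> jet_space m. \<forall>\<phi>\<in>{\<phi>}. \<phi> P = 0}"
      using assms \<phi> by (intro closure_of_minimal) auto
    then show ?thesis using P by auto
  qed
  ultimately show "P \<in> jet_space m \<and> (\<forall>\<phi>\<in>poly_funs. (\<forall>Q\<in>S. \<phi> Q = 0) \<longrightarrow> \<phi> P = 0)" by blast
next
  assume P: "P \<in> jet_space m \<and> (\<forall>\<phi>\<in>poly_funs. (\<forall>Q\<in>S. \<phi> Q = 0) \<longrightarrow> \<phi> P = 0)"
  have "closedin (zariski m) (zariski m closure_of S)" by simp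
  then have "\<exists>T\<subseteq>poly_funs. zariski m closure_of S = {P \<in> jet_space m. \<forall>\<phi>\<in>T. \<phi> P = 0}"
    by (simp only: closedin_zariski)
  then obtain T where T: "T \<subseteq> poly_funs" "zariski m closure_of S = {P \<in> jet_space m. \<forall>\<phi>\<in>T. \<phi> P = 0}"
    by (elim exE conjE)
  have S: "S \<subseteq> zariski m closure_of S" using assms by (intro closure_of_subset) simp
  have "\<phi> P = 0" if "\<phi> \<in> T" for \<phi>
    using P T(1) that S unfolding T(2) by blast
  then show "P \<in> zariski m closure_of S" unfolding T(2) using P by simp
qed

lemma irreducible_closure:
  assumes "irreducible_subset X S"
  shows "irreducible_subset X (X closure_of S)"
proof -
  have "S \<subseteq> X closure_of S" using assms by (intro closure_of_subset) (simp add: irreducible_subset_def)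
  then show ?thesis using assms unfolding irreducible_subset_def
    by (metis closure_of_minimal closure_of_subset_topspace order_trans subset_empty)
qed

text \<open>The image of a principal open subset of an affine space is irreducible. If it met the
  complements of two closed sets covering it, clearing denominators would give nonzero polynomials F
  and G; a parameter where F, G and \<tau> are all nonzero then maps outside both sets.\<close>

lemma irreducible_param:
  fixes \<Psi> :: "'k::alg_closed_field arc \<Rightarrow> 'k arc"
  assumes Z: "Z \<subseteq> poly_funs" and \<tau>: "\<tau> \<in> Z" "\<tau> P0 \<noteq> 0"
    and \<Psi>: "\<And>i. (\<lambda>P. fst (\<Psi> P) $ i) \<in> local_alg Z \<tau>" "\<And>i. (\<lambda>P. snd (\<Psi> P) $ i) \<in> local_alg Z \<tau>"
    and S: "S = \<Psi> ` {P. \<tau> P \<noteq> 0}" "S \<subseteq> jet_space m"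
  shows "irreducible_subset (zariski m) S"
  unfolding irreducible_subset_def
proof (intro conjI allI impI)
  show "S \<subseteq> topspace (zariski m)" using S by simp
  show "S \<noteq> {}" using S \<tau> by blast
  fix A B assume AB: "closedin (zariski m) A \<and> closedin (zariski m) B \<and> S \<subseteq> A \<union> B"
  show "S \<subseteq> A \<or> S \<subseteq> B"
  proof (rule ccontr)
    assume neg: "\<not> (S \<subseteq> A \<or> S \<subseteq> B)"
    from AB obtain T U where T: "T \<subseteq> poly_funs" "A = {P \<in> jet_space m. \<forall>\<phi>\<in>T. \<phi> P = 0}"
      and U: "U \<subseteq> poly_funs" "B = {P \<in> jet_space m. \<forall>\<phi>\<in>U. \<phi> P = 0}"
      unfolding closedin_zariski by blast
    from neg S T U obtain P Q \<phi> \<psi> where *: "\<phi> \<in> T" "\<psi> \<in> U" "\<tau> P \<noteq> 0" "\<tau> Q \<noteq> 0" "\<phi> (\<Psi> P) \<noteq> 0" "\<psi> (\<Psi> Q) \<noteq> 0"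
      by blast
    have "(\<lambda>P. \<phi> (\<Psi> P)) \<in> local_alg Z \<tau>" "(\<lambda>P. \<psi> (\<Psi> P)) \<in> local_alg Z \<tau>"
      using * T U by (auto intro!: poly_funs_compose \<tau> \<Psi>)
    then obtain M N F G where F: "F \<in> alg Z" "\<And>P. \<tau> P \<noteq> 0 \<Longrightarrow> \<tau> P ^ M * \<phi> (\<Psi> P) = F P"
      and G: "G \<in> alg Z" "\<And>P. \<tau> P \<noteq> 0 \<Longrightarrow> \<tau> P ^ N * \<psi> (\<Psi> P) = G P"
      unfolding local_alg_def by blast
    have p: "F \<in> poly_funs" "G \<in> poly_funs" "\<tau> \<in> poly_funs"
      using F(1) G(1) Z \<tau> alg_subset_poly_funs[OF Z] by blast+
    have "F P \<noteq> 0" "G Q \<noteq> 0" using * F(2)[of P] G(2)[of Q] by auto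
    with poly_funs_no_zero_divisors[OF p(1,2)] obtain R where "F R * G R \<noteq> 0" by blast
    with poly_funs_no_zero_divisors[OF poly_funs.mult[OF p(1,2)] p(3) _ \<tau>(2), of R]
    obtain R where R: "F R * G R * \<tau> R \<noteq> 0" by auto
    then have "\<phi> (\<Psi> R) \<noteq> 0" "\<psi> (\<Psi> R) \<noteq> 0" using F(2)[of R] G(2)[of R] by auto
    moreover have "\<Psi> R \<in> A \<union> B" using R S AB by auto
    ultimately show False using T U * by auto
  qed
qed

text \<open>An irreducible set inside a finite union of closed sets lies in one of them. Stating
  \<open>anti\<close> on the indices excludes repeated members as well as proper inclusions, hence a
  bijection rather than only a list of components.\<close>

lemma irreducible_components_finite_union:
  assumes "finite K" "C = (\<Union>k\<in>K. Z k)"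
    and irr: "\<And>k. k \<in> K \<Longrightarrow> irreducible_subset X (Z k)" and cl: "\<And>k. k \<in> K \<Longrightarrow> closedin X (Z k)"
    and anti: "\<And>k l. k \<in> K \<Longrightarrow> l \<in> K \<Longrightarrow> Z k \<subseteq> Z l \<Longrightarrow> k = l"
  shows "bij_betw Z K (irreducible_components X C)"
proof -
  have sub: "\<exists>k\<in>K. S \<subseteq> Z k" if "irreducible_subset X S" "S \<subseteq> C" for S
  proof -
    have "\<exists>k\<in>L. S \<subseteq> Z k" if "finite L" "L \<subseteq> K" "S \<subseteq> (\<Union>k\<in>L. Z k)" for L
      using that
    proof (induction L)
      case empty
      then show ?case using \<open>irreducible_subset X S\<close> by (simp add: irreducible_subset_def)
    next
      case (insert k L)
      have "closedin X (\<Union>k\<in>L. Z k)" using insert cl by (intro closedin_Union) auto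
      then have "S \<subseteq> Z k \<or> S \<subseteq> (\<Union>k\<in>L. Z k)"
        using \<open>irreducible_subset X S\<close> insert.prems cl[of k] unfolding irreducible_subset_def by auto
      then show ?case using insert by auto
    qed
    then show ?thesis using assms(1,2) that by blast
  qed
  have "irreducible_components X C = Z ` K"
  proof
    show "irreducible_components X C \<subseteq> Z ` K"
    proof
      fix S assume "S \<in> irreducible_components X C"
      then have S: "S \<subseteq> C" "irreducible_subset X S"
        and max: "\<And>Z'. S \<subseteq> Z' \<Longrightarrow> Z' \<subseteq> C \<Longrightarrow> irreducible_subset X Z' \<Longrightarrow> Z' = S"
        by (auto simp: irreducible_components_def)
      from sub[OF S(2,1)] obtain k where "k \<in> K" "S \<subseteq> Z k" by blast
      with max[of "Z k"] irr assms(2) show "S \<in> Z ` K" by blast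
    qed
    show "Z ` K \<subseteq> irreducible_components X C"
    proof
      fix S assume "S \<in> Z ` K"
      then obtain k where k: "k \<in> K" "S = Z k" by blast
      have "Z' = S" if "S \<subseteq> Z'" "Z' \<subseteq> C" "irreducible_subset X Z'" for Z'
      proof -
        from sub[OF that(3,2)] obtain l where "l \<in> K" "Z' \<subseteq> Z l" by blast
        with anti[of k l] k that show ?thesis by blast
      qed
      then show "S \<in> irreducible_components X C"
        using k irr assms(2) unfolding irreducible_components_def by blast
    qed
  qed
  moreover have "inj_on Z K" using anti by (intro inj_onI) blast
  ultimately show ?thesis by (simp add: bij_betw_def)
qed

subsection \<open>Algebraic dependence by counting monomials\<close>

interpretation fun_vs: vector_space "\<lambda>(c::'k::field) (F::'p \<Rightarrow> 'k) P. c * F P"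
  by unfold_locales (auto simp: plus_fun_def algebra_simps)

lemma sum_fun_apply: "(\<Sum>i\<in>I. F i) P = (\<Sum>i\<in>I. F i P :: 'k::comm_monoid_add)"
  by (induction I rule: infinite_finite_induct) (auto simp: zero_fun_def plus_fun_def)

lemma linear_relation:
  fixes G :: "'e \<Rightarrow> 'p \<Rightarrow> 'k::field"
  assumes "finite E" "\<And>e. e \<in> E \<Longrightarrow> G e \<in> fun_vs.span B" "finite B" "card B < card E"
  shows "\<exists>c. (\<exists>e\<in>E. c e \<noteq> 0) \<and> (\<forall>P. (\<Sum>e\<in>E. c e * G e P) = 0)"
proof (cases "inj_on G E")
  case True
  have "fun_vs.dependent (G ` E)"
  proof (rule ccontr)
    assume "fun_vs.independent (G ` E)"
    then have "card (G ` E) \<le> card B"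
      using fun_vs.independent_span_bound[OF assms(3)] assms(2) by blast
    then show False using assms(4) card_image[OF True] by simp
  qed
  then obtain u where u: "\<exists>v\<in>G ` E. u v \<noteq> 0" "(\<Sum>v\<in>G ` E. (\<lambda>P. u v * v P)) = 0"
    using fun_vs.dependent_finite[of "G ` E"] assms(1) by auto
  have "(\<Sum>e\<in>E. u (G e) * G e P) = 0" for P
    using fun_cong[OF u(2), of P] sum.reindex[OF True, of "\<lambda>v. u v * v P"]
    by (simp add: sum_fun_apply)
  with u(1) show ?thesis by (intro exI[of _ "u \<circ> G"]) auto
next
  \<comment> \<open>Dependence is a property of the set of values and does not see repetitions; a
    repeated member gives the relation G d - G e = 0 directly.\<close>
  case False
  then obtain d e where de: "d \<in> E" "e \<in> E" "d \<noteq> e" "G d = G e" unfolding inj_on_def by blast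
  define c :: "'e \<Rightarrow> 'k" where "c i = (if i = d then 1 else 0) - (if i = e then 1 else 0)" for i
  have "(\<Sum>i\<in>E. c i * G i P) = 0" for P
  proof -
    have "(\<Sum>i\<in>E. c i * G i P) = (\<Sum>i\<in>E. if i = d then G i P else 0) - (\<Sum>i\<in>E. if i = e then G i P else 0)"
      unfolding sum_subtractf[symmetric] by (intro sum.cong) (auto simp: c_def)
    then show ?thesis using de assms(1) by simp
  qed
  moreover have "c d \<noteq> 0" using de by (simp add: c_def)
  ultimately show ?thesis using de by blast
qed

text \<open>The exponents are bounded in each variable separately, not in total degree, so the
  number of monomials is bounded by a plain power.\<close>

definition monomials :: "('p \<Rightarrow> 'k::comm_ring_1) set \<Rightarrow> nat \<Rightarrow> ('p \<Rightarrow> 'k) set" where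
  "monomials Z n = (\<lambda>e P. \<Prod>z\<in>Z. z P ^ e z) ` (Z \<rightarrow>\<^sub>E {..n})"

lemma finite_monomials: "finite Z \<Longrightarrow> finite (monomials Z n)"
  by (simp add: monomials_def finite_PiE)

lemma card_monomials: "finite Z \<Longrightarrow> card (monomials Z n) \<le> Suc n ^ card Z"
  unfolding monomials_def
  by (rule order.trans[OF card_image_le]) (simp_all add: finite_PiE card_PiE)

lemma monomials_mono: "a \<le> b \<Longrightarrow> monomials Z a \<subseteq> monomials Z b"
  unfolding monomials_def by (intro image_mono PiE_mono) auto

lemma monomials_mult:
  assumes "finite Z" "F \<in> monomials Z a" "G \<in> monomials Z b"
  shows "(\<lambda>P. F P * G P) \<in> monomials Z (a + b)"
proof -
  from assms obtain d e where *: "d \<in> Z \<rightarrow>\<^sub>E {..a}" "e \<in> Z \<rightarrow>\<^sub>E {..b}"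
    "F = (\<lambda>P. \<Prod>z\<in>Z. z P ^ d z)" "G = (\<lambda>P. \<Prod>z\<in>Z. z P ^ e z)"
    unfolding monomials_def by blast
  show ?thesis unfolding monomials_def
  proof (rule image_eqI)
    show "(\<lambda>z\<in>Z. d z + e z) \<in> Z \<rightarrow>\<^sub>E {..a + b}"
      using * by (auto simp: PiE_iff intro!: add_mono)
    show "(\<lambda>P. F P * G P) = (\<lambda>P. \<Prod>z\<in>Z. z P ^ (\<lambda>z\<in>Z. d z + e z) z)"
      by (simp add: * power_add prod.distrib)
  qed
qed

text \<open>Multiplication is bilinear, so two span inductions, one in each factor, reduce the claim
  to products of monomials.\<close>

lemma span_monomials_mult:
  fixes F G :: "'p \<Rightarrow> 'k::field"
  assumes "finite Z" "F \<in> fun_vs.span (monomials Z a)" "G \<in> fun_vs.span (monomials Z b)"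
  shows "(\<lambda>P. F P * G P) \<in> fun_vs.span (monomials Z (a + b))"
proof -
  have sub: "fun_vs.subspace {F. (\<lambda>P. F P * G P) \<in> fun_vs.span B}" for G :: "'p \<Rightarrow> 'k" and B
  proof (rule fun_vs.subspaceI)
    show "0 \<in> {F. (\<lambda>P. F P * G P) \<in> fun_vs.span B}"
      using fun_vs.span_zero[of B] by (simp add: zero_fun_def)
    show "x + y \<in> {F. (\<lambda>P. F P * G P) \<in> fun_vs.span B}"
      if "x \<in> {F. (\<lambda>P. F P * G P) \<in> fun_vs.span B}" "y \<in> {F. (\<lambda>P. F P * G P) \<in> fun_vs.span B}" for x y
      using that fun_vs.span_add[of "\<lambda>P. x P * G P" B "\<lambda>P. y P * G P"]
      by (simp add: plus_fun_def algebra_simps)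
    show "(\<lambda>P. c * x P) \<in> {F. (\<lambda>P. F P * G P) \<in> fun_vs.span B}"
      if "x \<in> {F. (\<lambda>P. F P * G P) \<in> fun_vs.span B}" for c x
      using that fun_vs.span_scale[of "\<lambda>P. x P * G P" B c] by (simp add: mult.assoc)
  qed
  have 1: "(\<lambda>P. F P * G P) \<in> fun_vs.span (monomials Z (a + b))"
    if "F \<in> fun_vs.span (monomials Z a)" "G \<in> monomials Z b" for F G
    using fun_vs.span_induct[OF that(1) sub[of G "monomials Z (a + b)"]]
      monomials_mult[OF assms(1) _ that(2)] fun_vs.span_base by auto
  have "(\<lambda>P. G P * F P) \<in> fun_vs.span (monomials Z (a + b))"
    using fun_vs.span_induct[OF assms(3) sub[of F "monomials Z (a + b)"]]
      1[OF assms(2)] by (auto simp: mult.commute)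
  then show ?thesis by (simp add: mult.commute)
qed

lemma one_in_span_monomials: "(\<lambda>P. 1) \<in> fun_vs.span (monomials Z 0)"
proof (rule fun_vs.span_base)
  show "(\<lambda>P. 1) \<in> monomials Z 0"
    unfolding monomials_def by (rule image_eqI[of _ _ "\<lambda>z\<in>Z. 0"]) auto
qed

lemma alg_in_span_monomials:
  fixes F :: "'p \<Rightarrow> 'k::field"
  assumes "finite Z" "F \<in> alg Z"
  shows "\<exists>n. F \<in> fun_vs.span (monomials Z n)"
  using assms(2)
proof induction
  case (const c)
  have "(\<lambda>P. c * 1) \<in> fun_vs.span (monomials Z 0)"
    by (intro fun_vs.span_scale[of "\<lambda>P. 1" _ c] one_in_span_monomials)
  then show ?case by auto
next
  case (gen z)
  have "z \<in> monomials Z 1"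
    unfolding monomials_def
  proof (rule image_eqI[of _ _ "\<lambda>z'\<in>Z. if z' = z then 1 else 0"])
    show "z = (\<lambda>P. \<Prod>z'\<in>Z. z' P ^ (\<lambda>z'\<in>Z. if z' = z then 1 else 0) z')"
    proof
      fix P
      have "(\<Prod>z'\<in>Z. z' P ^ (\<lambda>z'\<in>Z. if z' = z then 1 else 0) z') = (\<Prod>z'\<in>Z. if z' = z then z' P else 1)"
        by (intro prod.cong) auto
      then show "z P = (\<Prod>z'\<in>Z. z' P ^ (\<lambda>z'\<in>Z. if z' = z then 1 else 0) z')"
        using gen assms(1) by simp
    qed
  qed auto
  then show ?case by (intro exI fun_vs.span_base)
next
  case (add F G)
  then obtain a b where "F \<in> fun_vs.span (monomials Z a)" "G \<in> fun_vs.span (monomials Z b)" by blast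
  then have "F \<in> fun_vs.span (monomials Z (max a b))" "G \<in> fun_vs.span (monomials Z (max a b))"
    using fun_vs.span_mono[OF monomials_mono[of a "max a b" Z]] fun_vs.span_mono[OF monomials_mono[of b "max a b" Z]]
    by auto
  then have "F + G \<in> fun_vs.span (monomials Z (max a b))" by (rule fun_vs.span_add)
  then show ?case by (auto simp: plus_fun_def)
next
  case (mult F G)
  then show ?case using span_monomials_mult[OF assms(1)] by blast
qed

lemma span_monomials_power:
  assumes "finite Z" "F \<in> fun_vs.span (monomials Z a)"
  shows "(\<lambda>P. F P ^ n) \<in> fun_vs.span (monomials Z (n * a))"
proof (induction n)
  case 0
  show ?case by (simp add: one_in_span_monomials)
next
  case (Suc n)
  show ?case using span_monomials_mult[OF assms Suc] by simp
qed

text \<open>There are \<open>M\<^bsup>card V\<^esup>\<close> monomials in the functions, and they lie in a space of dimension \<open>O(M\<^bsup>card Z\<^esup>)\<close>.\<close>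

lemma algebraic_dependence:
  fixes y :: "'v \<Rightarrow> 'p \<Rightarrow> 'k::field"
  assumes fin: "finite Z" "finite V" and \<tau>: "\<tau> \<in> Z" and y: "\<And>v. v \<in> V \<Longrightarrow> y v \<in> local_alg Z \<tau>"
    and less: "card Z < card V"
  obtains M c where "\<exists>e\<in>V \<rightarrow>\<^sub>E {..<M}. c e \<noteq> 0"
    "\<And>P. \<tau> P \<noteq> 0 \<Longrightarrow> (\<Sum>e\<in>V \<rightarrow>\<^sub>E {..<M}. c e * (\<Prod>v\<in>V. y v P ^ e v)) = 0"
proof -
  have "\<forall>v\<in>V. \<exists>N G a. G \<in> fun_vs.span (monomials Z a) \<and> (\<forall>P. \<tau> P \<noteq> 0 \<longrightarrow> \<tau> P ^ N * y v P = G P)"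
    using y alg_in_span_monomials[OF fin(1)] unfolding local_alg_def by fast
  then obtain N G a where G: "\<And>v. v \<in> V \<Longrightarrow> G v \<in> fun_vs.span (monomials Z (a v))"
    and N: "\<And>v P. v \<in> V \<Longrightarrow> \<tau> P \<noteq> 0 \<Longrightarrow> \<tau> P ^ N v * y v P = G v P"
    by metis
  define A where "A = (\<Sum>v\<in>V. a v)"
  define N' where "N' = (\<Sum>v\<in>V. N v)"
  have G': "G v \<in> fun_vs.span (monomials Z A)" if "v \<in> V" for v
    using G[OF that] fun_vs.span_mono[OF monomials_mono[of "a v" A Z]] fin that
    by (auto simp: A_def intro: member_le_sum)
  obtain t where \<tau>': "\<tau> \<in> fun_vs.span (monomials Z t)"
    using alg_in_span_monomials[OF fin(1) alg.gen[OF \<tau>]] by blast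
  \<comment> \<open>Per unit of M, the numerators contribute degree at most card V * A and the
    powers of \<tau> that clear denominators at most N' * t.\<close>
  define K where "K = card V * A + N' * t"
  \<comment> \<open>Large enough that the number of monomials, at most (M K + 1)^card Z <= M^card Z
    * (K + 1)^card Z, stays below M^(card Z + 1) <= M^card V.\<close>
  define M where "M = Suc (Suc K ^ card Z)"
  have M: "Suc (M * K) ^ card Z < M ^ card V"
  proof -
    have "Suc (M * K) \<le> M * Suc K" by (simp add: M_def)
    then have "Suc (M * K) ^ card Z \<le> (M * Suc K) ^ card Z" by (intro power_mono) auto
    also have "\<dots> = M ^ card Z * Suc K ^ card Z" by (rule power_mult_distrib)
    also have "\<dots> < M ^ card Z * M" by (simp add: M_def)
    also have "\<dots> = M ^ Suc (card Z)" by simp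
    also have "\<dots> \<le> M ^ card V" using less by (intro power_increasing) (auto simp: M_def)
    finally show ?thesis .
  qed
  \<comment> \<open>The monomial with exponents e times a power of \<tau> that does not depend on e,
    namely \<open>\<tau> P ^ (M * N')\<close>; a linear relation among the F e is therefore a
    relation among the monomials where \<tau> is nonzero.\<close>
  define F where "F e P = (\<Prod>v\<in>V. G v P ^ e v * (\<tau> P ^ (N v * (M - e v))))" for e P
  have F: "F e \<in> fun_vs.span (monomials Z (M * K))" if e: "e \<in> V \<rightarrow>\<^sub>E {..<M}" for e
  proof -
    have "(\<lambda>P. \<Prod>v\<in>V. G v P ^ e v * (\<tau> P ^ (N v * (M - e v)))) \<in> fun_vs.span (monomials Z (\<Sum>v\<in>V. e v * A + N v * (M - e v) * t))"
      using fin(2) G'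
    proof (induction V)
      case empty
      show ?case by (simp add: one_in_span_monomials)
    next
      case (insert v V)
      have "(\<lambda>P. (G v P ^ e v * (\<tau> P ^ (N v * (M - e v)))) * (\<Prod>v\<in>V. G v P ^ e v * (\<tau> P ^ (N v * (M - e v)))))
         \<in> fun_vs.span (monomials Z ((e v * A + N v * (M - e v) * t) + (\<Sum>v\<in>V. e v * A + N v * (M - e v) * t)))"
        using insert by (intro span_monomials_mult fin span_monomials_power \<tau>') auto
      then show ?case using insert by simp
    qed
    moreover have "(\<Sum>v\<in>V. e v * A + N v * (M - e v) * t) \<le> M * K"
    proof -
      have "(\<Sum>v\<in>V. e v * A + N v * (M - e v) * t) \<le> (\<Sum>v\<in>V. M * A + N v * M * t)"
        using e by (intro sum_mono add_mono mult_mono) (auto simp: PiE_iff dest!: bspec)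
      also have "\<dots> = M * K"
        by (simp add: sum.distrib K_def N'_def algebra_simps sum_distrib_left sum_distrib_right)
      finally show ?thesis .
    qed
    ultimately show ?thesis
      using fun_vs.span_mono[OF monomials_mono, of "\<Sum>v\<in>V. e v * A + N v * (M - e v) * t" "M * K" Z]
      unfolding F_def[abs_def] by blast
  qed
  have "\<exists>c. (\<exists>e\<in>V \<rightarrow>\<^sub>E {..<M}. c e \<noteq> 0) \<and> (\<forall>P. (\<Sum>e\<in>V \<rightarrow>\<^sub>E {..<M}. c e * F e P) = 0)"
  proof (rule linear_relation)
    show "card (monomials Z (M * K)) < card (V \<rightarrow>\<^sub>E {..<M})"
      using card_monomials[OF fin(1), of "M * K"] M fin by (simp add: card_PiE)
  qed (use fin F finite_monomials in \<open>auto simp: finite_PiE\<close>)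
  then obtain c where c: "\<exists>e\<in>V \<rightarrow>\<^sub>E {..<M}. c e \<noteq> 0" "\<And>P. (\<Sum>e\<in>V \<rightarrow>\<^sub>E {..<M}. c e * F e P) = 0" by blast
  show thesis
  proof (rule that[OF c(1)])
    fix P assume P: "\<tau> P \<noteq> 0"
    have "F e P = \<tau> P ^ (M * N') * (\<Prod>v\<in>V. y v P ^ e v)" if "e \<in> V \<rightarrow>\<^sub>E {..<M}" for e
    proof -
      have "F e P = (\<Prod>v\<in>V. \<tau> P ^ (M * N v) * y v P ^ e v)"
        unfolding F_def
      proof (rule prod.cong[OF refl])
        fix v assume v: "v \<in> V"
        then have "e v < M" using that by (auto simp: PiE_iff)
        then have "M * N v = N v * e v + N v * (M - e v)" by (simp add: algebra_simps flip: distrib_left)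
        then show "G v P ^ e v * \<tau> P ^ (N v * (M - e v)) = \<tau> P ^ (M * N v) * y v P ^ e v"
          by (simp add: N[OF v P, symmetric] power_mult_distrib power_add power_mult)
      qed
      also have "\<dots> = \<tau> P ^ (M * N') * (\<Prod>v\<in>V. y v P ^ e v)"
        by (simp add: prod.distrib N'_def sum_distrib_left power_sum)
      finally show ?thesis .
    qed
    then have "0 = \<tau> P ^ (M * N') * (\<Sum>e\<in>V \<rightarrow>\<^sub>E {..<M}. c e * (\<Prod>v\<in>V. y v P ^ e v))"
      using c(2)[of P] by (simp add: sum_distrib_left algebra_simps)
    then show "(\<Sum>e\<in>V \<rightarrow>\<^sub>E {..<M}. c e * (\<Prod>v\<in>V. y v P ^ e v)) = 0" using P by simp
  qed
qed

lemma sum_PiE_insert: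
  assumes "v \<notin> V" "finite V"
  shows "(\<Sum>e\<in>insert v V \<rightarrow>\<^sub>E {..<M::nat}. h e) = (\<Sum>i<M. \<Sum>e\<in>V \<rightarrow>\<^sub>E {..<M}. h (e(v := i)))"
proof -
  have "inj_on (\<lambda>(i, e). e(v := i)) ({..<M} \<times> (V \<rightarrow>\<^sub>E {..<M}))"
    using assms inj_combinator[of v V "\<lambda>_. {..<M}"] by simp
  then show ?thesis
    by (simp add: PiE_insert_eq sum.reindex sum.cartesian_product) (simp add: case_prod_beta)
qed

lemma monomial_insert_upd:
  assumes "v \<notin> V" "finite V"
  shows "(\<Prod>w\<in>insert v V. a w ^ (e(v := i)) w) = a v ^ i * (\<Prod>w\<in>V. a w ^ e w)"
proof -
  have "(\<Prod>w\<in>V. a w ^ (e(v := i)) w) = (\<Prod>w\<in>V. a w ^ e w)"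
    using assms by (intro prod.cong) auto
  then show ?thesis using assms by simp
qed

text \<open>Induction on the variables: with the others fixed, the relation is a univariate
  polynomial vanishing on an infinite field, so each of its coefficients is again a
  relation.\<close>

lemma monomials_independent:
  fixes c :: "('v \<Rightarrow> nat) \<Rightarrow> 'k::alg_closed_field"
  assumes "finite V" "\<And>a. (\<Sum>e\<in>V \<rightarrow>\<^sub>E {..<M}. c e * (\<Prod>v\<in>V. a v ^ e v)) = 0" "e \<in> V \<rightarrow>\<^sub>E {..<M}"
  shows "c e = 0"
  using assms
proof (induction V arbitrary: c e)
  case empty
  then show ?case by simp
next
  case (insert v V)
  define C where "C a i = (\<Sum>e\<in>V \<rightarrow>\<^sub>E {..<M}. c (e(v := i)) * (\<Prod>w\<in>V. a w ^ e w))" for a i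
  have C: "C a i = 0" if "i < M" for a i
  proof -
    define p where "p = (\<Sum>i<M. monom (C a i) i)"
    have "poly p s = 0" for s
    proof -
      have e: "(\<Prod>w\<in>V. (a(v := s)) w ^ e w) = (\<Prod>w\<in>V. a w ^ e w)" for e
        using insert.hyps by (intro prod.cong) auto
      have "0 = (\<Sum>e\<in>insert v V \<rightarrow>\<^sub>E {..<M}. c e * (\<Prod>w\<in>insert v V. (a(v := s)) w ^ e w))"
        using insert.prems(1)[of "a(v := s)"] by simp
      also have "\<dots> = (\<Sum>i<M. \<Sum>e\<in>V \<rightarrow>\<^sub>E {..<M}. c (e(v := i)) * ((a(v := s)) v ^ i * (\<Prod>w\<in>V. (a(v := s)) w ^ e w)))"
        unfolding sum_PiE_insert[OF insert.hyps(2,1)] monomial_insert_upd[OF insert.hyps(2,1)] ..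
      also have "\<dots> = poly p s"
        unfolding e by (simp add: p_def poly_sum poly_monom C_def sum_distrib_left mult_ac)
      finally show ?thesis by simp
    qed
    then have "p = 0" by (intro poly_eq_0_of_infinite)
    then have "coeff p i = 0" by simp
    then show ?thesis using that by (simp add: p_def coeff_sum)
  qed
  from insert.prems(2) obtain i d where e: "e = d(v := i)" "i < M" "d \<in> V \<rightarrow>\<^sub>E {..<M}"
    by (auto simp: PiE_insert_eq)
  show ?case
    using insert.IH[of "\<lambda>d. c (d(v := i))" d] C[OF e(2)] e(3) unfolding e(1) C_def by blast
qed

text \<open>If \<open>W\<close> lay in the closure of \<open>S\<close>, a relation between \<open>\<xi>\<close> and the \<open>y v\<close> on \<open>S\<close> could be
  divided by \<open>\<xi>\<close> until it no longer vanishes at \<open>\<xi> = 0\<close>, and would then restrict to a relation on \<open>W\<close>.\<close>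

lemma not_subset_closure_param:
  fixes \<Psi> :: "'p \<Rightarrow> 'k::alg_closed_field arc" and y :: "'v \<Rightarrow> 'k arc \<Rightarrow> 'k"
  assumes fin: "finite Z" "finite V" and \<tau>: "\<tau> \<in> Z"
    and \<Psi>: "\<And>i. (\<lambda>P. fst (\<Psi> P) $ i) \<in> local_alg Z \<tau>" "\<And>i. (\<lambda>P. snd (\<Psi> P) $ i) \<in> local_alg Z \<tau>"
    and S: "S = \<Psi> ` {P. \<tau> P \<noteq> 0}" "S \<subseteq> jet_space m"
    and \<xi>: "\<xi> \<in> poly_funs" "\<And>P. P \<in> S \<Longrightarrow> \<xi> P \<noteq> 0"
    and y: "\<And>v. v \<in> V \<Longrightarrow> y v \<in> poly_funs"
    and W: "\<And>a. \<exists>P\<in>W. \<xi> P = 0 \<and> (\<forall>v\<in>V. y v P = a v)"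
    and card: "card Z \<le> card V"
  shows "\<not> W \<subseteq> zariski m closure_of S"
proof
  assume sub: "W \<subseteq> zariski m closure_of S"
  \<comment> \<open>The index \<open>None\<close> stands for \<xi>; this extra function makes the
    number of functions exceed the number of parameters.\<close>
  define V' where "V' = insert None (Some ` V)"
  define y' where "y' = case_option \<xi> y"
  have y': "y' v \<in> poly_funs" if "v \<in> V'" for v
    using that \<xi> y by (auto simp: V'_def y'_def)
  have nv: "None \<notin> Some ` V" "finite (Some ` V)" using fin by auto
  have card': "card Z < card V'"
    using card nv by (simp add: V'_def card_image)
  obtain M c where c: "\<exists>e\<in>V' \<rightarrow>\<^sub>E {..<M}. c e \<noteq> 0"
    and rel: "\<And>P. \<tau> P \<noteq> 0 \<Longrightarrow> (\<Sum>e\<in>V' \<rightarrow>\<^sub>E {..<M}. c e * (\<Prod>v\<in>V'. y' v (\<Psi> P) ^ e v)) = 0"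
  proof (rule algebraic_dependence[OF fin(1) _ \<tau> _ card', of "\<lambda>v P. y' v (\<Psi> P)"])
    show "finite V'" using nv by (simp add: V'_def)
    show "(\<lambda>P. y' v (\<Psi> P)) \<in> local_alg Z \<tau>" if "v \<in> V'" for v
      by (rule poly_funs_compose[OF y'[OF that] \<tau> \<Psi>])
  qed blast
  define Q where "Q i P = (\<Sum>e\<in>Some ` V \<rightarrow>\<^sub>E {..<M}. c (e(None := i)) * (\<Prod>v\<in>Some ` V. y' v P ^ e v))" for i P
  have rel': "(\<Sum>i<M. \<xi> P ^ i * Q i P) = 0" if "P \<in> S" for P
  proof -
    from that S obtain R where R: "P = \<Psi> R" "\<tau> R \<noteq> 0" by blast
    have "(\<Sum>i<M. \<xi> P ^ i * Q i P) = (\<Sum>i<M. \<Sum>e\<in>Some ` V \<rightarrow>\<^sub>E {..<M}.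
        c (e(None := i)) * (y' None P ^ i * (\<Prod>v\<in>Some ` V. y' v P ^ e v)))"
      by (simp add: Q_def sum_distrib_left y'_def algebra_simps)
    also have "\<dots> = (\<Sum>e\<in>V' \<rightarrow>\<^sub>E {..<M}. c e * (\<Prod>v\<in>V'. y' v P ^ e v))"
      unfolding V'_def sum_PiE_insert[OF nv] monomial_insert_upd[OF nv] ..
    also have "\<dots> = 0" using rel R by simp
    finally show ?thesis .
  qed
  \<comment> \<open>Marks the powers of \<xi> that occur with some nonzero coefficient; the least
    one is divided out below.\<close>
  define R where "R i \<longleftrightarrow> i < M \<and> (\<exists>d\<in>Some ` V \<rightarrow>\<^sub>E {..<M}. c (d(None := i)) \<noteq> 0)" for i
  have "\<exists>i. R i"
    using c unfolding V'_def PiE_insert_eq R_def by auto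
  then obtain i where "R i" "\<forall>j<i. \<not> R j"
    unfolding exists_least_iff[of R] by blast
  then have i: "i < M" "\<exists>d\<in>Some ` V \<rightarrow>\<^sub>E {..<M}. c (d(None := i)) \<noteq> 0"
    and min: "\<And>j. j < i \<Longrightarrow> \<forall>d\<in>Some ` V \<rightarrow>\<^sub>E {..<M}. c (d(None := j)) = 0"
    unfolding R_def using order.strict_trans by blast+
  define \<phi> where "\<phi> P = (\<Sum>j\<in>{i..<M}. \<xi> P ^ (j - i) * Q j P)" for P
  have "\<phi> P = 0" if "P \<in> S" for P
  proof -
    have "0 = (\<Sum>j<M. \<xi> P ^ j * Q j P)" using rel'[OF that] by simp
    also have "\<dots> = (\<Sum>j\<in>{i..<M}. \<xi> P ^ j * Q j P)"
    proof (rule sum.mono_neutral_right)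
      show "\<forall>j\<in>{..<M} - {i..<M}. \<xi> P ^ j * Q j P = 0"
        using min by (auto simp: Q_def not_le intro!: sum.neutral)
    qed auto
    also have "\<dots> = \<xi> P ^ i * \<phi> P"
      unfolding \<phi>_def sum_distrib_left
      by (intro sum.cong refl) (auto simp: mult.assoc[symmetric] power_add[symmetric])
    finally show ?thesis using \<xi>(2)[OF that] by simp
  qed
  moreover have "\<phi> \<in> poly_funs"
  proof -
    show ?thesis unfolding \<phi>_def[abs_def] Q_def
      by (intro poly_funs_sum poly_funs.mult poly_funs_power poly_funs_prod \<xi>(1) poly_funs.const y') (simp add: V'_def)
  qed
  ultimately have \<phi>W: "\<phi> P = 0" if "P \<in> W" for P
    using sub that in_closure_zariski[OF S(2)] by blast
  have "c (d(None := i)) = 0" if "d \<in> Some ` V \<rightarrow>\<^sub>E {..<M}" for d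
  proof (rule monomials_independent[where c = "\<lambda>d. c (d(None := i))", OF nv(2) _ that])
    fix a :: "'v option \<Rightarrow> 'k"
    obtain P where P: "P \<in> W" "\<xi> P = 0" "\<And>v. v \<in> V \<Longrightarrow> y v P = a (Some v)"
      using W[of "\<lambda>v. a (Some v)"] by blast
    have "0 = \<phi> P" using \<phi>W P by simp
    also have "\<dots> = Q i P"
    proof -
      \<comment> \<open>At \<xi> = 0 all terms but the lowest disappear, which leaves a nontrivial
        relation among the y v alone.\<close>
      have "\<phi> P = (\<Sum>j\<in>{i..<M}. if j = i then Q j P else 0)"
        unfolding \<phi>_def P(2) by (intro sum.cong) auto
      then show ?thesis using i(1) by simp
    qed
    also have "\<dots> = (\<Sum>e\<in>Some ` V \<rightarrow>\<^sub>E {..<M}. c (e(None := i)) * (\<Prod>v\<in>Some ` V. a v ^ e v))"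
      unfolding Q_def by (intro sum.cong prod.cong arg_cong2[where f="(*)"] refl) (auto simp: y'_def P(3))
    finally show "(\<Sum>e\<in>Some ` V \<rightarrow>\<^sub>E {..<M}. c (e(None := i)) * (\<Prod>v\<in>Some ` V. a v ^ e v)) = 0" by simp
  qed
  then show False using i by blast
qed


section \<open>Arcs on a single branch\<close>

text \<open>Multiplication by A shifts orders by its subdegree. This transfers vanishing between f
  and one branch once the order of the other factor is known exactly.\<close>

lemma fps_mult_vanish:
  fixes A B :: "'k::idom fps"
  assumes "A \<noteq> 0"
  shows "(\<forall>s<subdegree A + n. (A * B) $ s = 0) \<longleftrightarrow> (\<forall>s<n. B $ s = 0)"
proof -
  have *: "(\<forall>s<n. B $ s = 0) \<longleftrightarrow> n \<le> subdegree B" if "B \<noteq> 0" for B :: "'k fps" and n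
    using that by (meson linorder_not_less nth_less_subdegree_zero nth_subdegree_nonzero order_less_le_trans)
  show ?thesis
  proof (cases "B = 0")
    case False
    then show ?thesis using assms by (simp add: *)
  qed simp
qed

lemma jet_coeff_monomial:
  fixes h :: "'k::comm_ring_1 fps fps"
  assumes "centered (x, y)" "\<And>a' b'. h $ a' $ b' = (if a' = a \<and> b' = b then 1 else 0)"
  shows "jet_coeff h l (x, y) = (x ^ a * y ^ b) $ l"
proof -
  have "jet_coeff h l (x, y) = (\<Sum>a'\<le>max a l. \<Sum>b'\<le>max b l. h $ a' $ b' * (x ^ a' * y ^ b') $ l)"
    by (rule jet_coeff_box[OF assms(1)]) auto
  also have "\<dots> = (\<Sum>a'\<le>max a l. if a' = a then (\<Sum>b'\<le>max b l. if b' = b then (x ^ a' * y ^ b') $ l else 0) else 0)"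
    unfolding assms(2) by (intro sum.cong refl) (simp add: if_distrib[of "\<lambda>c. c * _"] cong: if_cong)
  also have "\<dots> = (x ^ a * y ^ b) $ l" unfolding sum.delta[OF finite_atMost] by simp
  finally show ?thesis .
qed

lemma jet_coeff_weight_gt:
  assumes "P \<in> H_inf \<alpha>" "\<alpha> \<in> pos_pairs" "\<And>a b. h $ a $ b \<noteq> 0 \<Longrightarrow> n < wt \<alpha> (a, b)"
  shows "jet_coeff h n P = 0"
proof (cases P)
  case (Pair x y)
  show ?thesis unfolding Pair jet_coeff_H_inf[OF assms(1)[unfolded Pair] assms(2) order.refl]
  proof (intro sum.neutral ballI, goal_cases)
    case (1 a b)
    then show ?case using assms(3)[of a b] by (cases "h $ a $ b = 0") auto
  qed
qed

text \<open>First-order Taylor expansion. The quadratic remainder is exhibited without division, so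
  it holds in every characteristic.\<close>

lemma power_perturb:
  fixes Y Z :: "'a::comm_ring_1"
  shows "\<exists>W. (Y + Z) ^ n = Y ^ n + of_nat n * Y ^ (n - 1) * Z + Z ^ 2 * W"
proof (induction n)
  case 0
  show ?case by (intro exI[of _ 0]) simp
next
  case (Suc n)
  then obtain W where W: "(Y + Z) ^ n = Y ^ n + of_nat n * Y ^ (n - 1) * Z + Z ^ 2 * W" by blast
  have n: "of_nat n * Y ^ n = of_nat n * Y ^ (n - 1) * Y" by (cases n) (simp_all add: mult_ac)
  have "(Y + Z) ^ Suc n = Y ^ Suc n + of_nat (Suc n) * Y ^ n * Z + Z ^ 2 * (of_nat n * Y ^ (n - 1) + W * (Y + Z))"
    using n by (simp add: W algebra_simps power2_eq_square)
  then show ?case by auto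
qed

text \<open>The perturbation sits e >= 1 places above the leading term, so its square has offset 2e
  > e and cannot reach offset e: the dependence on b is affine.\<close>

lemma fps_power_perturb_nth:
  fixes y :: "'k::comm_ring_1 fps"
  assumes "\<And>i. i < v \<Longrightarrow> y $ i = 0" "e \<ge> 1"
  shows "((y + fps_const b * fps_X ^ (v + e)) ^ n) $ (v * n + e) = (y ^ n) $ (v * n + e) + of_nat n * (y $ v) ^ (n - 1) * b"
proof -
  let ?Y = "fps_shift v y" and ?Z = "fps_const b * fps_X ^ e"
  have y: "y = fps_X ^ v * ?Y" by (rule fps_shift_factor) (rule assms(1))
  have yz: "y + fps_const b * fps_X ^ (v + e) = fps_X ^ v * (?Y + ?Z)"
    by (subst y) (simp add: power_add algebra_simps)
  obtain W where W: "(?Y + ?Z) ^ n = ?Y ^ n + of_nat n * ?Y ^ (n - 1) * ?Z + ?Z ^ 2 * W"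
    using power_perturb by blast
  have 1: "(of_nat n * ?Y ^ (n - 1) * ?Z) $ e = of_nat n * (y $ v) ^ (n - 1) * b"
  proof -
    have "of_nat n * ?Y ^ (n - 1) * ?Z = fps_X ^ e * (of_nat n * ?Y ^ (n - 1) * fps_const b)" by (simp add: mult_ac)
    then have "(of_nat n * ?Y ^ (n - 1) * ?Z) $ e = (of_nat n * ?Y ^ (n - 1) * fps_const b) $ 0"
      by (simp only: fps_X_power_mult_nth) simp
    also have "\<dots> = of_nat n * (y $ v) ^ (n - 1) * b" by (simp add: fps_power_zeroth flip: fps_of_nat)
    finally show ?thesis .
  qed
  have 2: "(?Z ^ 2 * W) $ e = 0"
  proof -
    have "?Z ^ 2 * W = fps_X ^ (e + e) * (fps_const b ^ 2 * W)" by (simp only: power2_eq_square power_add mult_ac)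
    then show ?thesis using assms(2) by (simp only: fps_X_power_mult_nth) simp
  qed
  have "((y + fps_const b * fps_X ^ (v + e)) ^ n) $ (v * n + e) = (fps_X ^ (v * n) * (?Y + ?Z) ^ n) $ (v * n + e)"
    by (simp add: yz power_mult_distrib power_mult)
  also have "\<dots> = ((?Y + ?Z) ^ n) $ e" by (simp add: fps_X_power_mult_nth)
  also have "\<dots> = (?Y ^ n) $ e + of_nat n * (y $ v) ^ (n - 1) * b" unfolding W fps_add_nth 1 2 by simp
  also have "(?Y ^ n) $ e = (fps_X ^ (v * n) * ?Y ^ n) $ (v * n + e)" by (simp add: fps_X_power_mult_nth)
  also have "fps_X ^ (v * n) * ?Y ^ n = y ^ n" by (subst (2) y) (simp add: power_mult_distrib power_mult)
  finally show ?thesis .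
qed

section \<open>Coordinates and jet coefficients as polynomial functions\<close>

fun coord :: "nat + nat \<Rightarrow> 'k::zero arc \<Rightarrow> 'k" where
  "coord (Inl i) P = fst P $ i"
| "coord (Inr j) P = snd P $ j"

lemma coord_poly_funs: "(coord v :: 'k::comm_ring_1 arc \<Rightarrow> 'k) \<in> poly_funs"
  by (cases v) (simp_all add: poly_funs_coords coord.simps[abs_def])

text \<open>Only on centered arcs does the defining sum truncate at l, so agreement with a
  polynomial function is claimed only there.\<close>

lemma jet_coeff_poly_fun:
  fixes h :: "'k::field fps fps"
  obtains \<phi> where "\<phi> \<in> poly_funs" "\<And>P. centered P \<Longrightarrow> \<phi> P = jet_coeff h l P"
proof
  have pow: "(\<lambda>P. (X P ^ n) $ i) \<in> poly_funs" if "\<And>i. (\<lambda>P. X P $ i) \<in> poly_funs" for X :: "'k arc \<Rightarrow> 'k fps" and n i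
  proof (induction n arbitrary: i)
    case 0
    then show ?case by (simp add: poly_funs.const)
  next
    case (Suc n)
    then show ?case by (simp add: fps_mult_nth poly_funs_sum poly_funs.mult that)
  qed
  show "(\<lambda>P. \<Sum>a\<le>l. \<Sum>b\<le>l. h $ a $ b * (fst P ^ a * snd P ^ b) $ l) \<in> poly_funs"
    unfolding fps_mult_nth by (intro poly_funs_sum poly_funs.mult poly_funs.const pow poly_funs_coords)
  show "(\<Sum>a\<le>l. \<Sum>b\<le>l. h $ a $ b * (fst P ^ a * snd P ^ b) $ l) = jet_coeff h l P" if "centered P" for P
    using that jet_coeff_box[of "fst P" "snd P" l l l h] by simp
qed

lemma jet_coeff_compose_local_alg:
  assumes "\<tau> \<in> Z" "\<And>i. (\<lambda>P. fst (\<Psi> P) $ i) \<in> local_alg Z \<tau>" "\<And>i. (\<lambda>P. snd (\<Psi> P) $ i) \<in> local_alg Z \<tau>"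
    and "\<And>P. centered (\<Psi> P)"
  shows "(\<lambda>P. jet_coeff h l (\<Psi> P)) \<in> local_alg Z \<tau>"
proof -
  obtain \<phi> where \<phi>: "\<phi> \<in> poly_funs" "\<And>P. centered P \<Longrightarrow> \<phi> P = jet_coeff h l P"
    using jet_coeff_poly_fun[of h l] by blast
  have "(\<lambda>P. \<phi> (\<Psi> P)) \<in> local_alg Z \<tau>" by (rule poly_funs_compose[OF \<phi>(1) assms(1-3)])
  then show ?thesis by (simp add: \<phi>(2) assms(4))
qed

text \<open>One branch, without its unit factor, together with the lattice point s (p, q) on its
  ray. The unit does not affect vanishing orders; see \<open>jet_coeff_g_vanish_iff\<close>.\<close>

locale branch_arcs =
  fixes p q s :: nat and c :: "'k::alg_closed_field" and R :: "'k fps fps"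
  assumes p: "p \<ge> 1" and q: "q \<ge> 1" and coprime: "coprime p q" and s: "s \<ge> 1" and c: "c \<noteq> 0"
    and R: "R $ a $ b \<noteq> 0 \<Longrightarrow> p * q < p * a + q * b"
begin

abbreviation "\<alpha>1 \<equiv> s * p"
abbreviation "\<alpha>2 \<equiv> s * q"
abbreviation "\<nu> \<equiv> s * p * q"

definition eqn :: "'k fps fps" where
  "eqn = fps_const fps_X ^ p - fps_const (fps_const c) * fps_X ^ q + R"

lemma pos: "(\<alpha>1, \<alpha>2) \<in> pos_pairs"
  using p q s by (simp add: pos_pairs_def)

lemma jet_coeff_eqn:
  assumes "centered (x, y)"
  shows "jet_coeff eqn l (x, y) = (y ^ p) $ l - c * (x ^ q) $ l + jet_coeff R l (x, y)"
proof -
  have "(fps_const fps_X ^ p :: 'k fps fps) $ a' $ b' = (if a' = 0 \<and> b' = p then 1 else 0)" for a' b'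
    by (simp add: fps_const_power)
  moreover have "(fps_X ^ q :: 'k fps fps) $ a' $ b' = (if a' = q \<and> b' = 0 then 1 else 0)" for a' b'
    by simp
  ultimately show ?thesis
    unfolding eqn_def by (simp add: jet_coeff_add jet_coeff_diff jet_coeff_cmult assms
      jet_coeff_monomial[OF assms, of _ 0 p] jet_coeff_monomial[OF assms, of _ q 0])
qed

lemma weight_R:
  assumes "R $ a $ b \<noteq> 0" shows "\<nu> < wt (\<alpha>1, \<alpha>2) (a, b)"
proof -
  have "s * (p * q) < s * (p * a + q * b)" using R[OF assms] s by simp
  then show ?thesis by (simp add: wt_def algebra_simps)
qed

lemma jet_coeff_eqn_below:
  assumes P: "P \<in> H_inf (\<alpha>1, \<alpha>2)" and "l < \<nu>"
  shows "jet_coeff eqn l P = 0"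
proof (cases P)
  case (Pair x y)
  have "jet_coeff R l P = 0"
    using weight_R assms(2) by (intro jet_coeff_weight_gt[OF P pos]) (meson order.strict_trans)
  moreover have "(y ^ p) $ l = 0" "(x ^ q) $ l = 0"
    using monomial_nth_eq_0[of x y "(\<alpha>1, \<alpha>2)" l 0 p] monomial_nth_eq_0[of x y "(\<alpha>1, \<alpha>2)" l q 0] assms Pair
    by (simp_all add: mult_ac)
  ultimately show ?thesis
    using jet_coeff_eqn[of x y l] H_inf_centered[OF P pos] Pair by simp
qed

lemma jet_coeff_eqn_initial:
  assumes P: "P \<in> H_inf (\<alpha>1, \<alpha>2)"
  shows "jet_coeff eqn \<nu> P = (snd P $ \<alpha>2) ^ p - c * (fst P $ \<alpha>1) ^ q"
proof (cases P)
  case (Pair x y)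
  have "jet_coeff R \<nu> P = 0"
    using weight_R by (intro jet_coeff_weight_gt[OF P pos])
  moreover have "(y ^ p) $ \<nu> = (y $ \<alpha>2) ^ p" "(x ^ q) $ \<nu> = (x $ \<alpha>1) ^ q"
    using shifted_monomial_nth[OF fps_shift_factor fps_shift_factor, of \<alpha>1 x \<alpha>2 y 0 p \<nu>]
      shifted_monomial_nth[OF fps_shift_factor fps_shift_factor, of \<alpha>1 x \<alpha>2 y q 0 \<nu>] P Pair
    by (simp_all add: H_inf_def mult_ac fps_power_zeroth)
  ultimately show ?thesis
    using jet_coeff_eqn[of x y \<nu>] H_inf_centered[OF P pos] Pair by simp
qed

lemma weight_eqn:
  assumes "eqn $ a $ b \<noteq> 0" shows "\<nu> \<le> wt (\<alpha>1, \<alpha>2) (a, b)"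
proof (cases "R $ a $ b = 0")
  case True
  then have "(a = 0 \<and> b = p) \<or> (a = q \<and> b = 0)"
    using assms by (auto simp: eqn_def fps_const_power split: if_splits)
  then show ?thesis by (auto simp: wt_def mult_ac)
qed (use weight_R in force)

lemma jet_coeff_eqn_cong:
  assumes "P \<in> H_inf (\<alpha>1, \<alpha>2)" "P' \<in> H_inf (\<alpha>1, \<alpha>2)" "n \<le> \<nu> + e"
    and "\<And>i. i \<le> e \<Longrightarrow> fst P $ (\<alpha>1 + i) = fst P' $ (\<alpha>1 + i)"
    and "\<And>i. i \<le> e \<Longrightarrow> snd P $ (\<alpha>2 + i) = snd P' $ (\<alpha>2 + i)"
  shows "jet_coeff eqn n P = jet_coeff eqn n P'"
  using jet_coeff_cong[of "fst P" "snd P" "(\<alpha>1, \<alpha>2)" "fst P'" "snd P'" eqn \<nu> n] assms pos weight_eqn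
  by simp

text \<open>\<open>p\<close> and \<open>q\<close> do not both vanish in \<open>'k\<close>, so the equation can be solved for the higher
  coefficients of \<open>y\<close> or for those of \<open>x\<close>.\<close>

definition solve_y :: bool where "solve_y \<longleftrightarrow> of_nat p \<noteq> (0 :: 'k)"

text \<open>If both p and q were zero in the field, a Bezout identity p x = q y + 1 would give 0 =
  1.\<close>

lemma of_nat_q: "\<not> solve_y \<Longrightarrow> of_nat q \<noteq> (0 :: 'k)"
proof
  assume "\<not> solve_y" "of_nat q = (0 :: 'k)"
  then have 0: "of_nat p = (0 :: 'k)" by (simp add: solve_y_def)
  obtain x y where "p * x = q * y + gcd p q" using bezout_nat[of p q] p by auto
  then have "p * x = q * y + 1" using coprime by simp
  then have "(of_nat (p * x) :: 'k) = of_nat (q * y + 1)" by simp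
  then show False using 0 \<open>of_nat q = (0 :: 'k)\<close> by simp
qed

definition \<kappa> :: 'k where "\<kappa> = (SOME k. k ^ p = c)"

lemma \<kappa>: "\<kappa> ^ p = c"
  unfolding \<kappa>_def using nth_root_exists[of p c] p by (auto intro: someI)

lemma \<kappa>_nonzero: "\<kappa> \<noteq> 0"
  using \<kappa> c p by (auto simp: power_0_left split: if_splits)

text \<open>For any p-th root t of X, the quotient z of Y by \<kappa> t^q is a p-th root of unity.
  Since q is invertible modulo p, z is the q-th power of a power of z, and multiplying t by that
  power corrects Y without changing X.\<close>

lemma torus_param:
  assumes "X \<noteq> 0" "Y \<noteq> 0" "Y ^ p = c * X ^ q"
  obtains \<tau> where "\<tau> \<noteq> 0" "X = \<tau> ^ p" "Y = \<kappa> * \<tau> ^ q"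
proof -
  obtain t where t: "t ^ p = X" using nth_root_exists[of p X] p by auto
  have t0: "t \<noteq> 0" using t assms(1) p by (auto simp: power_0_left)
  define z where "z = Y / (\<kappa> * t ^ q)"
  have "(t ^ q) ^ p = X ^ q" by (simp add: t[symmetric] mult.commute flip: power_mult)
  then have z: "z ^ p = 1"
    using assms c by (simp add: z_def power_divide power_mult_distrib \<kappa>)
  obtain x y where "q * x = p * y + gcd q p" using bezout_nat[of q p] q by auto
  then have xy: "q * x = p * y + 1" using coprime by (simp add: gcd.commute)
  have "(z ^ x) ^ p = (z ^ p) ^ x" by (simp add: mult.commute flip: power_mult)
  then have 1: "(t * z ^ x) ^ p = X" by (simp add: power_mult_distrib t z)
  have "(z ^ x) ^ q = z ^ (q * x)" by (simp add: mult.commute flip: power_mult)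
  also have "\<dots> = z ^ (p * y + 1)" unfolding xy ..
  also have "\<dots> = z" by (simp add: power_mult z)
  finally have 2: "\<kappa> * (t * z ^ x) ^ q = Y"
    using t0 \<kappa>_nonzero by (simp add: power_mult_distrib z_def)
  have "z \<noteq> 0" using z p by (auto simp: power_0_left)
  then show thesis using that[of "t * z ^ x"] 1 2 t0 by simp
qed

section \<open>Solving successively for the higher coefficients\<close>

definition bump :: "nat \<Rightarrow> 'k \<Rightarrow> 'k arc \<Rightarrow> 'k arc" where
  "bump e \<theta> P = (if solve_y then (fst P, snd P + fps_const \<theta> * fps_X ^ (\<alpha>2 + e))
     else (fst P + fps_const \<theta> * fps_X ^ (\<alpha>1 + e), snd P))"

lemma bump_nth:
  "fst (bump e \<theta> P) $ i = fst P $ i + (if \<not> solve_y \<and> i = \<alpha>1 + e then \<theta> else 0)"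
  "snd (bump e \<theta> P) $ i = snd P $ i + (if solve_y \<and> i = \<alpha>2 + e then \<theta> else 0)"
  by (auto simp: bump_def)

text \<open>With \<open>slope_exp\<close>, the partial derivative of y^p - c x^q in the solved
  variable at the point (\<tau>^p, \<kappa> \<tau>^q), split into a constant and a power of
  \<tau>.\<close>

definition slope :: 'k where
  "slope = (if solve_y then of_nat p * \<kappa> ^ (p - 1) else - (c * of_nat q))"

definition slope_exp :: nat where
  "slope_exp = (if solve_y then q * (p - 1) else p * (q - 1))"

lemma slope_nonzero: "slope \<noteq> 0"
  using of_nat_q c \<kappa>_nonzero by (auto simp: slope_def solve_y_def)

lemma bump_H_inf: "P \<in> H_inf (\<alpha>1, \<alpha>2) \<Longrightarrow> bump e \<theta> P \<in> H_inf (\<alpha>1, \<alpha>2)"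
  by (cases "bump e \<theta> P"; cases P) (use bump_nth[of e \<theta> P] in \<open>auto simp: H_inf_def\<close>)

text \<open>The monomials of R weigh more than \<nu>, so at level \<nu> + e they see only offsets
  below e and ignore the change. The two leading monomials respond affinely by
  \<open>fps_power_perturb_nth\<close>.\<close>

lemma jet_coeff_bump:
  assumes P: "P \<in> H_inf (\<alpha>1, \<alpha>2)" and e: "e \<ge> 1" and \<tau>: "fst P $ \<alpha>1 = \<tau> ^ p" "snd P $ \<alpha>2 = \<kappa> * \<tau> ^ q"
  shows "jet_coeff eqn (\<nu> + e) (bump e \<theta> P) = jet_coeff eqn (\<nu> + e) P + \<theta> * (slope * \<tau> ^ slope_exp)"
proof (cases P)
  case (Pair x y)
  let ?Q = "bump e \<theta> P"
  have Q: "?Q \<in> H_inf (\<alpha>1, \<alpha>2)" by (rule bump_H_inf[OF P])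
  have c: "centered (x, y)" "centered (fst ?Q, snd ?Q)"
    using H_inf_centered[OF P pos] H_inf_centered[OF Q pos] Pair by simp_all
  have "jet_coeff R (\<nu> + e) (fst ?Q, snd ?Q) = jet_coeff R (\<nu> + e) (x, y)"
  proof (rule jet_coeff_cong[of _ _ "(\<alpha>1, \<alpha>2)" _ _ _ "\<nu> + 1"])
    show "\<nu> + 1 \<le> wt (\<alpha>1, \<alpha>2) (a, b)" if "R $ a $ b \<noteq> 0" for a b using weight_R[OF that] by simp
  qed (use P Q Pair pos in \<open>auto simp: bump_nth\<close>)
  moreover have "(snd ?Q ^ p) $ (\<nu> + e) - c * (fst ?Q ^ q) $ (\<nu> + e) =
    (y ^ p) $ (\<nu> + e) - c * (x ^ q) $ (\<nu> + e) + \<theta> * (slope * \<tau> ^ slope_exp)"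
  proof (cases solve_y)
    case True
    have "((y + fps_const \<theta> * fps_X ^ (\<alpha>2 + e)) ^ p) $ (\<alpha>2 * p + e) =
      (y ^ p) $ (\<alpha>2 * p + e) + of_nat p * (y $ \<alpha>2) ^ (p - 1) * \<theta>"
      using P Pair by (intro fps_power_perturb_nth e) (auto simp: H_inf_def)
    moreover have "\<alpha>2 * p = \<nu>" by simp
    ultimately show ?thesis using True \<tau> Pair
      by (simp add: bump_def slope_def slope_exp_def power_mult_distrib power_mult mult_ac)
  next
    case False
    have "((x + fps_const \<theta> * fps_X ^ (\<alpha>1 + e)) ^ q) $ (\<alpha>1 * q + e) =
      (x ^ q) $ (\<alpha>1 * q + e) + of_nat q * (x $ \<alpha>1) ^ (q - 1) * \<theta>"
      using P Pair by (intro fps_power_perturb_nth e) (auto simp: H_inf_def)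
    then have *: "((x + fps_const \<theta> * fps_X ^ (\<alpha>1 + e)) ^ q) $ (\<nu> + e) =
      (x ^ q) $ (\<nu> + e) + of_nat q * (x $ \<alpha>1) ^ (q - 1) * \<theta>" .
    have sl: "slope * \<tau> ^ slope_exp = - (c * of_nat q * (x $ \<alpha>1) ^ (q - 1))"
      using False \<tau> Pair by (simp add: slope_def slope_exp_def power_mult)
    have Q': "fst ?Q = x + fps_const \<theta> * fps_X ^ (\<alpha>1 + e)" "snd ?Q = y"
      using False Pair by (simp_all add: bump_def)
    show ?thesis unfolding Q' sl * by (simp add: algebra_simps)
  qed
  ultimately show ?thesis
    using jet_coeff_eqn[OF c(1)] jet_coeff_eqn[OF c(2)] Pair by simp
qed

text \<open>The d slots to be solved for start at zero, so that each is later filled by a single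
  \<open>bump\<close>; this makes it possible to recover every solution from its parameters.\<close>

definition base :: "nat \<Rightarrow> nat \<Rightarrow> 'k arc \<Rightarrow> 'k arc" where
  "base m d P =
    (Abs_fps (\<lambda>i. if i < \<alpha>1 \<or> m < i then 0 else if i = \<alpha>1 then (fst P $ \<alpha>1) ^ p
       else if \<not> solve_y \<and> i \<le> \<alpha>1 + d then 0 else fst P $ i),
     Abs_fps (\<lambda>i. if i < \<alpha>2 \<or> m < i then 0 else if i = \<alpha>2 then \<kappa> * (fst P $ \<alpha>1) ^ q
       else if solve_y \<and> i \<le> \<alpha>2 + d then 0 else snd P $ i))"

text \<open>The parametrization of the arcs of order \<open>\<alpha>\<close> on the branch: the coordinate \<open>x\<^bsup>(\<alpha>\<^sub>1)\<^esup>\<close> of the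
  parameter is \<open>\<tau>\<close>, and the coefficients number \<open>1, \<dots>, d\<close> of the solved variable are redundant.\<close>

primrec param :: "nat \<Rightarrow> nat \<Rightarrow> nat \<Rightarrow> 'k arc \<Rightarrow> 'k arc" where
  "param m d 0 P = base m d P"
| "param m d (Suc e) P = bump (Suc e)
     (- jet_coeff eqn (\<nu> + Suc e) (param m d e P) / (slope * (fst P $ \<alpha>1) ^ slope_exp)) (param m d e P)"

lemma param_H_inf: "param m d e P \<in> H_inf (\<alpha>1, \<alpha>2)"
proof (induction e)
  case 0
  show ?case by (simp add: H_inf_def base_def)
qed (simp add: bump_H_inf)

lemma param_centered: "centered (param m d e P)"
  using H_inf_centered[OF param_H_inf pos] .

lemma param_outside:
  assumes "\<alpha>1 + d \<le> m" "\<alpha>2 + d \<le> m" "e \<le> d"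
  shows "param m d e P \<in> jet_space m"
  using assms(3)
proof (induction e)
  case 0
  show ?case by (simp add: jet_space_def base_def)
next
  case (Suc e)
  then have "\<And>j. j > m \<Longrightarrow> fst (param m d e P) $ j = 0 \<and> snd (param m d e P) $ j = 0"
    by (auto simp: jet_space_def case_prod_beta)
  then show ?case using assms Suc.prems by (auto simp: jet_space_def case_prod_beta bump_nth)
qed

lemma param_free:
  "\<not> (\<not> solve_y \<and> \<alpha>1 < i \<and> i \<le> \<alpha>1 + e) \<Longrightarrow> fst (param m d e P) $ i = fst (base m d P) $ i"
  "\<not> (solve_y \<and> \<alpha>2 < i \<and> i \<le> \<alpha>2 + e) \<Longrightarrow> snd (param m d e P) $ i = snd (base m d P) $ i"
  by (induction e) (auto simp: bump_nth)

lemma param_initial: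
  assumes "\<alpha>1 \<le> m" "\<alpha>2 \<le> m"
  shows "fst (param m d e P) $ \<alpha>1 = (fst P $ \<alpha>1) ^ p" "snd (param m d e P) $ \<alpha>2 = \<kappa> * (fst P $ \<alpha>1) ^ q"
  using assms by (simp_all add: param_free base_def)

text \<open>Level \<nu> holds because \<kappa>^p = c. Each later level is repaired by its own bump,
  which is placed too high to disturb the levels already solved.\<close>

lemma param_solves:
  assumes m: "\<alpha>1 \<le> m" "\<alpha>2 \<le> m" and \<tau>: "fst P $ \<alpha>1 \<noteq> 0" and "l \<le> \<nu> + e"
  shows "jet_coeff eqn l (param m d e P) = 0"
  using assms(4)
proof (induction e arbitrary: l)
  case 0
  have "jet_coeff eqn \<nu> (base m d P) = 0"
  proof -
    have "((fst P $ \<alpha>1) ^ q) ^ p = ((fst P $ \<alpha>1) ^ p) ^ q" by (simp add: mult.commute flip: power_mult)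
    then show ?thesis
      using jet_coeff_eqn_initial[OF param_H_inf[of m d 0 P]] param_initial[OF m, of d 0 P] \<kappa>
      by (simp add: power_mult_distrib)
  qed
  then show ?case using jet_coeff_eqn_below[OF param_H_inf[of m d 0 P], of l] 0 by (cases "l = \<nu>") auto
next
  case (Suc e)
  let ?Q = "param m d e P" and ?\<theta> = "- jet_coeff eqn (\<nu> + Suc e) (param m d e P) / (slope * (fst P $ \<alpha>1) ^ slope_exp)"
  show ?case
  proof (cases "l = \<nu> + Suc e")
    case True
    have "jet_coeff eqn (\<nu> + Suc e) (bump (Suc e) ?\<theta> ?Q) =
      jet_coeff eqn (\<nu> + Suc e) ?Q + ?\<theta> * (slope * (fst P $ \<alpha>1) ^ slope_exp)"
      by (rule jet_coeff_bump[OF param_H_inf _ param_initial[OF m]]) simp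
    also have "\<dots> = 0" using slope_nonzero \<tau> by simp
    finally show ?thesis using True by simp
  next
    case False
    then have l: "l \<le> \<nu> + e" using Suc.prems by simp
    have "jet_coeff eqn l (param m d (Suc e) P) = jet_coeff eqn l ?Q"
      by (rule jet_coeff_eqn_cong[OF param_H_inf param_H_inf l]) (simp_all add: bump_nth)
    then show ?thesis using Suc.IH[OF l] by simp
  qed
qed

definition arcs :: "nat \<Rightarrow> nat \<Rightarrow> 'k arc set" where
  "arcs m d = jet_space m \<inter> F_set eqn (\<alpha>1, \<alpha>2) (real (\<nu> + d))"

lemma arcs_iff:
  "P \<in> arcs m d \<longleftrightarrow> P \<in> jet_space m \<and> P \<in> H_inf (\<alpha>1, \<alpha>2) \<and> fst P $ \<alpha>1 \<noteq> 0 \<and> snd P $ \<alpha>2 \<noteq> 0 \<and>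
    (\<forall>l\<le>\<nu> + d. jet_coeff eqn l P = 0)"
  unfolding arcs_def F_set_def by (cases P) (auto simp del: of_nat_add)

lemma param_in_arcs:
  assumes "\<alpha>1 + d \<le> m" "\<alpha>2 + d \<le> m" "fst P $ \<alpha>1 \<noteq> 0"
  shows "param m d d P \<in> arcs m d"
  using assms param_outside[of d m d P] param_H_inf[of m d d P] param_initial[of m d d P]
    param_solves[of m P _ d d] \<kappa>_nonzero by (auto simp: arcs_iff)

text \<open>For surjectivity, the leading coefficients of a solution give \<tau>, and the free ones
  are copied. The equation at level \<nu> + e then determines slot e, because it is affine in that
  slot with nonzero slope.\<close>

lemma arcs_param:
  assumes m: "\<alpha>1 + d \<le> m" "\<alpha>2 + d \<le> m"
  shows "arcs m d = param m d d ` {P. coord (Inl \<alpha>1) P \<noteq> 0}"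
proof (intro equalityI subsetI)
  fix P assume "P \<in> param m d d ` {P. coord (Inl \<alpha>1) P \<noteq> 0}"
  then show "P \<in> arcs m d" using param_in_arcs[OF m] by auto
next
  fix Q assume "Q \<in> arcs m d"
  then have Q: "Q \<in> jet_space m" "Q \<in> H_inf (\<alpha>1, \<alpha>2)" "fst Q $ \<alpha>1 \<noteq> 0" "snd Q $ \<alpha>2 \<noteq> 0"
    "\<And>l. l \<le> \<nu> + d \<Longrightarrow> jet_coeff eqn l Q = 0" by (auto simp: arcs_iff)
  have "(snd Q $ \<alpha>2) ^ p = c * (fst Q $ \<alpha>1) ^ q"
    using Q(5)[of \<nu>] jet_coeff_eqn_initial[OF Q(2)] by simp
  then obtain \<tau> where \<tau>: "\<tau> \<noteq> 0" "fst Q $ \<alpha>1 = \<tau> ^ p" "snd Q $ \<alpha>2 = \<kappa> * \<tau> ^ q"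
    using torus_param[OF Q(3,4)] by blast
  \<comment> \<open>The given arc with its leading x-coefficient \<tau>^p replaced by the parameter
    \<tau> itself.\<close>
  define P where "P = (fst Q + fps_const (\<tau> - fst Q $ \<alpha>1) * fps_X ^ \<alpha>1, snd Q)"
  have P: "fst P $ \<alpha>1 = \<tau>" "\<And>i. i \<noteq> \<alpha>1 \<Longrightarrow> fst P $ i = fst Q $ i" "snd P = snd Q"
    by (auto simp: P_def)
  have Q0: "\<And>i. i < \<alpha>1 \<or> m < i \<Longrightarrow> fst Q $ i = 0" "\<And>i. i < \<alpha>2 \<or> m < i \<Longrightarrow> snd Q $ i = 0"
    using Q(1,2) by (auto simp: H_inf_def jet_space_def)
  have base: "fst (base m d P) $ i = (if \<not> solve_y \<and> \<alpha>1 < i \<and> i \<le> \<alpha>1 + d then 0 else fst Q $ i)"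
    "snd (base m d P) $ i = (if solve_y \<and> \<alpha>2 < i \<and> i \<le> \<alpha>2 + d then 0 else snd Q $ i)" for i
    using P \<tau> Q0[of i] by (auto simp: base_def)
  have agree: "(\<forall>i. \<not> (\<not> solve_y \<and> \<alpha>1 + e < i \<and> i \<le> \<alpha>1 + d) \<longrightarrow> fst (param m d e P) $ i = fst Q $ i) \<and>
    (\<forall>i. \<not> (solve_y \<and> \<alpha>2 + e < i \<and> i \<le> \<alpha>2 + d) \<longrightarrow> snd (param m d e P) $ i = snd Q $ i)" if "e \<le> d" for e
    using that
  proof (induction e)
    case 0
    show ?case using base by auto
  next
    case (Suc e)
    let ?Q = "param m d e P"
    have IH: "\<And>i. \<not> (\<not> solve_y \<and> \<alpha>1 + e < i \<and> i \<le> \<alpha>1 + d) \<Longrightarrow> fst ?Q $ i = fst Q $ i"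
      "\<And>i. \<not> (solve_y \<and> \<alpha>2 + e < i \<and> i \<le> \<alpha>2 + d) \<Longrightarrow> snd ?Q $ i = snd Q $ i"
      using Suc by auto
    define \<theta> where "\<theta> = (if solve_y then snd Q $ (\<alpha>2 + Suc e) else fst Q $ (\<alpha>1 + Suc e))"
    have zero: "\<not> solve_y \<Longrightarrow> fst ?Q $ (\<alpha>1 + Suc e) = 0" "solve_y \<Longrightarrow> snd ?Q $ (\<alpha>2 + Suc e) = 0"
      using Suc.prems by (auto simp: param_free base)
    have bump: "fst (bump (Suc e) \<theta> ?Q) $ i = fst Q $ i" if "\<not> (\<not> solve_y \<and> \<alpha>1 + Suc e < i \<and> i \<le> \<alpha>1 + d)" for i
      using IH(1)[of i] zero that by (cases "i = \<alpha>1 + Suc e") (auto simp: bump_nth \<theta>_def)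
    have bump': "snd (bump (Suc e) \<theta> ?Q) $ i = snd Q $ i" if "\<not> (solve_y \<and> \<alpha>2 + Suc e < i \<and> i \<le> \<alpha>2 + d)" for i
      using IH(2)[of i] zero that by (cases "i = \<alpha>2 + Suc e") (auto simp: bump_nth \<theta>_def)
    \<comment> \<open>After the bump the arc agrees with Q through offset e + 1, and this level sees
      nothing further.\<close>
    have "jet_coeff eqn (\<nu> + Suc e) (bump (Suc e) \<theta> ?Q) = jet_coeff eqn (\<nu> + Suc e) Q"
      by (rule jet_coeff_eqn_cong[OF bump_H_inf[OF param_H_inf] Q(2) order.refl]) (auto intro!: bump bump')
    also have "\<dots> = 0" using Q(5) Suc.prems by simp
    finally have "jet_coeff eqn (\<nu> + Suc e) ?Q + \<theta> * (slope * (fst P $ \<alpha>1) ^ slope_exp) = 0"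
      by (subst (asm) jet_coeff_bump[OF param_H_inf _ param_initial]) (use m in auto)
    then have "\<theta> * (slope * (fst P $ \<alpha>1) ^ slope_exp) = - jet_coeff eqn (\<nu> + Suc e) ?Q"
      by (simp add: eq_neg_iff_add_eq_0 add.commute)
    then have "\<theta> = - jet_coeff eqn (\<nu> + Suc e) ?Q / (slope * (fst P $ \<alpha>1) ^ slope_exp)"
      using slope_nonzero \<tau>(1) P(1) by (subst nonzero_eq_divide_eq) auto
    then have "param m d (Suc e) P = bump (Suc e) \<theta> ?Q" by simp
    then show ?case using bump bump' by (auto simp del: param.simps)
  qed
  have "param m d d P = Q"
    using agree[OF order.refl] by (intro prod_eqI fps_ext) auto
  then show "Q \<in> param m d d ` {P. coord (Inl \<alpha>1) P \<noteq> 0}" using P \<tau> by (intro image_eqI[of _ _ P]) auto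
qed

section \<open>Dimension count for arcs on one branch\<close>

definition free_coords :: "nat \<Rightarrow> nat \<Rightarrow> (nat + nat) set" where
  "free_coords m d = (if solve_y then Inl ` {\<alpha>1<..m} \<union> Inr ` {\<alpha>2 + d<..m}
     else Inl ` {\<alpha>1 + d<..m} \<union> Inr ` {\<alpha>2<..m})"

lemma finite_free_coords: "finite (free_coords m d)"
  by (simp add: free_coords_def)

lemma card_free_coords:
  assumes "\<alpha>1 + d \<le> m" "\<alpha>2 + d \<le> m"
  shows "card (free_coords m d) + d = (m - \<alpha>1) + (m - \<alpha>2)"
proof -
  have "card (Inl ` A \<union> Inr ` B :: (nat + nat) set) = card A + card B" if "finite A" "finite B" for A B
    using that by (subst card_Un_disjoint) (auto simp: card_image)
  then show ?thesis using assms by (simp add: free_coords_def)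
qed

lemma param_local_alg:
  fixes m d
  defines "Z \<equiv> coord ` insert (Inl \<alpha>1) (free_coords m d)" and "\<tau> \<equiv> coord (Inl \<alpha>1)"
  shows "(\<lambda>P. fst (param m d e P) $ i) \<in> local_alg Z \<tau>" "(\<lambda>P. snd (param m d e P) $ i) \<in> local_alg Z \<tau>"
proof -
  have \<tau>: "\<tau> \<in> Z" by (simp add: Z_def \<tau>_def)
  have Z: "coord v \<in> alg Z" if "v \<in> insert (Inl \<alpha>1) (free_coords m d)" for v
    unfolding Z_def by (intro alg.gen imageI that)
  have Zx: "(\<lambda>P. fst P $ i) \<in> alg Z" if "Inl i \<in> insert (Inl \<alpha>1) (free_coords m d)" for i
    using Z[OF that] unfolding coord.simps(1)[abs_def] .
  have Zy: "(\<lambda>P. snd P $ i) \<in> alg Z" if "Inr i \<in> insert (Inl \<alpha>1) (free_coords m d)" for i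
    using Z[OF that] unfolding coord.simps(2)[abs_def] .
  have "(\<forall>i. (\<lambda>P. fst (param m d e P) $ i) \<in> local_alg Z \<tau>) \<and> (\<forall>i. (\<lambda>P. snd (param m d e P) $ i) \<in> local_alg Z \<tau>)"
  proof (induction e)
    case 0
    have "(\<lambda>P. if i < \<alpha>1 \<or> m < i then 0 else if i = \<alpha>1 then (fst P $ \<alpha>1) ^ p
       else if \<not> solve_y \<and> i \<le> \<alpha>1 + d then 0 else fst P $ i) \<in> alg Z" for i
      using Zx[of i] alg_power[OF Zx[of \<alpha>1], of p] alg.const[of 0 Z]
      by (cases "i < \<alpha>1 \<or> m < i"; cases "i = \<alpha>1"; cases "\<not> solve_y \<and> i \<le> \<alpha>1 + d")
         (auto simp: free_coords_def image_iff)
    moreover have "(\<lambda>P. if i < \<alpha>2 \<or> m < i then 0 else if i = \<alpha>2 then \<kappa> * (fst P $ \<alpha>1) ^ q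
       else if solve_y \<and> i \<le> \<alpha>2 + d then 0 else snd P $ i) \<in> alg Z" for i
      using Zy[of i] alg.mult[OF alg.const[of \<kappa>] alg_power[OF Zx[of \<alpha>1], of q]] alg.const[of 0 Z]
      by (cases "i < \<alpha>2 \<or> m < i"; cases "i = \<alpha>2"; cases "solve_y \<and> i \<le> \<alpha>2 + d")
         (auto simp: free_coords_def image_iff)
    ultimately have "(\<lambda>P. fst (base m d P) $ i) \<in> alg Z" "(\<lambda>P. snd (base m d P) $ i) \<in> alg Z" for i
      by (simp_all add: base_def)
    then show ?case by (simp add: local_alg_alg)
  next
    case (Suc e)
    define \<theta> where "\<theta> P = - 1 * jet_coeff eqn (\<nu> + Suc e) (param m d e P) / (slope * \<tau> P ^ slope_exp)" for P
    have \<theta>: "\<theta> \<in> local_alg Z \<tau>"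
      unfolding \<theta>_def using Suc
      by (intro local_alg_divide local_alg_mult local_alg_const slope_nonzero jet_coeff_compose_local_alg \<tau> param_centered) auto
    have if_\<theta>: "(\<lambda>P. if b then \<theta> P else 0) \<in> local_alg Z \<tau>" for b
      using \<theta> local_alg_const[of 0] by (cases b) auto
    have step: "param m d (Suc e) P = bump (Suc e) (\<theta> P) (param m d e P)" for P
      by (simp add: \<theta>_def \<tau>_def)
    show ?case unfolding step bump_nth
      using Suc by (intro conjI allI local_alg_add \<tau> if_\<theta>) auto
  qed
  then show "(\<lambda>P. fst (param m d e P) $ i) \<in> local_alg Z \<tau>" "(\<lambda>P. snd (param m d e P) $ i) \<in> local_alg Z \<tau>"
    by auto
qed

lemma arcs_subset: "arcs m d \<subseteq> jet_space m"
  by (simp add: arcs_def)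

lemma arcs_irreducible:
  assumes "\<alpha>1 + d \<le> m" "\<alpha>2 + d \<le> m"
  shows "irreducible_subset (zariski m) (arcs m d)"
proof (rule irreducible_param[OF _ _ _ param_local_alg arcs_param[OF assms] arcs_subset])
  show "coord (Inl \<alpha>1) (fps_X ^ \<alpha>1, 0) \<noteq> (0 :: 'k)" by simp
  show "(coord ` insert (Inl \<alpha>1) (free_coords m d) :: ('k arc \<Rightarrow> 'k) set) \<subseteq> poly_funs"
    using coord_poly_funs by blast
qed (simp del: coord.simps)

lemma arcs_realize:
  assumes "\<alpha>1 + d \<le> m" "\<alpha>2 + d \<le> m"
  shows "\<exists>P\<in>arcs m d. \<forall>v\<in>free_coords m d. coord v P = a v"
proof
  define P :: "'k arc" where "P = (Abs_fps (\<lambda>i. if i = \<alpha>1 then 1 else a (Inl i)), Abs_fps (\<lambda>i. a (Inr i)))"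
  show "param m d d P \<in> arcs m d" using assms by (intro param_in_arcs) (simp_all add: P_def)
  show "\<forall>v\<in>free_coords m d. coord v (param m d d P) = a v"
    by (auto simp: free_coords_def param_free base_def P_def split: if_splits)
qed

text \<open>The arcs have (m - \<alpha>1) + (m - \<alpha>2) - d + 1 parameters, \<tau> included. The
  separating function is the leading x-coefficient: nonzero on the arcs, zero at points of W where
  the coordinates in V are arbitrary.\<close>

lemma not_subset_closure_arcs:
  assumes m: "\<alpha>1 + d \<le> m" "\<alpha>2 + d \<le> m" and V: "finite V" "(m - \<alpha>1) + (m - \<alpha>2) + 1 \<le> card V + d"
    and W: "\<And>a. \<exists>P\<in>W. fst P $ \<alpha>1 = 0 \<and> (\<forall>v\<in>V. coord v P = a v)"
  shows "\<not> W \<subseteq> zariski m closure_of (arcs m d)"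
proof (rule not_subset_closure_param[OF _ V(1) _ param_local_alg arcs_param[OF m] arcs_subset])
  let ?Z = "coord ` insert (Inl \<alpha>1) (free_coords m d) :: ('k arc \<Rightarrow> 'k) set"
  show "finite ?Z" by (simp add: finite_free_coords)
  show "coord (Inl \<alpha>1) \<in> ?Z" by simp
  have "card ?Z \<le> card (insert (Inl \<alpha>1) (free_coords m d))" by (intro card_image_le) (simp add: finite_free_coords)
  also have "\<dots> \<le> Suc (card (free_coords m d))" by (rule card_insert_le_m1) (auto simp: finite_free_coords)
  also have "\<dots> \<le> card V" using card_free_coords[OF m] V(2) by linarith
  finally show "card ?Z \<le> card V" .
  show "\<exists>P\<in>W. coord (Inl \<alpha>1) P = 0 \<and> (\<forall>v\<in>V. coord v P = a v)" for a using W[of a] by simp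
  show "coord (Inl \<alpha>1) P \<noteq> 0" if "P \<in> arcs m d" for P using that by (simp add: arcs_iff)
qed (rule coord_poly_funs)+

text \<open>Level \<nu> + d + 1 is not implied by the earlier ones: changing the free coefficient at
  offset d + 1 by 1 stays inside the arcs but shifts this level by the nonzero slope.\<close>

lemma arcs_exact_order:
  assumes m: "\<alpha>1 + Suc d \<le> m" "\<alpha>2 + Suc d \<le> m"
  shows "\<exists>P\<in>arcs m d. jet_coeff eqn (\<nu> + Suc d) P \<noteq> 0"
proof (rule ccontr)
  assume neg: "\<not> ?thesis"
  \<comment> \<open>The parameter point with \<tau> = 1 and all free coordinates zero.\<close>
  define P0 :: "'k arc" where "P0 = (fps_X ^ \<alpha>1, 0)"
  define P where "P = param m d d P0"
  have P: "P \<in> arcs m d" unfolding P_def using m by (intro param_in_arcs) (simp_all add: P0_def)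
  have init: "fst P $ \<alpha>1 = 1 ^ p" "snd P $ \<alpha>2 = \<kappa> * 1 ^ q"
    using param_initial[of m d d P0] m by (simp_all add: P_def P0_def)
  have H: "P \<in> H_inf (\<alpha>1, \<alpha>2)" using P by (simp add: arcs_iff)
  have "bump (Suc d) 1 P \<in> arcs m d"
  proof -
    have "jet_coeff eqn l (bump (Suc d) 1 P) = 0" if "l \<le> \<nu> + d" for l
      using jet_coeff_eqn_cong[OF bump_H_inf[OF H] H that] P that by (simp add: bump_nth arcs_iff)
    then show ?thesis using P m bump_H_inf[OF H]
      by (auto simp: arcs_iff bump_nth jet_space_def case_prod_beta)
  qed
  then have "jet_coeff eqn (\<nu> + Suc d) (bump (Suc d) 1 P) = 0" "jet_coeff eqn (\<nu> + Suc d) P = 0"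
    using neg P by auto
  then show False using jet_coeff_bump[OF H _ init, of "Suc d" 1] slope_nonzero by simp
qed

end


section \<open>Arcs on a product of branches\<close>

locale branches =
  fixes J :: "'j set" and g u R :: "'j \<Rightarrow> 'k::alg_closed_field fps fps" and p q :: "'j \<Rightarrow> nat" and c :: "'j \<Rightarrow> 'k"
    and f :: "'k fps fps"
  assumes finite_J: "finite J" and f: "f = (\<Prod>j\<in>J. g j)"
    and u: "j \<in> J \<Longrightarrow> u j $ 0 $ 0 \<noteq> 0" and p: "j \<in> J \<Longrightarrow> p j \<ge> 1" and q: "j \<in> J \<Longrightarrow> q j \<ge> 1"
    and coprime: "j \<in> J \<Longrightarrow> coprime (p j) (q j)" and c: "j \<in> J \<Longrightarrow> c j \<noteq> 0"
    and R: "j \<in> J \<Longrightarrow> R j $ a $ b \<noteq> 0 \<Longrightarrow> p j * q j < p j * a + q j * b"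
    and g: "j \<in> J \<Longrightarrow> g j = u j * (fps_const fps_X ^ p j - fps_const (fps_const (c j)) * fps_X ^ q j + R j)"
begin

text \<open>The smaller of the weights of x^q and y^p, which is the weighted order of branch j by
  \<open>wt_order_g\<close>.\<close>

definition \<mu> :: "'j \<Rightarrow> nat \<times> nat \<Rightarrow> nat" where
  "\<mu> j w = min (fst w * q j) (snd w * p j)"

definition M :: "'j set \<Rightarrow> nat \<times> nat \<Rightarrow> nat" where
  "M K w = (\<Sum>j\<in>K. \<mu> j w)"

definition on_ray :: "'j \<Rightarrow> nat \<times> nat \<Rightarrow> bool" where
  "on_ray j w \<longleftrightarrow> fst w * q j = snd w * p j"

definition E :: "'j \<Rightarrow> 'k fps fps" where
  "E j = branch_arcs.eqn (p j) (q j) (c j) (R j)"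

lemma branch_arcs: "j \<in> J \<Longrightarrow> s \<ge> 1 \<Longrightarrow> branch_arcs (p j) (q j) s (c j) (R j)"
  by unfold_locales (use p[of j] q[of j] coprime[of j] c[of j] R[of j] in auto)

lemma E_eq: "j \<in> J \<Longrightarrow> E j = fps_const fps_X ^ p j - fps_const (fps_const (c j)) * fps_X ^ q j + R j"
  unfolding E_def using branch_arcs[of j 1] by (intro branch_arcs.eqn_def) auto

lemma g_eq: "j \<in> J \<Longrightarrow> g j = u j * E j"
  using g E_eq by simp

lemma \<mu>_pos: "j \<in> J \<Longrightarrow> w \<in> pos_pairs \<Longrightarrow> \<mu> j w \<ge> 1"
  using p[of j] q[of j] by (auto simp: \<mu>_def pos_pairs_def)

lemma \<mu>_le: "\<mu> j w \<le> fst w * q j" "\<mu> j w \<le> snd w * p j"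
  by (auto simp: \<mu>_def)

text \<open>R is assumed to lie above the edge only for the weight (p, q). Multiplying that
  inequality by \<mu>, bounding \<mu> by the weight of each vertex and cancelling p q gives the same
  for every positive weight.\<close>

lemma weight_R_gt:
  assumes "j \<in> J" "w \<in> pos_pairs" "R j $ a $ b \<noteq> 0"
  shows "\<mu> j w < wt w (a, b)"
proof -
  let ?n = "\<mu> j w"
  have "?n * (p j * q j) < ?n * (p j * a + q j * b)"
    using R[OF assms(1,3)] \<mu>_pos[OF assms(1,2)] by simp
  also have "\<dots> = ?n * (p j * a) + ?n * (q j * b)" by (simp add: distrib_left)
  also have "\<dots> \<le> (fst w * q j) * (p j * a) + (snd w * p j) * (q j * b)"
    by (intro add_mono mult_right_mono \<mu>_le) auto
  also have "\<dots> = wt w (a, b) * (p j * q j)" by (simp add: wt_def algebra_simps)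
  finally show ?thesis by (simp only: mult_less_cancel2)
qed

lemma E_nth:
  assumes "j \<in> J"
  shows "E j $ a $ b = (if a = 0 \<and> b = p j then 1 else 0) - c j * (if a = q j \<and> b = 0 then 1 else 0) + R j $ a $ b"
  by (simp add: E_eq[OF assms] fps_const_power)

lemma R_vertex: "j \<in> J \<Longrightarrow> R j $ 0 $ (p j) = 0" "j \<in> J \<Longrightarrow> R j $ (q j) $ 0 = 0"
  using R[of j 0 "p j"] R[of j "q j" 0] by (auto simp: mult.commute)

lemma wt_order_E:
  assumes j: "j \<in> J" and w: "w \<in> pos_pairs"
  shows "wt_order w (E j) = \<mu> j w"
proof -
  have ge: "\<mu> j w \<le> wt w (a, b)" if "E j $ a $ b \<noteq> 0" for a b
  proof (cases "R j $ a $ b = 0")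
    case True
    then have "(a = 0 \<and> b = p j) \<or> (a = q j \<and> b = 0)" using that by (auto simp: E_nth[OF j] split: if_splits)
    then show ?thesis using \<mu>_le[of j w] by (auto simp: wt_def)
  qed (use weight_R_gt[OF j w] in \<open>force simp: less_imp_le\<close>)
  show ?thesis
  proof (cases "fst w * q j \<le> snd w * p j")
    case True
    show ?thesis
      by (rule wt_order_eqI[OF w, of _ "q j" 0])
         (use True p[OF j] q[OF j] c[OF j] ge R_vertex[OF j] in \<open>auto simp: E_nth[OF j] wt_def \<mu>_def\<close>)
  next
    case False
    show ?thesis
      by (rule wt_order_eqI[OF w, of _ 0 "p j"])
         (use False p[OF j] q[OF j] ge R_vertex[OF j] in \<open>auto simp: E_nth[OF j] wt_def \<mu>_def\<close>)
  qed
qed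

lemma E_nonzero: "j \<in> J \<Longrightarrow> E j \<noteq> 0"
  using E_nth[of j 0 "p j"] R_vertex[of j] q[of j] by auto

lemma u_nonzero: "j \<in> J \<Longrightarrow> u j \<noteq> 0"
  using u[of j] by auto

lemma g_nonzero: "j \<in> J \<Longrightarrow> g j \<noteq> 0"
  using g_eq E_nonzero u_nonzero by auto

lemma wt_order_u: "j \<in> J \<Longrightarrow> w \<in> pos_pairs \<Longrightarrow> wt_order w (u j) = 0"
  using u[of j] by (intro wt_order_eqI[of w _ 0 0]) (auto simp: wt_def)

lemma wt_order_g: "j \<in> J \<Longrightarrow> w \<in> pos_pairs \<Longrightarrow> wt_order w (g j) = \<mu> j w"
  by (simp add: g_eq wt_order_mult u_nonzero E_nonzero wt_order_u wt_order_E)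

lemma wt_order_prod_g: "K \<subseteq> J \<Longrightarrow> w \<in> pos_pairs \<Longrightarrow> wt_order w (\<Prod>j\<in>K. g j) = M K w"
  unfolding M_def by (subst wt_order_prod) (auto simp: g_nonzero wt_order_g intro!: sum.cong)

lemma wt_order_f: "w \<in> pos_pairs \<Longrightarrow> wt_order w f = M J w"
  by (simp add: f wt_order_prod_g)

lemma f_nonzero: "f \<noteq> 0"
  using finite_J g_nonzero by (simp add: f)

lemma nu_f: "w \<in> pos_pairs \<Longrightarrow> nu (real_pair w) f = real (M J w)"
  using nu_eq_wt_order[OF _ f_nonzero] wt_order_f by simp

lemma nu_g: "j \<in> J \<Longrightarrow> w \<in> pos_pairs \<Longrightarrow> nu (real_pair w) (g j) = real (\<mu> j w)"
  using nu_eq_wt_order[OF _ g_nonzero] wt_order_g by simp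

lemma jet_coeff_g_below:
  "j \<in> J \<Longrightarrow> w \<in> pos_pairs \<Longrightarrow> P \<in> H_inf w \<Longrightarrow> l < \<mu> j w \<Longrightarrow> jet_coeff (g j) l P = 0"
  using jet_coeff_below[of P w l "g j"] wt_order_g by simp

lemma jet_coeff_f_below: "w \<in> pos_pairs \<Longrightarrow> P \<in> H_inf w \<Longrightarrow> l < M J w \<Longrightarrow> jet_coeff f l P = 0"
  using jet_coeff_below[of P w l f] wt_order_f by simp

lemma jet_coeff_u_0: "centered P \<Longrightarrow> jet_coeff (u j) 0 P = u j $ 0 $ 0"
  by (cases P) (simp add: jet_coeff_box[of _ _ 0 0 0])

text \<open>Along a centered arc the unit has a nonzero constant term, so multiplying by it shifts
  no order.\<close>

lemma jet_coeff_g_vanish_iff: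
  assumes "j \<in> J" "centered P"
  shows "(\<forall>l\<le>n. jet_coeff (g j) l P = 0) \<longleftrightarrow> (\<forall>l\<le>n. jet_coeff (E j) l P = 0)"
proof -
  have u0: "ev (u j) P $ 0 \<noteq> 0" using u[OF assms(1)] jet_coeff_u_0[OF assms(2)] by simp
  then have "ev (u j) P \<noteq> 0" "subdegree (ev (u j) P) = 0" by (auto simp del: ev_nth)
  then show ?thesis
    using fps_mult_vanish[of "ev (u j) P" "Suc n" "ev (E j) P"]
    by (simp add: g_eq[OF assms(1)] ev_mult[OF assms(2), symmetric] less_Suc_eq_le)
qed

lemma jet_coeff_g_initial:
  assumes j: "j \<in> J" and w: "w \<in> pos_pairs" and P: "P \<in> H_inf w"
  shows "jet_coeff (g j) (\<mu> j w) P = u j $ 0 $ 0 *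
    ((if snd w * p j = \<mu> j w then (snd P $ snd w) ^ p j else 0) - c j * (if fst w * q j = \<mu> j w then (fst P $ fst w) ^ q j else 0))"
proof -
  let ?n = "\<mu> j w"
  obtain x y where xy: "P = (x, y)" by (cases P)
  have cen: "centered P" by (rule H_inf_centered[OF P w])
  interpret B: branch_arcs "p j" "q j" 1 "c j" "R j" by (rule branch_arcs[OF j]) simp
  have "jet_coeff (R j) ?n P = 0"
    by (rule jet_coeff_weight_gt[OF P w]) (rule weight_R_gt[OF j w])
  moreover have "(y ^ p j) $ ?n = (if snd w * p j = ?n then (y $ snd w) ^ p j else 0)"
    "(x ^ q j) $ ?n = (if fst w * q j = ?n then (x $ fst w) ^ q j else 0)"
    using shifted_monomial_nth[OF fps_shift_factor fps_shift_factor, of "fst w" x "snd w" y 0 "p j" ?n]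
      shifted_monomial_nth[OF fps_shift_factor fps_shift_factor, of "fst w" x "snd w" y "q j" 0 ?n] P xy
      \<mu>_le[of j w]
    by (auto simp: H_inf_def fps_power_zeroth)
  ultimately have *: "jet_coeff (E j) ?n P = (if snd w * p j = ?n then (y $ snd w) ^ p j else 0) -
      c j * (if fst w * q j = ?n then (x $ fst w) ^ q j else 0)"
    using B.jet_coeff_eqn[of x y ?n] cen xy by (simp add: E_def)
  have below: "jet_coeff (E j) l P = 0" if "l < ?n" for l
    using jet_coeff_below[OF P w, of l "E j"] that wt_order_E[OF j w] by simp
  have "jet_coeff (g j) ?n P = (ev (u j) P * ev (E j) P) $ ?n"
    by (simp add: g_eq[OF j] ev_mult[OF cen, symmetric])
  also have "\<dots> = (\<Sum>i=0..?n. if i = 0 then ev (u j) P $ 0 * ev (E j) P $ ?n else 0)"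
    unfolding fps_mult_nth by (intro sum.cong refl) (auto simp: below)
  also have "\<dots> = u j $ 0 $ 0 * jet_coeff (E j) ?n P" by (simp add: jet_coeff_u_0[OF cen])
  finally show ?thesis using * xy by simp
qed

lemma jet_coeff_g_nonzero:
  assumes "j \<in> J" "w \<in> pos_pairs" "P \<in> H_inf w" "fst P $ fst w \<noteq> 0" "snd P $ snd w \<noteq> 0"
    and "on_ray j w \<Longrightarrow> (snd P $ snd w) ^ p j \<noteq> c j * (fst P $ fst w) ^ q j"
  shows "jet_coeff (g j) (\<mu> j w) P \<noteq> 0"
  using assms u[of j] c[of j] unfolding jet_coeff_g_initial[OF assms(1-3)]
  by (auto simp: \<mu>_def on_ray_def min_def)

text \<open>In the Cauchy product at the sum of the lower bounds, every other splitting puts one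
  factor below its own bound.\<close>

lemma jet_coeff_prod_g_initial:
  assumes "K \<subseteq> J" "w \<in> pos_pairs" "P \<in> H_inf w"
  shows "jet_coeff (\<Prod>j\<in>K. g j) (M K w) P = (\<Prod>j\<in>K. jet_coeff (g j) (\<mu> j w) P)"
proof -
  have cen: "centered P" by (rule H_inf_centered[OF assms(3,2)])
  have "finite K" using assms(1) finite_J finite_subset by blast
  then show ?thesis using assms(1)
  proof (induction K)
    case empty
    then show ?case by (simp add: M_def jet_coeff_1 cen)
  next
    case (insert j K)
    then have j: "j \<in> J" and K: "K \<subseteq> J" by auto
    have M: "M (insert j K) w = \<mu> j w + M K w" using insert by (simp add: M_def)
    have "jet_coeff (\<Prod>j\<in>insert j K. g j) (M (insert j K) w) P =
      (ev (g j) P * ev (\<Prod>j\<in>K. g j) P) $ (\<mu> j w + M K w)"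
      using insert by (simp add: M ev_mult[OF cen, symmetric])
    also have "\<dots> = (\<Sum>i=0..\<mu> j w + M K w. if i = \<mu> j w then jet_coeff (g j) i P * jet_coeff (\<Prod>j\<in>K. g j) (M K w) P else 0)"
      unfolding fps_mult_nth
    proof (intro sum.cong refl, goal_cases)
      case (1 i)
      consider "i < \<mu> j w" | "i = \<mu> j w" | "i > \<mu> j w" by linarith
      then show ?case
      proof cases
        case 3
        then have "\<mu> j w + M K w - i < M K w" using 1 by simp
        then have "jet_coeff (\<Prod>j\<in>K. g j) (\<mu> j w + M K w - i) P = 0"
          using jet_coeff_below[OF assms(3,2)] wt_order_prod_g[OF K assms(2)] by simp
        then show ?thesis using 3 by simp
      qed (use jet_coeff_g_below[OF j assms(2,3)] in auto)
    qed
    also have "\<dots> = jet_coeff (g j) (\<mu> j w) P * jet_coeff (\<Prod>j\<in>K. g j) (M K w) P" by simp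
    finally show ?case using insert by simp
  qed
qed

lemma on_ray_unique:
  assumes "i \<in> J" "j \<in> J" "on_ray i w" "on_ray j w" "w \<in> pos_pairs"
  shows "p i = p j \<and> q i = q j"
proof -
  have "fst w * snd w * (q i * p j) = fst w * snd w * (p i * q j)"
    using assms(3,4) unfolding on_ray_def by (metis mult.assoc mult.commute)
  then have eq: "q i * p j = p i * q j" using assms(5) by (auto simp: pos_pairs_def)
  have "p j dvd p i"
    using eq coprime[OF assms(2)] by (metis coprime_dvd_mult_left_iff dvd_triv_right)
  moreover have "p i dvd p j"
    using eq coprime[OF assms(1)] by (metis coprime_dvd_mult_right_iff dvd_triv_left)
  ultimately have "p i = p j" by (rule dvd_antisym[rotated])
  with eq p[OF assms(1)] show ?thesis by (simp add: mult.commute)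
qed

lemma on_ray_multiple:
  assumes "j \<in> J" "on_ray j w" "w \<in> pos_pairs"
  obtains s where "s \<ge> 1" "w = (s * p j, s * q j)"
proof -
  have eq: "fst w * q j = snd w * p j" using assms(2) by (simp add: on_ray_def)
  then have "p j dvd fst w" using coprime[OF assms(1)] by (metis coprime_dvd_mult_left_iff dvd_triv_right)
  then obtain s where s: "fst w = s * p j" by (metis dvd_div_mult_self)
  then have "snd w = s * q j" using eq p[OF assms(1)] by (simp add: mult_ac)
  moreover have "s \<ge> 1" using s assms(3) by (cases s) (auto simp: pos_pairs_def)
  ultimately show thesis using s that[of s] by (cases w) auto
qed

lemma on_ray_\<mu>: "on_ray j w \<Longrightarrow> \<mu> j w = fst w * q j" "on_ray j w \<Longrightarrow> \<mu> j w = snd w * p j"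
  by (auto simp: on_ray_def \<mu>_def)

lemma M_remove: "j \<in> J \<Longrightarrow> M J w = \<mu> j w + M (J - {j}) w"
  unfolding M_def using finite_J by (rule sum.remove)

lemma \<mu>_mono: "v \<le> w \<Longrightarrow> \<mu> j v \<le> \<mu> j w"
  unfolding \<mu>_def less_eq_prod_def by (intro min.mono mult_right_mono) auto

lemma M_mono: "v \<le> w \<Longrightarrow> M K v \<le> M K w"
  unfolding M_def by (intro sum_mono \<mu>_mono)

lemma \<mu>_strict_mono: "j \<in> J \<Longrightarrow> fst v < fst w \<Longrightarrow> snd v < snd w \<Longrightarrow> \<mu> j v < \<mu> j w"
  unfolding \<mu>_def using p[of j] q[of j] by (auto simp: min_less_iff_conj min_less_iff_disj)

lemma M_strict_mono:
  "K \<subseteq> J \<Longrightarrow> K \<noteq> {} \<Longrightarrow> fst v < fst w \<Longrightarrow> snd v < snd w \<Longrightarrow> M K v < M K w"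
  unfolding M_def using finite_J by (intro sum_strict_mono) (auto intro: \<mu>_strict_mono finite_subset)

end

text \<open>Non-degeneracy is kept as distinctness of the constants c on a common ray, and
  singularity as multiplicity at least 2, the multiplicity of a branch being min p q.\<close>

locale curve = branches J g u R p q c f
  for J :: "'j set" and g u R :: "'j \<Rightarrow> 'k::alg_closed_field fps fps" and p q :: "'j \<Rightarrow> nat" and c :: "'j \<Rightarrow> 'k"
    and f :: "'k fps fps" +
  fixes m :: nat
  assumes distinct: "i \<in> J \<Longrightarrow> j \<in> J \<Longrightarrow> i \<noteq> j \<Longrightarrow> p i = p j \<Longrightarrow> q i = q j \<Longrightarrow> c i \<noteq> c j"
    and singular: "(\<Sum>j\<in>J. min (p j) (q j)) \<ge> 2"
    and m: "m \<ge> 1"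
begin

lemma J_nonempty: "J \<noteq> {}"
  using singular by auto

section \<open>The F-sets as arcs on a single branch\<close>

definition Fset :: "nat \<times> nat \<Rightarrow> 'j \<Rightarrow> 'k arc set" where
  "Fset \<alpha> j = jet_space m \<inter> F_set (g j) \<alpha> (nu (real_pair \<alpha>) (g j) + real m - nu (real_pair \<alpha>) f)"

lemma F_bar_eq: "F_bar f (g j) m \<alpha> = zariski m closure_of (Fset \<alpha> j)"
  by (simp add: F_bar_def Fset_def)

definition idx :: "nat \<times> nat \<Rightarrow> 'j \<Rightarrow> bool" where
  "idx \<alpha> j \<longleftrightarrow> j \<in> J \<and> \<alpha> \<in> pos_pairs \<and> on_ray j \<alpha> \<and> M J \<alpha> \<le> m"

lemma Fset_iff:
  assumes "idx \<alpha> j"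
  shows "P \<in> Fset \<alpha> j \<longleftrightarrow> P \<in> jet_space m \<and> P \<in> H_inf \<alpha> \<and> fst P $ fst \<alpha> \<noteq> 0 \<and> snd P $ snd \<alpha> \<noteq> 0 \<and>
    (\<forall>l\<le>\<mu> j \<alpha> + (m - M J \<alpha>). jet_coeff (g j) l P = 0)"
proof -
  have "nu (real_pair \<alpha>) (g j) + real m - nu (real_pair \<alpha>) f = real (\<mu> j \<alpha> + (m - M J \<alpha>))"
    using assms by (simp add: idx_def nu_f nu_g of_nat_diff)
  then show ?thesis unfolding Fset_def F_set_def by (cases P) (auto simp del: of_nat_add)
qed

text \<open>The number of solved slots is d = m - \<nu>_\<alpha>(f). They all lie within the m-jets
  because each coordinate of \<alpha> is at most the order of branch j, hence at most
  \<nu>_\<alpha>(f).\<close>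

lemma Fset_arcs:
  assumes "idx (s * p j, s * q j) j" "s \<ge> 1"
  shows "Fset (s * p j, s * q j) j = branch_arcs.arcs (p j) (q j) s (c j) (R j) m (m - M J (s * p j, s * q j))"
    and "s * p j + (m - M J (s * p j, s * q j)) \<le> m" "s * q j + (m - M J (s * p j, s * q j)) \<le> m"
proof -
  let ?\<alpha> = "(s * p j, s * q j)"
  have j: "j \<in> J" and pos: "?\<alpha> \<in> pos_pairs" and M: "M J ?\<alpha> \<le> m" using assms by (auto simp: idx_def)
  interpret B: branch_arcs "p j" "q j" s "c j" "R j" by (rule branch_arcs[OF j assms(2)])
  have \<mu>: "\<mu> j ?\<alpha> = s * p j * q j" by (simp add: \<mu>_def mult_ac)
  show "Fset ?\<alpha> j = B.arcs m (m - M J ?\<alpha>)"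
  proof (rule set_eqI)
    fix P
    show "P \<in> Fset ?\<alpha> j \<longleftrightarrow> P \<in> B.arcs m (m - M J ?\<alpha>)"
      unfolding Fset_iff[OF assms(1)] B.arcs_iff \<mu>
      using jet_coeff_g_vanish_iff[OF j, of P] H_inf_centered[of P, OF _ pos]
      by (auto simp: E_def)
  qed
  have "s * p j \<le> \<mu> j ?\<alpha>" "s * q j \<le> \<mu> j ?\<alpha>" using p[OF j] q[OF j] by (auto simp: \<mu>)
  moreover have "\<mu> j ?\<alpha> \<le> M J ?\<alpha>" using M_remove[OF j] by simp
  ultimately show "s * p j + (m - M J ?\<alpha>) \<le> m" "s * q j + (m - M J ?\<alpha>) \<le> m" using M by linarith+
qed

lemma Fset_subset: "Fset \<alpha> j \<subseteq> jet_space m"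
  by (simp add: Fset_def)

lemma Fset_irreducible:
  assumes "idx \<alpha> j"
  shows "irreducible_subset (zariski m) (Fset \<alpha> j)"
proof -
  obtain s where s: "s \<ge> 1" "\<alpha> = (s * p j, s * q j)"
    using assms by (auto simp: idx_def elim: on_ray_multiple)
  then show ?thesis
    using Fset_arcs[of s j] branch_arcs.arcs_irreducible[OF branch_arcs] assms by (auto simp: idx_def)
qed

lemma Fset_nonempty: "idx \<alpha> j \<Longrightarrow> Fset \<alpha> j \<noteq> {}"
  using Fset_irreducible by (simp add: irreducible_subset_def)

lemma Fset_initial:
  assumes "idx \<alpha> j" "P \<in> Fset \<alpha> j"
  shows "(snd P $ snd \<alpha>) ^ p j = c j * (fst P $ fst \<alpha>) ^ q j"
proof -
  have j: "j \<in> J" "\<alpha> \<in> pos_pairs" "on_ray j \<alpha>" using assms by (auto simp: idx_def)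
  have "jet_coeff (g j) (\<mu> j \<alpha>) P = 0" "P \<in> H_inf \<alpha>" using assms by (auto simp: Fset_iff)
  then show ?thesis
    using jet_coeff_g_initial[OF j(1,2), of P] u[OF j(1)] on_ray_\<mu>[OF j(3)] by simp
qed

text \<open>On the same ray the two leading equations would force equal constants c; off the ray the
  initial form is a single monomial, nonzero on the torus.\<close>

lemma other_branch_nonzero:
  assumes "j \<in> J" "w \<in> pos_pairs" "on_ray j w" "P \<in> H_inf w" "fst P $ fst w \<noteq> 0" "snd P $ snd w \<noteq> 0"
    and "(snd P $ snd w) ^ p j = c j * (fst P $ fst w) ^ q j" "i \<in> J" "i \<noteq> j"
  shows "jet_coeff (g i) (\<mu> i w) P \<noteq> 0"
proof (rule jet_coeff_g_nonzero[OF assms(8,2,4,5,6)])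
  assume "on_ray i w"
  then have pq: "p i = p j" "q i = q j" using on_ray_unique[OF assms(8,1) _ assms(3,2)] by auto
  then have "c i \<noteq> c j" using distinct[OF assms(8,1,9)] by simp
  then show "(snd P $ snd w) ^ p i \<noteq> c i * (fst P $ fst w) ^ q i"
    using assms(5,7) by (simp add: pq)
qed

lemma Fset_other_nonzero:
  assumes "idx \<alpha> j" "P \<in> Fset \<alpha> j" "i \<in> J" "i \<noteq> j"
  shows "jet_coeff (g i) (\<mu> i \<alpha>) P \<noteq> 0"
  by (rule other_branch_nonzero[of j])
     (use assms Fset_initial[OF assms(1,2)] Fset_iff[OF assms(1), of P] in \<open>auto simp: idx_def\<close>)

section \<open>Covering of the jets by H-sets and F-sets\<close>

lemma pos_pairs_upward: "\<alpha> \<in> pos_pairs \<Longrightarrow> \<alpha> \<le> \<beta> \<Longrightarrow> \<beta> \<in> pos_pairs"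
  by (cases \<alpha>; cases \<beta>) (auto simp: pos_pairs_def)

lemma B_idx_iff:
  "\<gamma> \<in> B_idx f n \<longleftrightarrow> \<gamma> \<in> pos_pairs \<and> M J \<gamma> > n \<and> (\<forall>\<delta>\<in>pos_pairs. M J \<delta> > n \<longrightarrow> \<delta> \<le> \<gamma> \<longrightarrow> \<delta> = \<gamma>)"
proof -
  have "{\<gamma> \<in> pos_pairs. nu (real_pair \<gamma>) f > real n} = {\<gamma> \<in> pos_pairs. M J \<gamma> > n}"
    by (intro Collect_cong conj_cong refl) (simp only: nu_f of_nat_less_iff)
  then show ?thesis unfolding B_idx_def Let_def by auto
qed

lemma C0_iff: "P \<in> C0 f m \<longleftrightarrow> P \<in> jet_space m \<and> centered P \<and> (\<forall>l\<le>m. jet_coeff f l P = 0)"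
  by (cases P) (auto simp: C0_def centered_def)

lemma B_idx_below:
  assumes "\<alpha> \<in> pos_pairs" "M J \<alpha> > n"
  shows "\<exists>\<gamma>\<in>B_idx f n. \<gamma> \<le> \<alpha>"
  using assms
proof (induction "fst \<alpha> + snd \<alpha>" arbitrary: \<alpha> rule: less_induct)
  case less
  show ?case
  proof (cases "\<alpha> \<in> B_idx f n")
    case False
    then obtain \<delta> where \<delta>: "\<delta> \<in> pos_pairs" "M J \<delta> > n" "\<delta> \<le> \<alpha>" "\<delta> \<noteq> \<alpha>"
      using less.prems by (auto simp: B_idx_iff)
    then have "fst \<delta> + snd \<delta> < fst \<alpha> + snd \<alpha>"
      by (cases \<delta>; cases \<alpha>) auto
    from less.hyps[OF this \<delta>(1,2)] \<delta>(3) show ?thesis by (meson order.trans)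
  qed auto
qed

lemma H_inf_antimono: "\<gamma> \<le> \<alpha> \<Longrightarrow> H_inf \<alpha> \<subseteq> H_inf \<gamma>"
  by (auto simp: H_inf_def less_eq_prod_def)

text \<open>In every splitting of a level l <= m, either the product of the other branches is below
  its order or branch j is at a level where it vanishes.\<close>

lemma Fset_subset_C0:
  assumes "idx \<alpha> j"
  shows "Fset \<alpha> j \<subseteq> C0 f m"
proof
  fix P assume P: "P \<in> Fset \<alpha> j"
  have j: "j \<in> J" "\<alpha> \<in> pos_pairs" "M J \<alpha> \<le> m" using assms by (auto simp: idx_def)
  have PH: "P \<in> H_inf \<alpha>" "P \<in> jet_space m" and v: "\<And>l. l \<le> \<mu> j \<alpha> + (m - M J \<alpha>) \<Longrightarrow> jet_coeff (g j) l P = 0"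
    using P by (auto simp: Fset_iff[OF assms])
  have cen: "centered P" by (rule H_inf_centered[OF PH(1) j(2)])
  let ?r = "\<Prod>i\<in>J - {j}. g i"
  have "f = ?r * g j" unfolding f by (subst prod.remove[OF finite_J j(1)]) simp
  then have evf: "ev f P = ev ?r P * ev (g j) P" by (simp add: ev_mult[OF cen])
  have "jet_coeff f l P = 0" if "l \<le> m" for l
  proof -
    have "jet_coeff ?r i P * jet_coeff (g j) (l - i) P = 0" for i
    proof (cases "i < M (J - {j}) \<alpha>")
      case True
      then have "jet_coeff ?r i P = 0"
        using jet_coeff_below[OF PH(1) j(2)] wt_order_prod_g[OF _ j(2), of "J - {j}"] by auto
      then show ?thesis by simp
    next
      case False
      then have "l - i \<le> \<mu> j \<alpha> + (m - M J \<alpha>)" using M_remove[OF j(1), of \<alpha>] that j(3) by linarith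
      then show ?thesis using v by simp
    qed
    moreover have "jet_coeff f l P = (\<Sum>i=0..l. jet_coeff ?r i P * jet_coeff (g j) (l - i) P)"
      using arg_cong[OF evf, of "\<lambda>h. h $ l"] by (simp add: fps_mult_nth)
    ultimately show ?thesis by (simp only: sum.neutral_const)
  qed
  then show "P \<in> C0 f m" using PH cen by (simp add: C0_iff)
qed

lemma H_fin_subset_C0:
  assumes "\<gamma> \<in> pos_pairs" "M J \<gamma> > m"
  shows "H_fin m \<gamma> \<subseteq> C0 f m"
proof
  fix P :: "'k arc" assume "P \<in> H_fin m \<gamma>"
  then have P: "P \<in> H_inf \<gamma>" "P \<in> jet_space m" by (auto simp: H_fin_def)
  then show "P \<in> C0 f m"
    using H_inf_centered[OF P(1) assms(1)] jet_coeff_f_below[OF assms(1) P(1)] assms(2)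
    by (simp add: C0_iff)
qed

lemma C0_cases:
  assumes "P \<in> C0 f m"
  shows "(\<exists>\<gamma>\<in>B_idx f m. P \<in> H_fin m \<gamma>) \<or> (\<exists>\<alpha> j. idx \<alpha> j \<and> P \<in> Fset \<alpha> j)"
proof -
  obtain x y where xy: "P = (x, y)" by (cases P)
  have jet: "P \<in> jet_space m" and cen: "centered P" and van: "\<And>l. l \<le> m \<Longrightarrow> jet_coeff f l P = 0"
    using assms by (auto simp: C0_iff)
  \<comment> \<open>A zero series gets order m + 1, so an order of at most m certifies a nonzero
    leading coefficient.\<close>
  define ord where "ord x = (if x = 0 then m + 1 else subdegree x)" for x :: "'k fps"
  have ord: "x $ i = 0" if "i < ord x" for x :: "'k fps" and i using that by (auto simp: ord_def split: if_splits)
  have ord': "x $ ord x \<noteq> 0" if "ord x \<le> m" for x :: "'k fps" using that by (auto simp: ord_def split: if_splits)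
  have ord1: "ord x \<ge> 1" if "x $ 0 = 0" for x :: "'k fps"
    using that ord'[of x] by (cases "ord x") auto
  define \<alpha> where "\<alpha> = (ord x, ord y)"
  have pos: "\<alpha> \<in> pos_pairs" using cen ord1 by (auto simp: \<alpha>_def pos_pairs_def centered_def xy)
  have H: "P \<in> H_inf \<alpha>" using ord by (auto simp: H_inf_def xy \<alpha>_def)
  show ?thesis
  proof (cases "M J \<alpha> > m")
    case True
    then obtain \<gamma> where "\<gamma> \<in> B_idx f m" "\<gamma> \<le> \<alpha>" using B_idx_below[OF pos] by blast
    then show ?thesis using H jet H_inf_antimono[of \<gamma> \<alpha>] by (auto simp: H_fin_def)
  next
    case False
    then have M: "M J \<alpha> \<le> m" by simp
    have "(\<Prod>j\<in>J. jet_coeff (g j) (\<mu> j \<alpha>) P) = 0"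
      using jet_coeff_prod_g_initial[OF order.refl pos H] van[OF M] by (simp add: f)
    then obtain j where j: "j \<in> J" "jet_coeff (g j) (\<mu> j \<alpha>) P = 0"
      using finite_J by auto
    have \<mu>m: "\<mu> j \<alpha> \<le> m" using M M_remove[OF j(1), of \<alpha>] by simp
    \<comment> \<open>The variable attaining the minimum in \<mu> has order at most \<mu> <= m, so
      its leading coefficient is nonzero. Off the ray the initial form is a monomial in that
      variable and could not vanish.\<close>
    have X: "x $ ord x \<noteq> 0" if "ord x * q j \<le> ord y * p j"
    proof (rule ord')
      have "ord x * q j \<le> m" using that \<mu>m by (simp add: \<mu>_def \<alpha>_def)
      then show "ord x \<le> m" using q[OF j(1)] by (metis dual_order.trans le_add1 mult.commute mult_le_mono1 nat_mult_1)
    qed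
    have Y: "y $ ord y \<noteq> 0" if "ord y * p j \<le> ord x * q j"
    proof (rule ord')
      have "ord y * p j \<le> m" using that \<mu>m by (simp add: \<mu>_def \<alpha>_def)
      then show "ord y \<le> m" using p[OF j(1)] by (metis dual_order.trans le_add1 mult.commute mult_le_mono1 nat_mult_1)
    qed
    have ray: "on_ray j \<alpha>"
    proof (rule ccontr)
      assume "\<not> on_ray j \<alpha>"
      then show False
        using j(2) jet_coeff_g_initial[OF j(1) pos H] u[OF j(1)] c[OF j(1)] X Y
        by (auto simp: on_ray_def \<mu>_def \<alpha>_def xy min_def split: if_splits)
    qed
    have XY: "fst P $ fst \<alpha> \<noteq> 0" "snd P $ snd \<alpha> \<noteq> 0"
      using ray X Y by (auto simp: on_ray_def \<alpha>_def xy)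
    have init: "(snd P $ snd \<alpha>) ^ p j = c j * (fst P $ fst \<alpha>) ^ q j"
      using jet_coeff_g_nonzero[OF j(1) pos H XY] j(2) by blast
    have idx: "idx \<alpha> j" using j pos ray M by (simp add: idx_def)
    note other = other_branch_nonzero[OF j(1) pos ray H XY init]
    let ?r = "\<Prod>i\<in>J - {j}. g i"
    have "jet_coeff ?r (M (J - {j}) \<alpha>) P \<noteq> 0"
      using jet_coeff_prod_g_initial[OF _ pos H, of "J - {j}"] other finite_J by auto
    moreover have "jet_coeff ?r i P = 0" if "i < M (J - {j}) \<alpha>" for i
      using jet_coeff_below[OF H pos] wt_order_prod_g[OF _ pos, of "J - {j}"] that by auto
    \<comment> \<open>The complementary product has exactly this order, so the vanishing of f
      through level m passes entirely to branch j.\<close>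
    ultimately have r: "subdegree (ev ?r P) = M (J - {j}) \<alpha>" "ev ?r P \<noteq> 0"
      by (auto intro!: subdegreeI simp: fps_eq_iff)
    have "f = ?r * g j" unfolding f by (subst prod.remove[OF finite_J j(1)]) simp
    then have evf: "ev f P = ev ?r P * ev (g j) P" by (simp add: ev_mult[OF cen])
    have eq: "M (J - {j}) \<alpha> + Suc (\<mu> j \<alpha> + (m - M J \<alpha>)) = Suc m"
      using M_remove[OF j(1), of \<alpha>] M by simp
    have "\<forall>l<Suc m. (ev ?r P * ev (g j) P) $ l = 0"
      unfolding evf[symmetric] using van by (simp add: less_Suc_eq_le)
    then have "\<forall>l<Suc (\<mu> j \<alpha> + (m - M J \<alpha>)). ev (g j) P $ l = 0"
      using fps_mult_vanish[OF r(2), of "Suc (\<mu> j \<alpha> + (m - M J \<alpha>))" "ev (g j) P"] unfolding r(1) eq by blast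
    then have "P \<in> Fset \<alpha> j" unfolding Fset_iff[OF idx] using jet H XY by (simp add: less_Suc_eq_le)
    then show ?thesis using idx by blast
  qed
qed

end


section \<open>Components\<close>

lemma closure_H_inf:
  assumes "S \<subseteq> jet_space m" "S \<subseteq> H_inf \<alpha>"
  shows "zariski m closure_of S \<subseteq> H_inf \<alpha>"
proof
  fix P assume P: "P \<in> zariski m closure_of S"
  have x: "fst P $ i = 0" if "i < fst \<alpha>" for i
  proof -
    have "\<forall>Q\<in>S. coord (Inl i) Q = 0" using assms(2) that by (auto simp: H_inf_def)
    then have "coord (Inl i) P = 0" using P coord_poly_funs[of "Inl i"] in_closure_zariski[OF assms(1), of P] by blast
    then show ?thesis by simp
  qed
  have y: "snd P $ i = 0" if "i < snd \<alpha>" for i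
  proof -
    have "\<forall>Q\<in>S. coord (Inr i) Q = 0" using assms(2) that by (auto simp: H_inf_def)
    then have "coord (Inr i) P = 0" using P coord_poly_funs[of "Inr i"] in_closure_zariski[OF assms(1), of P] by blast
    then show ?thesis by simp
  qed
  show "P \<in> H_inf \<alpha>" using x y by (cases P) (auto simp: H_inf_def)
qed

lemma closure_jet_coeff:
  assumes "S \<subseteq> jet_space m" "\<And>Q. Q \<in> S \<Longrightarrow> centered Q" "\<And>Q. Q \<in> S \<Longrightarrow> jet_coeff h l Q = 0"
    and P: "P \<in> zariski m closure_of S"
  shows "centered P" "jet_coeff h l P = 0"
proof -
  show cen: "centered P"
    using closure_H_inf[OF assms(1), of "(1, 1)"] assms(2) P centered_H_inf by blast
  obtain \<phi> where \<phi>: "\<phi> \<in> poly_funs" "\<And>P. centered P \<Longrightarrow> \<phi> P = jet_coeff h l P"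
    using jet_coeff_poly_fun[of h l] by blast
  then have "\<phi> P = 0" using P assms in_closure_zariski[OF assms(1), of P] by auto
  then show "jet_coeff h l P = 0" using \<phi>(2)[OF cen] by simp
qed

lemma H_fin_closed: "closedin (zariski m) (H_fin m \<gamma> :: 'k::field arc set)"
proof -
  have "zariski m closure_of (H_fin m \<gamma>) \<subseteq> (H_fin m \<gamma> :: 'k arc set)"
    using closure_H_inf[of "H_fin m \<gamma>" m \<gamma>] closure_of_subset_topspace[of "zariski m" "H_fin m \<gamma>"]
    by (auto simp: H_fin_def)
  then show ?thesis
    by (subst closure_of_subset_eq[symmetric]) (auto simp: H_fin_def)
qed

lemma H_fin_irreducible: "irreducible_subset (zariski m) (H_fin m \<gamma> :: 'k::alg_closed_field arc set)"
proof -
  define \<Psi> :: "'k arc \<Rightarrow> 'k arc" where "\<Psi> P =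
    (Abs_fps (\<lambda>i. if fst \<gamma> \<le> i \<and> i \<le> m then fst P $ i else 0), Abs_fps (\<lambda>i. if snd \<gamma> \<le> i \<and> i \<le> m then snd P $ i else 0))" for P
  have *: "(\<lambda>P. if b then F P else 0) \<in> local_alg poly_funs \<tau>" if "F \<in> poly_funs" for b F and \<tau> :: "'k arc \<Rightarrow> 'k"
    using local_alg_alg[OF alg.gen[OF that]] by (cases b) (auto simp: local_alg_const)
  show ?thesis
  \<comment> \<open>With \<tau> = 1 every point is an admissible parameter, so an arbitrary one
    serves as witness.\<close>
  proof (rule irreducible_param[of poly_funs "\<lambda>_. 1" undefined \<Psi>])
    show "(\<lambda>P. fst (\<Psi> P) $ i) \<in> local_alg poly_funs (\<lambda>_. 1)" "(\<lambda>P. snd (\<Psi> P) $ i) \<in> local_alg poly_funs (\<lambda>_. 1)" for i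
      by (simp_all add: \<Psi>_def * poly_funs_coords)
    show "H_fin m \<gamma> = \<Psi> ` {P. (1 :: 'k) \<noteq> 0}"
    proof (intro equalityI subsetI)
      fix P :: "'k arc" assume "P \<in> H_fin m \<gamma>"
      then have "P = \<Psi> P" by (cases P) (auto simp: \<Psi>_def H_fin_def H_inf_def jet_space_def fps_eq_iff)
      then show "P \<in> \<Psi> ` {P. (1 :: 'k) \<noteq> 0}" by (intro image_eqI[of _ _ P]) auto
    qed (auto simp: H_fin_def H_inf_def jet_space_def \<Psi>_def)
  qed (auto simp: poly_funs.const H_fin_def)
qed

text \<open>Coprimality rules out p = q, so one of them is at least 3 and a + b <= d/2 + d/3 <
  d.\<close>

lemma coprime_sum_bound:
  fixes p q a b d :: nat
  assumes "p \<ge> 2" "q \<ge> 2" "coprime p q" "q * a \<le> d" "p * b \<le> d" "d \<ge> 1"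
  shows "a + b + 1 \<le> d"
proof -
  have "p \<noteq> q" using assms by auto
  then consider "p \<ge> 3" | "q \<ge> 3" using assms by linarith
  then show ?thesis
  proof cases
    case 1
    have "2 * a \<le> d" "3 * b \<le> d"
      using mult_le_mono1[OF assms(2), of a] mult_le_mono1[OF 1, of b] assms by linarith+
    then show ?thesis using assms(6) by presburger
  next
    case 2
    have "3 * a \<le> d" "2 * b \<le> d"
      using mult_le_mono1[OF assms(1), of b] mult_le_mono1[OF 2, of a] assms by linarith+
    then show ?thesis using assms(6) by presburger
  qed
qed

text \<open>Equivalent to (p - 1)(q - 1) >= 2, which fails only for p = q = 2 among p, q >=
  2.\<close>

lemma coprime_mult_bound:
  fixes p q :: nat
  assumes "p \<ge> 2" "q \<ge> 2" "coprime p q"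
  shows "p + q + 1 \<le> p * q"
proof -
  have "p \<noteq> q" using assms by auto
  then consider "p \<ge> 3" | "q \<ge> 3" using assms by linarith
  then show ?thesis
  proof cases
    case 1
    then obtain a b where "p = a + 3" "q = b + 2" using assms by (metis le_add_diff_inverse2)
    then show ?thesis by (simp add: algebra_simps)
  next
    case 2
    then obtain a b where "q = a + 3" "p = b + 2" using assms by (metis le_add_diff_inverse2)
    then show ?thesis by (simp add: algebra_simps)
  qed
qed

context curve begin

lemma Fset_H_inf: "Fset \<alpha> j \<subseteq> H_inf \<alpha>"
  by (auto simp: Fset_def F_set_def)

lemma Fset_centered: "\<alpha> \<in> pos_pairs \<Longrightarrow> P \<in> Fset \<alpha> j \<Longrightarrow> centered P"
  using Fset_H_inf H_inf_centered by blast

lemma closure_Fset_H_inf: "zariski m closure_of (Fset \<alpha> j) \<subseteq> H_inf \<alpha>"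
  by (rule closure_H_inf[OF Fset_subset Fset_H_inf])

lemma closure_Fset_jet_coeff:
  assumes "idx \<alpha> j" "P \<in> zariski m closure_of (Fset \<alpha> j)" "l \<le> \<mu> j \<alpha> + (m - M J \<alpha>)"
  shows "jet_coeff (g j) l P = 0"
proof (rule closure_jet_coeff(2)[OF Fset_subset _ _ assms(2)])
  show "centered Q" if "Q \<in> Fset \<alpha> j" for Q
    using assms(1) Fset_centered[OF _ that] by (simp add: idx_def)
  show "jet_coeff (g j) l Q = 0" if "Q \<in> Fset \<alpha> j" for Q
    using that assms(1,3) Fset_iff by blast
qed

lemma closure_Fset_C0:
  assumes "idx \<alpha> j"
  shows "zariski m closure_of (Fset \<alpha> j) \<subseteq> C0 f m"
proof
  fix P assume P: "P \<in> zariski m closure_of (Fset \<alpha> j)"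
  have S: "centered Q" "l \<le> m \<Longrightarrow> jet_coeff f l Q = 0" if "Q \<in> Fset \<alpha> j" for Q l
    using Fset_subset_C0[OF assms] that by (auto simp: C0_iff)
  have "P \<in> jet_space m" using P closure_of_subset_topspace[of "zariski m" "Fset \<alpha> j"] by auto
  moreover have "centered P"
  proof (rule H_inf_centered)
    show "P \<in> H_inf \<alpha>" using closure_Fset_H_inf P by (rule subsetD)
    show "\<alpha> \<in> pos_pairs" using assms by (simp add: idx_def)
  qed
  moreover have "jet_coeff f l P = 0" if "l \<le> m" for l
    by (rule closure_jet_coeff(2)[OF Fset_subset S(1) S(2)[OF _ that] P])
  ultimately show "P \<in> C0 f m" by (simp add: C0_iff)
qed

section \<open>Inclusions between F-sets\<close>

lemma idx_multiple:
  assumes "idx \<alpha> j"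
  obtains s where "s \<ge> 1" "\<alpha> = (s * p j, s * q j)"
  using assms by (auto simp: idx_def elim: on_ray_multiple)

text \<open>From \<beta> to \<alpha> the other branches can only gain order while the total stays at
  most m, so the level demanded of branch j at \<beta> reaches its initial level at
  \<alpha>.\<close>

lemma M_rest_mono: "\<beta> \<le> \<alpha> \<Longrightarrow> M J \<alpha> \<le> m \<Longrightarrow> j \<in> J \<Longrightarrow> \<mu> j \<alpha> \<le> \<mu> j \<beta> + (m - M J \<beta>)"
  using M_remove[of j \<alpha>] M_remove[of j \<beta>] M_mono[of \<beta> \<alpha> "J - {j}"] by linarith

lemma single_branch: "J = {j} \<Longrightarrow> p j \<ge> 2 \<and> q j \<ge> 2"
  using singular by simp

text \<open>Orders force \<beta> <= \<alpha>, and the initial level at \<alpha> forces the same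
  branch. If \<alpha> and \<beta> differ, a second branch makes the level demanded at \<beta>
  strictly higher than at \<alpha>. With a single branch both levels equal m, and only dimension
  separates the sets.\<close>

lemma Fset_subset_closure_imp:
  assumes \<alpha>: "idx \<alpha> i" and \<beta>: "idx \<beta> j" and sub: "Fset \<alpha> i \<subseteq> zariski m closure_of (Fset \<beta> j)"
  shows "\<alpha> = \<beta> \<and> i = j"
proof -
  have \<alpha>': "i \<in> J" "\<alpha> \<in> pos_pairs" "M J \<alpha> \<le> m" and \<beta>': "j \<in> J" "\<beta> \<in> pos_pairs" "M J \<beta> \<le> m"
    using \<alpha> \<beta> by (auto simp: idx_def)
  obtain P where P: "P \<in> Fset \<alpha> i" using Fset_nonempty[OF \<alpha>] by blast
  have PH: "P \<in> H_inf \<beta>" "fst P $ fst \<alpha> \<noteq> 0" "snd P $ snd \<alpha> \<noteq> 0"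
    using P sub closure_Fset_H_inf[of \<beta> j] Fset_iff[OF \<alpha>, of P] by blast+
  then have "\<not> fst \<alpha> < fst \<beta>" "\<not> snd \<alpha> < snd \<beta>" by (auto simp: H_inf_def)
  then have le: "\<beta> \<le> \<alpha>" by (simp add: less_eq_prod_def)
  have ij: "i = j"
  proof (rule ccontr)
    assume "i \<noteq> j"
    then have "jet_coeff (g j) (\<mu> j \<alpha>) P \<noteq> 0" using Fset_other_nonzero[OF \<alpha> P \<beta>'(1)] by auto
    moreover have "jet_coeff (g j) (\<mu> j \<alpha>) P = 0"
      using closure_Fset_jet_coeff[OF \<beta>] P sub M_rest_mono[OF le \<alpha>'(3) \<beta>'(1)] by blast
    ultimately show False by simp
  qed
  obtain s where s: "s \<ge> 1" "\<alpha> = (s * p j, s * q j)" using idx_multiple[OF \<alpha>] ij by auto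
  obtain s' where s': "s' \<ge> 1" "\<beta> = (s' * p j, s' * q j)" using idx_multiple[OF \<beta>] by auto
  have p': "p j \<ge> 1" and q': "q j \<ge> 1" using p q \<beta>' by auto
  show ?thesis
  proof (rule ccontr)
    assume neg: "\<not> ?thesis"
    have "s' \<le> s" using le s s' p' by simp
    moreover have "s' \<noteq> s" using neg ij s s' by auto
    ultimately have less: "s' < s" by simp
    interpret B: branch_arcs "p j" "q j" s "c j" "R j" by (rule branch_arcs[OF \<beta>'(1) s(1)])
    interpret B': branch_arcs "p j" "q j" s' "c j" "R j" by (rule branch_arcs[OF \<beta>'(1) s'(1)])
    have \<mu>: "\<mu> j \<alpha> = s * p j * q j" "\<mu> j \<beta> = s' * p j * q j" using s s' by (simp_all add: \<mu>_def mult_ac)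
    have \<alpha>j: "idx (s * p j, s * q j) j" and \<beta>j: "idx (s' * p j, s' * q j) j" using \<alpha> \<beta> ij s s' by auto
    note arcs = Fset_arcs[OF \<alpha>j s(1), folded s(2)] and arcs' = Fset_arcs[OF \<beta>j s'(1), folded s'(2)]
    show False
    proof (cases "J - {j} = {}")
      case False
      have "M (J - {j}) \<beta> < M (J - {j}) \<alpha>"
        using False less p' q' by (intro M_strict_mono) (auto simp: s s')
      then have k: "\<mu> j \<alpha> + Suc (m - M J \<alpha>) \<le> \<mu> j \<beta> + (m - M J \<beta>)" "\<mu> j \<alpha> + 1 \<le> M J \<alpha>"
        using M_remove[OF \<beta>'(1), of \<alpha>] M_remove[OF \<beta>'(1), of \<beta>] \<alpha>'(3) \<beta>'(3) by linarith+
      have "s * p j \<le> \<mu> j \<alpha>" "s * q j \<le> \<mu> j \<alpha>" using p' q' by (auto simp: \<mu>)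
      then have "s * p j + Suc (m - M J \<alpha>) \<le> m" "s * q j + Suc (m - M J \<alpha>) \<le> m"
        using k(2) \<alpha>'(3) by linarith+
      from B.arcs_exact_order[OF this] obtain P where
        P: "P \<in> Fset \<alpha> j" "jet_coeff (E j) (\<mu> j \<alpha> + Suc (m - M J \<alpha>)) P \<noteq> 0"
        unfolding arcs \<mu> E_def by blast
      have "\<forall>l\<le>\<mu> j \<beta> + (m - M J \<beta>). jet_coeff (g j) l P = 0"
        using closure_Fset_jet_coeff[OF \<beta>] P(1) sub ij by blast
      then have "\<forall>l\<le>\<mu> j \<beta> + (m - M J \<beta>). jet_coeff (E j) l P = 0"
        using jet_coeff_g_vanish_iff[OF \<beta>'(1) Fset_centered[OF \<alpha>'(2) P(1)]] by blast
      then show False using P(2) k(1) by blast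
    next
      case True
      then have J: "J = {j}" using \<beta>'(1) by auto
      have M: "M J \<alpha> = \<mu> j \<alpha>" "M J \<beta> = \<mu> j \<beta>" by (simp_all add: M_def J)
      obtain e where e: "s = s' + e" "e \<ge> 1" using less by (metis add.commute less_imp_add_positive One_nat_def Suc_leI)
      \<comment> \<open>For one branch the number of free coordinates at s (p, q) is m + s (pq - p -
        q). It grows by at least 1 from s' to s, which compensates for the extra parameter \<tau> at
        \<beta>.\<close>
      have "e * (p j + q j + 1) \<le> e * (p j * q j)"
        using coprime_mult_bound[of "p j" "q j"] single_branch[OF J] coprime[OF \<beta>'(1)] by (intro mult_le_mono2) simp
      then have "e * p j + e * q j + 1 \<le> e * (p j * q j)" using e(2) by (simp add: distrib_left)
      then have *: "s * p j + s * q j + \<mu> j \<beta> + 1 \<le> s' * p j + s' * q j + \<mu> j \<alpha>"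
        unfolding \<mu> e(1) by (simp add: algebra_simps)
      have "\<not> Fset \<alpha> j \<subseteq> zariski m closure_of B'.arcs m (m - M J \<beta>)"
      proof (rule B'.not_subset_closure_arcs[OF arcs'(2,3) B.finite_free_coords[of m "m - M J \<alpha>"]])
        show "m - s' * p j + (m - s' * q j) + 1 \<le> card (B.free_coords m (m - M J \<alpha>)) + (m - M J \<beta>)"
          using B.card_free_coords[OF arcs(2,3)] * arcs(2,3) arcs'(2,3) M \<alpha>'(3) \<beta>'(3) by linarith
        fix a
        obtain P where P: "P \<in> B.arcs m (m - M J \<alpha>)" "\<forall>v\<in>B.free_coords m (m - M J \<alpha>). coord v P = a v"
          using B.arcs_realize[OF arcs(2,3)] by blast
        have "P \<in> H_inf \<alpha>" using P(1) Fset_H_inf[of \<alpha> j] unfolding arcs(1) by blast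
        then have "fst P $ (s' * p j) = 0" using less p' by (auto simp: H_inf_def s(2))
        then show "\<exists>P\<in>Fset \<alpha> j. fst P $ (s' * p j) = 0 \<and> (\<forall>v\<in>B.free_coords m (m - M J \<alpha>). coord v P = a v)"
          using P arcs(1) by blast
      qed
      then show False using sub ij arcs'(1) by simp
    qed
  qed
qed

text \<open>If a coordinate exceeded m + 1, lowering it by 1 would keep the total order above m:
  either some branch already has order at least that lowered coordinate, or all orders are decided
  by the other coordinate. This contradicts minimality.\<close>

lemma B_idx_bound:
  assumes "\<gamma> \<in> B_idx f m"
  shows "fst \<gamma> \<le> m + 1" "snd \<gamma> \<le> m + 1"
proof -
  have \<gamma>: "\<gamma> \<in> pos_pairs" "M J \<gamma> > m" and min: "\<And>\<delta>. \<delta> \<in> pos_pairs \<Longrightarrow> M J \<delta> > m \<Longrightarrow> \<delta> \<le> \<gamma> \<Longrightarrow> \<delta> = \<gamma>"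
    using assms by (auto simp: B_idx_iff)
  show "fst \<gamma> \<le> m + 1"
  proof (rule ccontr)
    assume neg: "\<not> fst \<gamma> \<le> m + 1"
    define \<delta> where "\<delta> = (fst \<gamma> - 1, snd \<gamma>)"
    have \<delta>: "\<delta> \<in> pos_pairs" "\<delta> \<le> \<gamma>" "\<delta> \<noteq> \<gamma>"
      using \<gamma> neg by (cases \<gamma>; auto simp: \<delta>_def pos_pairs_def)+
    have "M J \<delta> > m"
    proof (cases "\<exists>j\<in>J. fst \<delta> * q j \<le> snd \<delta> * p j")
      case True
      then obtain j where j: "j \<in> J" "fst \<delta> * q j \<le> snd \<delta> * p j" by blast
      have "m < fst \<delta> * 1" using neg by (simp add: \<delta>_def)
      also have "\<dots> \<le> fst \<delta> * q j" using q[OF j(1)] by (intro mult_le_mono) auto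
      also have "\<dots> = \<mu> j \<delta>" using j by (simp add: \<mu>_def)
      also have "\<dots> \<le> M J \<delta>" using M_remove[OF j(1)] by simp
      finally show ?thesis .
    next
      case False
      have "\<mu> j \<delta> = \<mu> j \<gamma>" if "j \<in> J" for j
      proof -
        have "snd \<gamma> * p j < (fst \<gamma> - 1) * q j" using False that by (auto simp: \<delta>_def not_le)
        moreover have "(fst \<gamma> - 1) * q j \<le> fst \<gamma> * q j" by simp
        ultimately have "snd \<gamma> * p j < (fst \<gamma> - 1) * q j" "snd \<gamma> * p j < fst \<gamma> * q j" by linarith+
        then show ?thesis unfolding \<mu>_def \<delta>_def fst_conv snd_conv by linarith
      qed
      then show ?thesis using \<gamma> by (simp add: M_def)
    qed
    then show False using min[OF \<delta>(1) _ \<delta>(2)] \<delta>(3) by simp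
  qed
  show "snd \<gamma> \<le> m + 1"
  proof (rule ccontr)
    assume neg: "\<not> snd \<gamma> \<le> m + 1"
    define \<delta> where "\<delta> = (fst \<gamma>, snd \<gamma> - 1)"
    have \<delta>: "\<delta> \<in> pos_pairs" "\<delta> \<le> \<gamma>" "\<delta> \<noteq> \<gamma>"
      using \<gamma> neg by (cases \<gamma>; auto simp: \<delta>_def pos_pairs_def)+
    have "M J \<delta> > m"
    proof (cases "\<exists>j\<in>J. snd \<delta> * p j \<le> fst \<delta> * q j")
      case True
      then obtain j where j: "j \<in> J" "snd \<delta> * p j \<le> fst \<delta> * q j" by blast
      have "m < snd \<delta> * 1" using neg by (simp add: \<delta>_def)
      also have "\<dots> \<le> snd \<delta> * p j" using p[OF j(1)] by (intro mult_le_mono) auto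
      also have "\<dots> = \<mu> j \<delta>" using j by (simp add: \<mu>_def)
      also have "\<dots> \<le> M J \<delta>" using M_remove[OF j(1)] by simp
      finally show ?thesis .
    next
      case False
      have "\<mu> j \<delta> = \<mu> j \<gamma>" if "j \<in> J" for j
      proof -
        have "fst \<gamma> * q j < (snd \<gamma> - 1) * p j" using False that by (auto simp: \<delta>_def not_le)
        moreover have "(snd \<gamma> - 1) * p j \<le> snd \<gamma> * p j" by simp
        ultimately have "fst \<gamma> * q j < (snd \<gamma> - 1) * p j" "fst \<gamma> * q j < snd \<gamma> * p j" by linarith+
        then show ?thesis unfolding \<mu>_def \<delta>_def fst_conv snd_conv by linarith
      qed
      then show ?thesis using \<gamma> by (simp add: M_def)
    qed
    then show False using min[OF \<delta>(1) _ \<delta>(2)] \<delta>(3) by simp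
  qed
qed

lemma finite_B_idx: "finite (B_idx f m)"
proof (rule finite_subset)
  show "B_idx f m \<subseteq> {..m + 1} \<times> {..m + 1}" using B_idx_bound by force
qed simp

section \<open>Inclusions involving H-sets\<close>

definition vertex_arc :: "nat \<times> nat \<Rightarrow> 'k \<Rightarrow> 'k \<Rightarrow> 'k arc" where
  "vertex_arc \<gamma> a b = (Abs_fps (\<lambda>i. if i = fst \<gamma> \<and> i \<le> m then a else 0), Abs_fps (\<lambda>i. if i = snd \<gamma> \<and> i \<le> m then b else 0))"

lemma vertex_arc_H_fin: "vertex_arc \<gamma> a b \<in> H_fin m \<gamma>"
  by (simp add: vertex_arc_def H_fin_def H_inf_def jet_space_def)

lemma vertex_arc_nth:
  "fst (vertex_arc \<gamma> a b) $ i = (if i = fst \<gamma> \<and> i \<le> m then a else 0)"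
  "snd (vertex_arc \<gamma> a b) $ i = (if i = snd \<gamma> \<and> i \<le> m then b else 0)"
  by (simp_all add: vertex_arc_def)

text \<open>The bound m + 1 matters: m-jets carry no coordinate above m, so they cannot distinguish
  larger orders.\<close>

lemma H_fin_subset_H_inf_imp:
  assumes "H_fin m \<gamma> \<subseteq> (H_inf \<beta> :: 'k arc set)" "fst \<beta> \<le> m + 1" "snd \<beta> \<le> m + 1"
  shows "\<beta> \<le> \<gamma>"
proof -
  have H: "vertex_arc \<gamma> 1 1 \<in> H_inf \<beta>" using assms(1) vertex_arc_H_fin by blast
  have "fst \<beta> \<le> fst \<gamma>"
  proof (rule ccontr)
    assume "\<not> fst \<beta> \<le> fst \<gamma>"
    then have "fst (vertex_arc \<gamma> 1 1) $ fst \<gamma> = 0" "fst \<gamma> \<le> m" using H assms by (auto simp: H_inf_def)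
    then show False by (simp add: vertex_arc_nth)
  qed
  moreover have "snd \<beta> \<le> snd \<gamma>"
  proof (rule ccontr)
    assume "\<not> snd \<beta> \<le> snd \<gamma>"
    then have "snd (vertex_arc \<gamma> 1 1) $ snd \<gamma> = 0" "snd \<gamma> \<le> m" using H assms by (auto simp: H_inf_def)
    then show False by (simp add: vertex_arc_nth)
  qed
  ultimately show ?thesis by (simp add: less_eq_prod_def)
qed

lemma H_fin_subset_H_fin_imp:
  assumes "\<gamma> \<in> B_idx f m" "\<beta> \<in> B_idx f m" "H_fin m \<gamma> \<subseteq> (H_fin m \<beta> :: 'k arc set)"
  shows "\<gamma> = \<beta>"
proof -
  have "\<beta> \<le> \<gamma>" using H_fin_subset_H_inf_imp[of \<gamma> \<beta>] B_idx_bound[OF assms(2)] assms(3) by (auto simp: H_fin_def)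
  then show ?thesis using assms(1,2) by (auto simp: B_idx_iff)
qed

lemma Fset_not_subset_H_fin:
  assumes "idx \<alpha> j" "\<gamma> \<in> B_idx f m"
  shows "\<not> Fset \<alpha> j \<subseteq> H_fin m \<gamma>"
proof
  assume sub: "Fset \<alpha> j \<subseteq> H_fin m \<gamma>"
  obtain P where P: "P \<in> Fset \<alpha> j" using Fset_nonempty[OF assms(1)] by blast
  then have "P \<in> H_inf \<gamma>" "fst P $ fst \<alpha> \<noteq> 0" "snd P $ snd \<alpha> \<noteq> 0"
    using sub by (auto simp: Fset_iff[OF assms(1)] H_fin_def)
  then have "\<not> fst \<alpha> < fst \<gamma>" "\<not> snd \<alpha> < snd \<gamma>" by (auto simp: H_inf_def)
  then have "\<gamma> \<le> \<alpha>" by (simp add: less_eq_prod_def)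
  then have "M J \<gamma> \<le> M J \<alpha>" by (rule M_mono)
  then show False using assms by (simp add: idx_def B_idx_iff)
qed

lemma idx_bound:
  assumes "idx \<alpha> j" shows "fst \<alpha> \<le> m" "snd \<alpha> \<le> m"
proof -
  obtain s where s: "s \<ge> 1" "\<alpha> = (s * p j, s * q j)" using idx_multiple[OF assms] .
  then show "fst \<alpha> \<le> m" "snd \<alpha> \<le> m" using Fset_arcs(2,3)[of s j] assms by auto
qed

text \<open>The closure of an \<open>F\<close>-set satisfies \<open>y\<^sup>p = c x\<^sup>q\<close> at level \<open>\<beta>\<close>.\<close>

lemma H_fin_subset_closure_imp_less:
  assumes \<gamma>: "\<gamma> \<in> B_idx f m" and \<beta>: "idx \<beta> j" and sub: "H_fin m \<gamma> \<subseteq> zariski m closure_of (Fset \<beta> j)"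
  shows "fst \<beta> < fst \<gamma>" "snd \<beta> < snd \<gamma>"
proof -
  have \<beta>': "j \<in> J" "\<beta> \<in> pos_pairs" "M J \<beta> \<le> m" "on_ray j \<beta>" using \<beta> by (auto simp: idx_def)
  have bound: "fst \<beta> \<le> m" "snd \<beta> \<le> m" using idx_bound[OF \<beta>] by auto
  have "H_fin m \<gamma> \<subseteq> (H_inf \<beta> :: 'k arc set)" by (rule order.trans[OF sub closure_Fset_H_inf])
  then have le: "\<beta> \<le> \<gamma>" using H_fin_subset_H_inf_imp[of \<gamma> \<beta>] bound by simp
  let ?T = "vertex_arc \<gamma> 1 1"
  have T: "?T \<in> zariski m closure_of (Fset \<beta> j)" using sub vertex_arc_H_fin by blast
  have "jet_coeff (g j) (\<mu> j \<beta>) ?T = 0" "?T \<in> H_inf \<beta>"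
    using closure_Fset_jet_coeff[OF \<beta> T] subsetD[OF closure_Fset_H_inf T] by auto
  then have eq: "(snd ?T $ snd \<beta>) ^ p j = c j * (fst ?T $ fst \<beta>) ^ q j"
    using jet_coeff_g_initial[OF \<beta>'(1,2)] u[OF \<beta>'(1)] on_ray_\<mu>[OF \<beta>'(4)] by simp
  have p0: "p j > 0" "q j > 0" "c j \<noteq> 0" using p q c \<beta>'(1) by (auto simp: Suc_le_eq)
  \<comment> \<open>At level \<beta> the test arc has coefficients 0 or 1, and the leading equation
    forbids exactly one of them being zero. Both orders are met or both are exceeded.\<close>
  have "fst \<beta> = fst \<gamma> \<longleftrightarrow> snd \<beta> = snd \<gamma>"
    using eq bound p0 by (auto simp: vertex_arc_nth power_0_left split: if_splits)
  moreover have "\<beta> \<noteq> \<gamma>" using \<beta>'(3) \<gamma> by (auto simp: B_idx_iff)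
  ultimately show "fst \<beta> < fst \<gamma>" "snd \<beta> < snd \<gamma>"
    using le by (auto simp: less_eq_prod_def prod_eq_iff)
qed

text \<open>Otherwise branch j would vanish at its initial level on the whole H-set; keeping only
  the leading coefficient of a variable that attains the minimum gives a counterexample.\<close>

lemma H_fin_subset_closure_imp_order:
  assumes \<gamma>: "\<gamma> \<in> B_idx f m" and \<beta>: "idx \<beta> j" and sub: "H_fin m \<gamma> \<subseteq> zariski m closure_of (Fset \<beta> j)"
  shows "\<mu> j \<gamma> > \<mu> j \<beta> + (m - M J \<beta>)"
proof (rule ccontr)
  assume neg: "\<not> ?thesis"
  have j: "j \<in> J" using \<beta> by (simp add: idx_def)
  have pos: "\<gamma> \<in> pos_pairs" using \<gamma> by (simp add: B_idx_iff)
  \<comment> \<open>Ensures that the leading coefficient used in the test arc survives truncation at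
    m.\<close>
  have "\<mu> j \<gamma> \<le> m" using neg M_remove[OF j, of \<beta>] \<beta> by (simp add: idx_def)
  have van: "jet_coeff (g j) (\<mu> j \<gamma>) (vertex_arc \<gamma> a b) = 0" for a b
    using closure_Fset_jet_coeff[OF \<beta> subsetD[OF sub vertex_arc_H_fin[of \<gamma> a b]]] neg by simp
  have H: "vertex_arc \<gamma> a b \<in> H_inf \<gamma>" for a b using vertex_arc_H_fin by (auto simp: H_fin_def)
  have p0: "p j > 0" "q j > 0" "c j \<noteq> 0" "u j $ 0 $ 0 \<noteq> 0" using p q c u j by (auto simp: Suc_le_eq)
  show False
  proof (cases "fst \<gamma> * q j \<le> snd \<gamma> * p j")
    case True
    then have "fst \<gamma> * q j \<le> m" using \<open>\<mu> j \<gamma> \<le> m\<close> by (simp add: \<mu>_def)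
    moreover have "fst \<gamma> \<le> fst \<gamma> * q j" using p0 by simp
    ultimately have "fst \<gamma> \<le> m" by linarith
    then show False using van[of 1 0] True p0 unfolding jet_coeff_g_initial[OF j pos H]
      by (auto simp: vertex_arc_nth \<mu>_def power_0_left split: if_splits)
  next
    case False
    then have "snd \<gamma> * p j \<le> m" using \<open>\<mu> j \<gamma> \<le> m\<close> by (simp add: \<mu>_def)
    moreover have "snd \<gamma> \<le> snd \<gamma> * p j" using p0 by simp
    ultimately have "snd \<gamma> \<le> m" by linarith
    then show False using van[of 0 1] False p0 unfolding jet_coeff_g_initial[OF j pos H]
      by (auto simp: vertex_arc_nth \<mu>_def power_0_left split: if_splits)
  qed
qed

text \<open>For \<open>\<gamma> = \<beta> + (a + 1, b + 1)\<close> and \<open>d = m - \<nu>\<^sub>\<beta>(f) > 0\<close>, minimality of \<open>\<gamma>\<close> gives \<open>q a \<le> d\<close> and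
  \<open>p b \<le> d\<close>. If \<open>p, q \<ge> 2\<close>, the codimension \<open>a + b + 2\<close> of the \<open>H\<close>-set in \<^term>\<open>H_inf \<beta>\<close> is at most the
  codimension \<open>d + 1\<close> of the \<open>F\<close>-set; otherwise a second branch contradicts minimality.\<close>

lemma H_fin_subset_closure_imp:
  assumes \<gamma>: "\<gamma> \<in> B_idx f m" and \<beta>: "idx \<beta> j" and sub: "H_fin m \<gamma> \<subseteq> zariski m closure_of (Fset \<beta> j)"
  shows "M J \<beta> = m \<and> \<gamma> = \<beta> + (1, 1)"
proof -
  have \<beta>': "j \<in> J" "\<beta> \<in> pos_pairs" "M J \<beta> \<le> m" "on_ray j \<beta>" using \<beta> by (auto simp: idx_def)
  have \<gamma>': "\<gamma> \<in> pos_pairs" "M J \<gamma> > m" and min: "\<And>\<delta>. \<delta> \<in> pos_pairs \<Longrightarrow> \<delta> \<le> \<gamma> \<Longrightarrow> \<delta> \<noteq> \<gamma> \<Longrightarrow> M J \<delta> \<le> m"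
    using \<gamma> by (auto simp: B_idx_iff not_less[symmetric])
  note less = H_fin_subset_closure_imp_less[OF assms] and order = H_fin_subset_closure_imp_order[OF assms]
  have p': "p j \<ge> 1" and q': "q j \<ge> 1" using p q \<beta>' by auto
  have le: "\<beta> + (1, 1) \<le> \<gamma>" using less by (cases \<beta>; cases \<gamma>) auto
  show ?thesis
  proof (cases "M J \<beta> = m")
    case True
    have "M J (\<beta> + (1, 1)) > m"
      using M_strict_mono[OF order.refl J_nonempty, of \<beta> "\<beta> + (1, 1)"] True by (cases \<beta>) auto
    moreover have "\<beta> + (1, 1) \<in> pos_pairs" using \<beta>'(2) by (auto simp: pos_pairs_def)
    ultimately show ?thesis using min[OF _ le] True by fastforce
  next
    case False
    define d where "d = m - M J \<beta>"
    have d: "d \<ge> 1" "m = M J \<beta> + d" using False \<beta>'(3) by (auto simp: d_def)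
    obtain s where s: "s \<ge> 1" "\<beta> = (s * p j, s * q j)" using idx_multiple[OF \<beta>] .
    have \<mu>: "\<mu> j \<beta> = s * p j * q j" using s by (simp add: \<mu>_def mult_ac)
    define a where "a = fst \<gamma> - s * p j - 1"
    define b where "b = snd \<gamma> - s * q j - 1"
    have ab: "fst \<gamma> = s * p j + a + 1" "snd \<gamma> = s * q j + b + 1"
      using less s(2) by (auto simp: a_def b_def)
    have big: "fst \<gamma> * q j > \<mu> j \<beta> + d" "snd \<gamma> * p j > \<mu> j \<beta> + d"
      using order \<mu>_le[of j \<gamma>] by (auto simp: d_def)
    have small: "\<mu> j \<delta> + M (J - {j}) \<delta> \<le> m" if "\<delta> \<in> pos_pairs" "\<delta> \<le> \<gamma>" "\<delta> \<noteq> \<gamma>" for \<delta>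
      using min[OF that] M_remove[OF \<beta>'(1)] by simp
    have m_eq: "m = \<mu> j \<beta> + M (J - {j}) \<beta> + d" using d(2) M_remove[OF \<beta>'(1)] by simp
    define \<delta>1 where "\<delta>1 = (fst \<gamma> - 1, snd \<gamma>)"
    define \<delta>2 where "\<delta>2 = (fst \<gamma>, snd \<gamma> - 1)"
    have \<delta>1: "\<delta>1 \<in> pos_pairs" "\<delta>1 \<le> \<gamma>" "\<delta>1 \<noteq> \<gamma>" "\<beta> \<le> \<delta>1"
      using less \<gamma>'(1) \<beta>'(2) by (cases \<beta>; cases \<gamma>; auto simp: \<delta>1_def pos_pairs_def)+
    have \<delta>2: "\<delta>2 \<in> pos_pairs" "\<delta>2 \<le> \<gamma>" "\<delta>2 \<noteq> \<gamma>" "\<beta> \<le> \<delta>2"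
      using less \<gamma>'(1) \<beta>'(2) by (cases \<beta>; cases \<gamma>; auto simp: \<delta>2_def pos_pairs_def)+
    \<comment> \<open>The other term of this minimum exceeds the bound by \<open>big\<close>, so the
      lowered coordinate is the one that satisfies it.\<close>
    have "\<mu> j \<delta>1 \<le> \<mu> j \<beta> + d" using small[OF \<delta>1(1-3)] M_mono[OF \<delta>1(4), of "J - {j}"] m_eq by linarith
    then have "(fst \<gamma> - 1) * q j \<le> \<mu> j \<beta> + d" using big(2) unfolding \<delta>1_def \<mu>_def[of j "(fst \<gamma> - 1, snd \<gamma>)"] fst_conv snd_conv by linarith
    then have qa: "q j * a \<le> d" unfolding ab \<mu> by (simp add: algebra_simps)
    have "\<mu> j \<delta>2 \<le> \<mu> j \<beta> + d" using small[OF \<delta>2(1-3)] M_mono[OF \<delta>2(4), of "J - {j}"] m_eq by linarith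
    then have "(snd \<gamma> - 1) * p j \<le> \<mu> j \<beta> + d" using big(1) unfolding \<delta>2_def \<mu>_def[of j "(fst \<gamma>, snd \<gamma> - 1)"] fst_conv snd_conv by linarith
    then have pb: "p j * b \<le> d" unfolding ab \<mu> by (simp add: algebra_simps)
    have big': "q j * (a + 1) > d" "p j * (b + 1) > d" using big unfolding ab \<mu> by (simp_all add: algebra_simps)
    have "p j \<ge> 2 \<and> q j \<ge> 2"
    proof (rule ccontr)
      assume neg: "\<not> (p j \<ge> 2 \<and> q j \<ge> 2)"
      then have rest: "J - {j} \<noteq> {}" using single_branch \<beta>'(1) by blast
      consider "p j = 1" | "q j = 1" using neg p' q' by linarith
      then show False
      proof cases
        case 1
        \<comment> \<open>With p = 1 the bounds on b pinch. Lowering the second coordinate leaves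
          branch j at order \<mu>_\<beta> + d, while the other branches have strictly gained, so the
          total still exceeds m.\<close>
        then have b: "b = d" using pb big'(2) by simp
        have "M (J - {j}) \<beta> < M (J - {j}) \<delta>2"
          using rest less b d(1) ab s by (intro M_strict_mono) (auto simp: \<delta>2_def)
        moreover have "\<mu> j \<delta>2 = min (fst \<gamma> * q j) ((snd \<gamma> - 1) * p j)" by (simp only: \<delta>2_def \<mu>_def fst_conv snd_conv)
        moreover have "(snd \<gamma> - 1) * p j = \<mu> j \<beta> + d" using 1 b by (simp add: ab \<mu>)
        ultimately show False using small[OF \<delta>2(1-3)] m_eq big(1) by linarith
      next
        case 2
        then have a: "a = d" using qa big'(1) by simp
        have "M (J - {j}) \<beta> < M (J - {j}) \<delta>1"
          using rest less a d(1) ab s by (intro M_strict_mono) (auto simp: \<delta>1_def)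
        moreover have "\<mu> j \<delta>1 = min ((fst \<gamma> - 1) * q j) (snd \<gamma> * p j)" by (simp only: \<delta>1_def \<mu>_def fst_conv snd_conv)
        moreover have "(fst \<gamma> - 1) * q j = \<mu> j \<beta> + d" using 2 a by (simp add: ab \<mu>)
        ultimately show False using small[OF \<delta>1(1-3)] m_eq big(2) by linarith
      qed
    qed
    then have sum: "a + b + 1 \<le> d"
      using coprime_sum_bound[of "p j" "q j" a d b] coprime[OF \<beta>'(1)] qa pb d(1) by simp
    interpret B: branch_arcs "p j" "q j" s "c j" "R j" by (rule branch_arcs[OF \<beta>'(1) s(1)])
    have \<beta>j: "idx (s * p j, s * q j) j" using \<beta> s by simp
    note arcs = Fset_arcs[OF \<beta>j s(1), folded s(2), folded d_def]
    note bound = B_idx_bound[OF \<gamma>]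
    \<comment> \<open>All coordinates that are free on the H-set; the x-coefficient at order s p is
      zero there.\<close>
    let ?V = "Inl ` {fst \<gamma>..m} \<union> Inr ` {snd \<gamma>..m} :: (nat + nat) set"
    have card: "card ?V = (m + 1 - fst \<gamma>) + (m + 1 - snd \<gamma>)"
      by (subst card_Un_disjoint) (auto simp: card_image)
    have "\<not> H_fin m \<gamma> \<subseteq> zariski m closure_of B.arcs m d"
    proof (rule B.not_subset_closure_arcs[OF arcs(2,3), of ?V])
      show "m - s * p j + (m - s * q j) + 1 \<le> card ?V + d"
        unfolding card using ab sum bound arcs(2,3) by linarith
      fix v :: "nat + nat \<Rightarrow> 'k"
      define P :: "'k arc" where "P = (Abs_fps (\<lambda>i. if i \<in> {fst \<gamma>..m} then v (Inl i) else 0), Abs_fps (\<lambda>i. if i \<in> {snd \<gamma>..m} then v (Inr i) else 0))"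
      have "P \<in> H_fin m \<gamma>" "fst P $ (s * p j) = 0" "\<forall>w\<in>?V. coord w P = v w"
        using ab by (auto simp: P_def H_fin_def H_inf_def jet_space_def)
      then show "\<exists>P\<in>H_fin m \<gamma>. fst P $ (s * p j) = 0 \<and> (\<forall>w\<in>?V. coord w P = v w)" by blast
    qed simp
    then show ?thesis using sub arcs(1) by simp
  qed
qed

text \<open>Raising either coordinate of \<alpha> by 1 leaves the total at m by minimality, hence
  leaves every \<mu> unchanged. A minimum is insensitive to both increments only if its two terms
  tie.\<close>

lemma on_ray_of_vertex:
  assumes \<alpha>: "\<alpha> \<in> pos_pairs" "M J \<alpha> = m" and B: "\<alpha> + (1, 1) \<in> B_idx f m" and j: "j \<in> J"
  shows "on_ray j \<alpha>"
proof -
  have eq: "\<mu> j \<delta> = \<mu> j \<alpha>" if "\<alpha> \<le> \<delta>" "\<delta> \<le> \<alpha> + (1, 1)" "\<delta> \<noteq> \<alpha> + (1, 1)" for \<delta>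
  proof -
    have "M J \<delta> \<le> m"
      using B that pos_pairs_upward[OF \<alpha>(1) that(1)] by (auto simp: B_idx_iff not_less[symmetric])
    then show ?thesis
      using M_remove[OF j, of \<alpha>] M_remove[OF j, of \<delta>] \<mu>_mono[OF that(1), of j] M_mono[OF that(1), of "J - {j}"] \<alpha>(2)
      by linarith
  qed
  obtain a b where ab: "\<alpha> = (a, b)" by (cases \<alpha>)
  have "\<mu> j (a + 1, b) = \<mu> j (a, b)" "\<mu> j (a, b + 1) = \<mu> j (a, b)"
    using eq[of "(a + 1, b)"] eq[of "(a, b + 1)"] by (auto simp: ab)
  then have "\<not> a * q j < b * p j" "\<not> b * p j < a * q j"
    using p[OF j] q[OF j] by (auto simp: \<mu>_def min_def split: if_splits)
  then show ?thesis by (simp add: on_ray_def ab)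
qed

text \<open>When \<alpha> + (1, 1) is minimal, all branches lie on the ray of \<alpha>. The boundary
  condition then holds by hypothesis, and lowering any coordinate of \<alpha> lowers every \<mu>, so
  \<alpha> is minimal at level m - 1.\<close>

lemma B_star_eq:
  assumes frontier: "\<And>\<alpha>. \<alpha> \<in> pos_pairs \<Longrightarrow> (\<And>j. j \<in> J \<Longrightarrow> on_ray j \<alpha>) \<Longrightarrow>
    real_pair \<alpha> \<in> frontier (convex hull (tropical_variety f))"
  shows "B_star f m = B_idx f m - {\<alpha> + (1, 1) |\<alpha>. \<alpha> \<in> pos_pairs \<and> M J \<alpha> = m}"
proof -
  have "\<alpha> \<in> B_idx f (m - 1) \<and> real_pair \<alpha> \<in> frontier (convex hull (tropical_variety f)) \<and> nu (real_pair \<alpha>) f = real m"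
    if \<alpha>: "\<alpha> \<in> pos_pairs" "M J \<alpha> = m" "\<alpha> + (1, 1) \<in> B_idx f m" for \<alpha>
  proof (intro conjI)
    have ray: "on_ray j \<alpha>" if "j \<in> J" for j using on_ray_of_vertex[OF \<alpha> that] .
    show "real_pair \<alpha> \<in> frontier (convex hull (tropical_variety f))" using frontier[OF \<alpha>(1) ray] .
    show "nu (real_pair \<alpha>) f = real m" using nu_f[OF \<alpha>(1)] \<alpha>(2) by simp
    have "\<delta> = \<alpha>" if \<delta>: "\<delta> \<in> pos_pairs" "M J \<delta> > m - 1" "\<delta> \<le> \<alpha>" for \<delta>
    proof (rule ccontr)
      assume "\<delta> \<noteq> \<alpha>"
      then have less: "fst \<delta> < fst \<alpha> \<or> snd \<delta> < snd \<alpha>"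
        using \<delta>(3) by (auto simp: less_eq_prod_def prod_eq_iff)
      have "\<mu> j \<delta> < \<mu> j \<alpha>" if "j \<in> J" for j
        using less
      proof
        assume "fst \<delta> < fst \<alpha>"
        then have "fst \<delta> * q j < fst \<alpha> * q j" using q[OF that] by simp
        then show ?thesis using on_ray_\<mu>(1)[OF ray[OF that]] \<mu>_le(1)[of j \<delta>] by linarith
      next
        assume "snd \<delta> < snd \<alpha>"
        then have "snd \<delta> * p j < snd \<alpha> * p j" using p[OF that] by simp
        then show ?thesis using on_ray_\<mu>(2)[OF ray[OF that]] \<mu>_le(2)[of j \<delta>] by linarith
      qed
      then have "M J \<delta> < M J \<alpha>" unfolding M_def using finite_J J_nonempty by (intro sum_strict_mono)
      then show False using \<delta>(2) \<alpha>(2) by simp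
    qed
    then show "\<alpha> \<in> B_idx f (m - 1)" using \<alpha> m by (auto simp: B_idx_iff)
  qed
  moreover have "\<alpha> \<in> pos_pairs \<and> M J \<alpha> = m" if "\<alpha> \<in> B_idx f (m - 1)" "nu (real_pair \<alpha>) f = real m" for \<alpha>
    using that nu_f[of \<alpha>] by (auto simp: B_idx_iff simp del: map_prod_simp)
  ultimately show ?thesis unfolding B_star_def by blast
qed

text \<open>When \<nu>_\<alpha>(f) = m only the leading equation is imposed. Adding leading terms
  s^p and k s^q with k^p = c gives a curve in the F-set for s nonzero that passes through P at s =
  0.\<close>

lemma H_fin_subset_closure:
  assumes \<alpha>: "idx \<alpha> j" and M: "M J \<alpha> = m"
  shows "H_fin m (\<alpha> + (1, 1)) \<subseteq> zariski m closure_of (Fset \<alpha> j)"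
proof
  fix P :: "'k arc" assume P: "P \<in> H_fin m (\<alpha> + (1, 1))"
  have \<alpha>': "j \<in> J" "\<alpha> \<in> pos_pairs" "on_ray j \<alpha>" using \<alpha> by (auto simp: idx_def)
  have p': "p j \<ge> 1" and q': "q j \<ge> 1" using p q \<alpha>' by auto
  obtain k where k: "k ^ p j = c j" using nth_root_exists[of "p j" "c j"] p' by auto
  have k0: "k \<noteq> 0" using k c[OF \<alpha>'(1)] p' by (auto simp: power_0_left)
  define \<Gamma> where "\<Gamma> s = (fst P + fps_const (s ^ p j) * fps_X ^ fst \<alpha>, snd P + fps_const (k * s ^ q j) * fps_X ^ snd \<alpha>)" for s
  have \<Gamma>: "fst (\<Gamma> s) $ i = fst P $ i + (if i = fst \<alpha> then s ^ p j else 0)"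
    "snd (\<Gamma> s) $ i = snd P $ i + (if i = snd \<alpha> then k * s ^ q j else 0)" for s i
    by (auto simp: \<Gamma>_def)
  have P0: "fst P $ i = 0" if "i \<le> fst \<alpha> \<or> m < i" for i
    using P that by (auto simp: H_fin_def H_inf_def jet_space_def)
  have P1: "snd P $ i = 0" if "i \<le> snd \<alpha> \<or> m < i" for i
    using P that by (auto simp: H_fin_def H_inf_def jet_space_def)
  have F: "\<Gamma> s \<in> Fset \<alpha> j" if s: "s \<noteq> 0" for s
  proof -
    have jet: "\<Gamma> s \<in> jet_space m" using P0 P1 idx_bound[OF \<alpha>] by (auto simp: jet_space_def case_prod_beta \<Gamma>)
    have H: "\<Gamma> s \<in> H_inf \<alpha>" using P0 P1 by (cases "\<Gamma> s") (use \<Gamma>[of s] in \<open>auto simp: H_inf_def\<close>)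
    have "((s ^ q j) ^ p j) = (s ^ p j) ^ q j" by (simp add: mult.commute flip: power_mult)
    then have "jet_coeff (g j) (\<mu> j \<alpha>) (\<Gamma> s) = 0"
      using jet_coeff_g_initial[OF \<alpha>'(1,2) H] P0[of "fst \<alpha>"] P1[of "snd \<alpha>"] on_ray_\<mu>[OF \<alpha>'(3)] k
      by (simp add: \<Gamma> power_mult_distrib)
    then have "\<forall>l\<le>\<mu> j \<alpha>. jet_coeff (g j) l (\<Gamma> s) = 0"
      using jet_coeff_g_below[OF \<alpha>'(1,2) H] by (auto simp: le_less)
    then show ?thesis unfolding Fset_iff[OF \<alpha>] using jet H s k0 P0[of "fst \<alpha>"] P1[of "snd \<alpha>"] M by (simp add: \<Gamma>)
  qed
  have curve: "\<exists>r. \<forall>s. fst (\<Gamma> s) $ i = poly r s" "\<exists>r. \<forall>s. snd (\<Gamma> s) $ i = poly r s" for i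
    by (rule exI[of _ "[:fst P $ i:] + (if i = fst \<alpha> then monom 1 (p j) else 0)"], simp add: \<Gamma> poly_monom)
       (rule exI[of _ "[:snd P $ i:] + (if i = snd \<alpha> then monom k (q j) else 0)"], simp add: \<Gamma> poly_monom)
  have "\<phi> P = 0" if \<phi>: "\<phi> \<in> poly_funs" "\<forall>Q\<in>Fset \<alpha> j. \<phi> Q = 0" for \<phi>
  proof -
    obtain r where r: "\<And>s. \<phi> (\<Gamma> s) = poly r s" using poly_funs_curve[OF \<phi>(1), of \<Gamma>] curve by blast
    have "r = 0" using F \<phi>(2) by (intro poly_eq_0_of_infinite) (simp flip: r)
    moreover have "\<Gamma> 0 = P" using p' q' by (intro prod_eqI fps_ext) (auto simp: \<Gamma> power_0_left)
    ultimately show ?thesis using r[of 0] by simp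
  qed
  then show "P \<in> zariski m closure_of (Fset \<alpha> j)"
    using P in_closure_zariski[OF Fset_subset] by (auto simp: H_fin_def)
qed

text \<open>The tropical variety of f matters here only through the boundary condition on \<alpha>,
  which is therefore taken as a hypothesis.\<close>

theorem C0_decomposition:
  assumes frontier: "\<And>\<alpha>. \<alpha> \<in> pos_pairs \<Longrightarrow> (\<And>j. j \<in> J \<Longrightarrow> on_ray j \<alpha>) \<Longrightarrow>
    real_pair \<alpha> \<in> frontier (convex hull (tropical_variety f))"
  defines "Z \<equiv> case_sum (H_fin m) (\<lambda>(\<alpha>, j). F_bar f (g j) m \<alpha>)"
    and "K \<equiv> B_star f m <+> {(\<alpha>, j). idx \<alpha> j}"
  shows "C0 f m = (\<Union>k\<in>K. Z k)" and "bij_betw Z K (irreducible_components (zariski m) (C0 f m))"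
proof -
  have B_star: "B_star f m = B_idx f m - {\<alpha> + (1, 1) |\<alpha>. \<alpha> \<in> pos_pairs \<and> M J \<alpha> = m}"
    by (rule B_star_eq) (rule frontier)
  have sub: "B_star f m \<subseteq> B_idx f m" by (auto simp: B_star)
  show eq: "C0 f m = (\<Union>k\<in>K. Z k)"
  proof (intro equalityI subsetI)
    fix P assume "P \<in> C0 f m"
    from C0_cases[OF this] show "P \<in> (\<Union>k\<in>K. Z k)"
    proof (elim disjE bexE exE conjE)
      fix \<alpha> j assume idx: "idx \<alpha> j" and "P \<in> Fset \<alpha> j"
      then have "P \<in> F_bar f (g j) m \<alpha>"
        using closure_of_subset[of "Fset \<alpha> j" "zariski m"] Fset_subset by (auto simp: F_bar_eq)
      then show ?thesis using idx by (auto simp: K_def Z_def intro!: bexI[of _ "Inr (\<alpha>, j)"])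
    next
      fix \<gamma> assume \<gamma>: "\<gamma> \<in> B_idx f m" "P \<in> H_fin m \<gamma>"
      show ?thesis
      proof (cases "\<gamma> \<in> B_star f m")
        case True
        then show ?thesis using \<gamma> by (auto simp: K_def Z_def intro!: bexI[of _ "Inl \<gamma>"])
      next
        \<comment> \<open>A removed H-set lies in the closure of the F-set of any branch at
          \<alpha>, so the union is unchanged.\<close>
        case False
        then obtain \<alpha> where \<alpha>: "\<alpha> \<in> pos_pairs" "M J \<alpha> = m" "\<gamma> = \<alpha> + (1, 1)" using \<gamma> by (auto simp: B_star)
        obtain j where j: "j \<in> J" using J_nonempty by blast
        have "idx \<alpha> j" using on_ray_of_vertex[OF \<alpha>(1,2) _ j] \<gamma> \<alpha> j by (simp add: idx_def)
        then have "Inr (\<alpha>, j) \<in> K" "P \<in> Z (Inr (\<alpha>, j))"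
          using H_fin_subset_closure[of \<alpha> j] \<alpha> \<gamma> by (auto simp: K_def Z_def F_bar_eq)
        then show ?thesis by blast
      qed
    qed
  next
    fix P assume "P \<in> (\<Union>k\<in>K. Z k)"
    then obtain k where k: "k \<in> K" "P \<in> Z k" by blast
    show "P \<in> C0 f m"
    proof (cases k)
      case (Inl \<gamma>)
      then have "\<gamma> \<in> B_idx f m" "P \<in> H_fin m \<gamma>" using k sub by (auto simp: K_def Z_def)
      then show ?thesis using H_fin_subset_C0[of \<gamma>] by (auto simp: B_idx_iff)
    next
      case (Inr v)
      then obtain \<alpha> j where "idx \<alpha> j" "P \<in> zariski m closure_of (Fset \<alpha> j)"
        using k by (auto simp: K_def Z_def F_bar_eq)
      then show ?thesis using closure_Fset_C0[of \<alpha> j] by blast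
    qed
  qed
  show "bij_betw Z K (irreducible_components (zariski m) (C0 f m))"
  proof (rule irreducible_components_finite_union[OF _ eq])
    have "{(\<alpha>, j). idx \<alpha> j} \<subseteq> ({..m} \<times> {..m}) \<times> J"
    proof clarify
      fix a b j assume idx: "idx (a, b) j"
      then show "(a, b) \<in> {..m} \<times> {..m} \<and> j \<in> J" using idx_bound[OF idx] by (simp add: idx_def)
    qed
    moreover have "finite (({..m} \<times> {..m}) \<times> J)" using finite_J by simp
    ultimately have "finite {(\<alpha>, j). idx \<alpha> j}" by (rule finite_subset)
    then show "finite K" using finite_B_idx sub finite_subset by (auto simp: K_def)
    show "irreducible_subset (zariski m) (Z k)" if k: "k \<in> K" for k
    proof (cases k)
      case (Inl \<gamma>)
      then show ?thesis by (simp add: Z_def H_fin_irreducible)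
    next
      case (Inr v)
      then obtain \<alpha> j where "v = (\<alpha>, j)" "idx \<alpha> j" using k by (auto simp: K_def)
      then show ?thesis using irreducible_closure[OF Fset_irreducible[of \<alpha> j]] Inr by (simp add: Z_def F_bar_eq)
    qed
    show "closedin (zariski m) (Z k)" if "k \<in> K" for k
      by (cases k) (simp_all add: Z_def F_bar_eq H_fin_closed case_prod_beta)
    show "k = l" if kl: "k \<in> K" "l \<in> K" "Z k \<subseteq> Z l" for k l
    proof -
      have cl: "Fset \<alpha> j \<subseteq> zariski m closure_of (Fset \<alpha> j)" for \<alpha> j
        by (rule closure_of_subset) (simp add: Fset_subset)
      show ?thesis
      proof (cases k)
        case k: (Inl \<gamma>)
        then have \<gamma>: "\<gamma> \<in> B_star f m" using kl by (auto simp: K_def)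
        show ?thesis
        proof (cases l)
          case (Inl \<gamma>')
          then show ?thesis using kl k \<gamma> sub H_fin_subset_H_fin_imp[of \<gamma> \<gamma>'] by (auto simp: K_def Z_def)
        next
          case (Inr v)
          then obtain \<alpha> j where v: "v = (\<alpha>, j)" "idx \<alpha> j" using kl by (auto simp: K_def)
          have "M J \<alpha> = m \<and> \<gamma> = \<alpha> + (1, 1)"
            using H_fin_subset_closure_imp[OF _ v(2), of \<gamma>] kl(3) k Inr v \<gamma> sub by (auto simp: Z_def F_bar_eq)
          moreover have "\<alpha> \<in> pos_pairs" using v(2) by (simp add: idx_def)
          ultimately have "\<gamma> \<notin> B_star f m" unfolding B_star by blast
          then show ?thesis using \<gamma> by blast
        qed
      next
        case k: (Inr v)
        then obtain \<alpha> j where v: "v = (\<alpha>, j)" "idx \<alpha> j" using kl by (auto simp: K_def)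
        have "Z k = zariski m closure_of (Fset \<alpha> j)" by (simp add: k v Z_def F_bar_eq)
        then have F: "Fset \<alpha> j \<subseteq> Z l" using kl(3) cl[of \<alpha> j] by simp
        show ?thesis
        proof (cases l)
          case (Inl \<gamma>)
          then show ?thesis using F Fset_not_subset_H_fin[OF v(2), of \<gamma>] kl(2) sub by (auto simp: K_def Z_def)
        next
          case (Inr w)
          then obtain \<beta> i where w: "w = (\<beta>, i)" "idx \<beta> i" using kl by (auto simp: K_def)
          then have "\<alpha> = \<beta> \<and> j = i"
            using Fset_subset_closure_imp[OF v(2) w(2)] F Inr by (auto simp: Z_def F_bar_eq)
          then show ?thesis using k v w Inr by simp
        qed
      qed
    qed
  qed
qed

end


section \<open>Newton polyhedra and tropical varieties\<close>

definition init_supp :: "nat \<times> nat \<Rightarrow> 'k::comm_ring_1 fps fps \<Rightarrow> (nat \<times> nat) set" where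
  "init_supp w h = {e \<in> supp h. wt w e = wt_order w h}"

definition init_face :: "nat \<times> nat \<Rightarrow> 'k::comm_ring_1 fps fps \<Rightarrow> (real \<times> real) set" where
  "init_face w h = newton_polyhedron h \<inter> {P. real_pair w \<bullet> P = real (wt_order w h)}"

lemma finite_weight: "w \<in> pos_pairs \<Longrightarrow> finite {e. wt w e = n}"
proof (rule finite_subset)
  assume w: "w \<in> pos_pairs"
  show "{e. wt w e = n} \<subseteq> {..n} \<times> {..n}"
  proof clarify
    fix a b assume "n = wt w (a, b)"
    moreover have "a \<le> fst w * a" "b \<le> snd w * b" using w by (auto simp: pos_pairs_def)
    ultimately show "a \<in> {..wt w (a, b)} \<and> b \<in> {..wt w (a, b)}" unfolding wt_def fst_conv snd_conv atMost_iff by linarith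
  qed
qed simp

lemma finite_init_supp: "w \<in> pos_pairs \<Longrightarrow> finite (init_supp w h)"
  using finite_subset[OF _ finite_weight[of w "wt_order w h"]] by (auto simp: init_supp_def)

lemma init_supp_nonempty: "w \<in> pos_pairs \<Longrightarrow> h \<noteq> 0 \<Longrightarrow> init_supp w h \<noteq> {}"
  by (rule wt_order_attained[of w h]) (auto simp: init_supp_def supp_def)

lemma supp_in_newton_polyhedron: "e \<in> supp h \<Longrightarrow> real_pair e \<in> newton_polyhedron h"
  unfolding newton_polyhedron_def
  by (intro hull_inc UN_I[of e], assumption) (cases e, auto intro!: image_eqI[of _ _ "(0, 0)"])

text \<open>The right-hand side is convex: the hull lies on the supporting line, and a proper
  mixture with a point strictly above it is strictly above. It contains the generators because, for
  a positive weight, a nonzero quadrant vector raises the weight. Hence the face cut out by w is the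
  hull of finitely many points.\<close>

lemma newton_polyhedron_subset:
  assumes w: "w \<in> pos_pairs"
  shows "newton_polyhedron h \<subseteq> convex hull (real_pair ` init_supp w h) \<union> {P. real_pair w \<bullet> P > real (wt_order w h)}"
    (is "_ \<subseteq> ?C \<union> ?U")
proof -
  let ?n = "real (wt_order w h)"
  have C: "real_pair w \<bullet> P = ?n" if "P \<in> ?C" for P
  proof -
    have "?C \<subseteq> {P. real_pair w \<bullet> P = ?n}"
      by (intro hull_minimal image_subsetI CollectI convex_hyperplane) (simp add: init_supp_def inner_real_pair)
    then show ?thesis using that by auto
  qed
  have "convex (?C \<union> ?U)"
  proof (rule convexI)
    fix x y :: "real \<times> real" and u v :: real
    assume xy: "x \<in> ?C \<union> ?U" "y \<in> ?C \<union> ?U" and uv: "0 \<le> u" "0 \<le> v" "u + v = 1"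
    have le: "?n \<le> real_pair w \<bullet> P" if "P \<in> ?C \<union> ?U" for P using C[of P] that by auto
    show "u *\<^sub>R x + v *\<^sub>R y \<in> ?C \<union> ?U"
    proof (cases "x \<in> ?C \<and> y \<in> ?C")
      case True
      then show ?thesis using convexD[OF convex_convex_hull _ _ uv, of x _ y] by blast
    next
      case False
      consider "u = 0" | "v = 0" | "u > 0" "v > 0" using uv by linarith
      then show ?thesis
      proof cases
        case 3
        have "u * ?n + v * ?n < u * (real_pair w \<bullet> x) + v * (real_pair w \<bullet> y)"
        proof (cases "x \<in> ?C")
          case True
          then have "?n < real_pair w \<bullet> y" using False xy by auto
          then show ?thesis using 3 le[OF xy(1)] by (intro add_le_less_mono mult_left_mono mult_strict_left_mono) auto
        next
          case x: False
          then have "?n < real_pair w \<bullet> x" using xy by auto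
          then show ?thesis using 3 le[OF xy(2)] by (intro add_less_le_mono mult_left_mono mult_strict_left_mono) auto
        qed
        then have "?n < real_pair w \<bullet> (u *\<^sub>R x + v *\<^sub>R y)"
          using uv by (simp add: inner_add_right flip: distrib_right)
        then show ?thesis by simp
      qed (use xy uv in auto)
    qed
  qed
  moreover have "(\<Union>p\<in>supp h. (+) (real_pair p) ` ({0..} \<times> {0..})) \<subseteq> ?C \<union> ?U"
  proof
    fix P assume "P \<in> (\<Union>p\<in>supp h. (+) (real_pair p) ` ({0..} \<times> {0..}))"
    then obtain a b X Y where e: "(a, b) \<in> supp h" and XY: "X \<ge> 0" "Y \<ge> 0" and P: "P = real_pair (a, b) + (X, Y)"
      by fastforce
    show "P \<in> ?C \<union> ?U"
    proof (cases "real_pair w \<bullet> P > ?n")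
      case False
      obtain w1 w2 where w12: "w = (w1, w2)" "w1 \<ge> 1" "w2 \<ge> 1" using w by (cases w) (auto simp: pos_pairs_def)
      have "?n \<le> real (wt w (a, b))" using wt_order_le[OF w, of h a b] e by (simp add: supp_def)
      moreover have "real_pair w \<bullet> (real_pair (a, b) + (X, Y)) = real (wt w (a, b)) + (real w1 * X + real w2 * Y)"
        by (simp add: w12 wt_def inner_prod_def algebra_simps)
      moreover have "real w1 * X \<ge> X" "real w2 * Y \<ge> Y"
        using mult_right_mono[of 1 "real w1" X] mult_right_mono[of 1 "real w2" Y] w12 XY by auto
      ultimately have "wt w (a, b) = wt_order w h" "X = 0" "Y = 0" using False XY unfolding P by linarith+
      then have "P \<in> real_pair ` init_supp w h"
        using e by (intro image_eqI[of _ _ "(a, b)"]) (auto simp: init_supp_def P)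
      then have "P \<in> ?C" by (rule hull_inc)
      then show ?thesis ..
    qed simp
  qed
  ultimately show ?thesis unfolding newton_polyhedron_def by (intro hull_minimal)
qed

lemma init_face_eq:
  assumes "w \<in> pos_pairs"
  shows "init_face w h = convex hull (real_pair ` init_supp w h)"
proof
  show "init_face w h \<subseteq> convex hull (real_pair ` init_supp w h)"
    using newton_polyhedron_subset[OF assms, of h] by (auto simp: init_face_def)
  have "real_pair ` init_supp w h \<subseteq> init_face w h"
    by (intro image_subsetI) (simp add: init_face_def init_supp_def inner_real_pair supp_in_newton_polyhedron)
  moreover have "convex (init_face w h)"
    unfolding init_face_def newton_polyhedron_def by (intro convex_Int convex_convex_hull convex_hyperplane)
  ultimately show "convex hull (real_pair ` init_supp w h) \<subseteq> init_face w h" by (rule hull_minimal)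
qed

lemma init_face_face_of:
  assumes "w \<in> pos_pairs"
  shows "init_face w h face_of newton_polyhedron h"
  unfolding init_face_def
proof (rule face_of_Int_supporting_hyperplane_ge)
  show "convex (newton_polyhedron h)" by (simp add: newton_polyhedron_def)
  fix P assume "P \<in> newton_polyhedron h"
  then consider "P \<in> convex hull (real_pair ` init_supp w h)" | "real_pair w \<bullet> P > real (wt_order w h)"
    using newton_polyhedron_subset[OF assms, of h] by blast
  then show "real (wt_order w h) \<le> real_pair w \<bullet> P"
  proof cases
    case 1
    then have "P \<in> init_face w h" using init_face_eq[OF assms] by blast
    then show ?thesis by (simp add: init_face_def)
  qed simp
qed

lemma init_face_compact: "w \<in> pos_pairs \<Longrightarrow> compact (init_face w h)"
  by (simp add: init_face_eq finite_init_supp finite_imp_compact_convex_hull)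

lemma init_face_nonempty: "w \<in> pos_pairs \<Longrightarrow> h \<noteq> 0 \<Longrightarrow> init_face w h \<noteq> {}"
  by (simp add: init_face_eq init_supp_nonempty)

lemma face_poly_init_face:
  assumes w: "w \<in> pos_pairs"
  shows "face_poly h (init_face w h) = init_form w h"
proof (intro poly_eqI)
  fix a b
  let ?S = "{p. real_pair p \<in> init_face w h}"
  have wt: "wt w p = wt_order w h" if "p \<in> ?S" for p
    using that inner_real_pair[of w p] by (simp add: init_face_def del: map_prod_simp)
  have fin: "finite ?S"
    using wt by (intro finite_subset[OF _ finite_weight[OF w, of "wt_order w h"]]) auto
  have "coeff (coeff (face_poly h (init_face w h)) a) b = (\<Sum>p\<in>?S. if p = (a, b) then h $ a $ b else 0)"
    unfolding face_poly_def by (auto simp: coeff_sum case_prod_beta intro!: sum.cong)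
  also have "\<dots> = (if (a, b) \<in> ?S then h $ a $ b else 0)" by (simp add: fin)
  also have "\<dots> = (if wt w (a, b) = wt_order w h then h $ a $ b else 0)"
  proof (cases "h $ a $ b = 0")
    case False
    then have "(a, b) \<in> ?S \<longleftrightarrow> wt w (a, b) = wt_order w h"
      using wt supp_in_newton_polyhedron[of "(a, b)" h] inner_real_pair[of w "(a, b)"]
      by (auto simp: init_face_def supp_def simp del: map_prod_simp)
    then show ?thesis by simp
  qed simp
  finally show "coeff (coeff (face_poly h (init_face w h)) a) b = coeff (coeff (init_form w h) a) b"
    by (simp add: init_form_def coeff_wt_fps[OF w])
qed

text \<open>An initial form vanishing on the torus is not a monomial, so its face is an edge.\<close>

lemma mem_tropical_variety:
  fixes h :: "'k::field fps fps"
  assumes w: "w \<in> pos_pairs" and h: "h \<noteq> 0" and z: "poly2 (init_form w h) X Y = 0" "X \<noteq> 0" "Y \<noteq> 0"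
  shows "real_pair w \<in> tropical_variety h"
proof -
  have "\<exists>d\<in>init_supp w h. \<exists>e\<in>init_supp w h. d \<noteq> e"
  proof (rule ccontr)
    assume neg: "\<not> ?thesis"
    obtain a b where ab: "(a, b) \<in> init_supp w h" using init_supp_nonempty[OF w h] by auto
    have "init_form w h = monom (monom (h $ a $ b) b) a"
    proof (intro poly_eqI)
      fix a' b'
      have "wt w (a', b') = wt_order w h \<and> h $ a' $ b' \<noteq> 0 \<longleftrightarrow> (a', b') = (a, b)"
        using neg ab by (auto simp: init_supp_def supp_def)
      then show "coeff (coeff (init_form w h) a') b' = coeff (coeff (monom (monom (h $ a $ b) b) a) a') b'"
        by (auto simp: init_form_def coeff_wt_fps[OF w])
    qed
    then have "poly2 (init_form w h) X Y = h $ a $ b * Y ^ b * X ^ a"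
      by (simp add: poly2_def poly_monom poly_power)
    then show False using z ab by (auto simp: init_supp_def supp_def)
  qed
  then obtain d e where de: "d \<in> init_supp w h" "e \<in> init_supp w h" "d \<noteq> e" by blast
  have w0: "real_pair w \<noteq> 0" using w by (cases w) (auto simp: pos_pairs_def zero_prod_def)
  \<comment> \<open>The face lies on a line and contains two distinct points, so its dimension is
    exactly 1.\<close>
  have "aff_dim (init_face w h) \<le> aff_dim {P. real_pair w \<bullet> P = real (wt_order w h)}"
    by (rule aff_dim_subset) (auto simp: init_face_def)
  also have "\<dots> = 1" using w0 by simp
  finally have "aff_dim (init_face w h) \<le> 1" .
  moreover have "{real_pair d, real_pair e} \<subseteq> init_face w h"
    using de hull_subset[of "real_pair ` init_supp w h" convex] unfolding init_face_eq[OF w] by blast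
  then have "aff_dim {real_pair d, real_pair e} \<le> aff_dim (init_face w h)" by (rule aff_dim_subset)
  moreover have "real_pair d \<noteq> real_pair e" using de(3) by (cases d; cases e) auto
  ultimately have "aff_dim (init_face w h) = 1" by simp
  then have edge: "init_face w h edge_of newton_polyhedron h"
    using init_face_face_of[OF w] by (simp add: edge_of_def)
  have nu: "real_pair w \<bullet> P = nu (real_pair w) h" if "P \<in> init_face w h" for P
    using that nu_eq_wt_order[OF w h] by (simp add: init_face_def)
  have nonneg: "real_pair w \<in> {0..} \<times> {0..}" by (cases w) auto
  show ?thesis
    unfolding tropical_variety_def
  proof (rule UN_I[of "init_face w h"])
    show "init_face w h \<in> {\<Phi>. \<Phi> edge_of newton_polyhedron h \<and> compact \<Phi>}"
      using edge init_face_compact[OF w] by simp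
    show "real_pair w \<in> {\<omega> \<in> {0..} \<times> {0..}. \<forall>P\<in>init_face w h. \<omega> \<bullet> P = nu \<omega> h}"
      using nonneg nu by simp
  qed
qed

text \<open>Excludes a tropical factor with no branch, since the empty set is not a semi-line. A
  face of the quadrant containing P contains 2 P, as P is the midpoint of 0 and 2 P; a compact face
  is thus at most the origin and cannot be an edge.\<close>

lemma tropical_variety_1: "tropical_variety (1 :: 'k::comm_ring_1 fps fps) = {}"
proof -
  have "supp (1 :: 'k fps fps) = {(0, 0)}"
  proof -
    have "(1 :: 'k fps fps) $ a $ b \<noteq> 0 \<longleftrightarrow> a = 0 \<and> b = 0" for a b by auto
    then show ?thesis by (auto simp: supp_def)
  qed
  then have NP: "newton_polyhedron (1 :: 'k fps fps) = {0..} \<times> {0..}"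
  proof -
    have "(+) (0 :: real, 0 :: real) ` S = S" for S by (simp flip: zero_prod_def)
    then show ?thesis
      unfolding newton_polyhedron_def \<open>supp 1 = {(0, 0)}\<close> by (simp add: convex_Times hull_same)
  qed
  have "\<not> \<Phi> edge_of newton_polyhedron (1 :: 'k fps fps)" if cpt: "compact \<Phi>" for \<Phi>
  proof
    assume edge: "\<Phi> edge_of newton_polyhedron (1 :: 'k fps fps)"
    then have face: "\<Phi> face_of {0..} \<times> {0..}" and dim: "aff_dim \<Phi> = 1" by (auto simp: edge_of_def NP)
    obtain B where B: "\<And>P. P \<in> \<Phi> \<Longrightarrow> norm P \<le> B"
      using compact_imp_bounded[OF cpt] by (auto simp: bounded_iff)
    have double: "2 *\<^sub>R P \<in> \<Phi>" if "P \<in> \<Phi>" for P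
    proof (cases "P = 0")
      case False
      have PQ: "P \<in> {0..} \<times> {0..}" using face_of_imp_subset[OF face] that by blast
      have seg: "P \<in> open_segment 0 (2 *\<^sub>R P)"
        using False by (auto simp: in_segment intro!: exI[of _ "1/2"])
      have ends: "(0 :: real \<times> real) \<in> {0..} \<times> {0..}" "2 *\<^sub>R P \<in> {0..} \<times> {0..}" using PQ by (auto simp: zero_prod_def)
      show ?thesis using face_ofD[OF face seg ends that] ..
    qed (use that in simp)
    have pow: "2 ^ n *\<^sub>R P \<in> \<Phi>" if "P \<in> \<Phi>" for P n
    proof (induction n)
      case (Suc n)
      then show ?case using double[OF Suc] by simp
    qed (use that in simp)
    have "P = 0" if P: "P \<in> \<Phi>" for P
    proof (rule ccontr)
      assume "P \<noteq> 0"
      then obtain n where "B / norm P < 2 ^ n" using real_arch_pow[of 2 "B / norm P"] by auto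
      then have "B < norm (2 ^ n *\<^sub>R P)" using \<open>P \<noteq> 0\<close> by (simp add: field_simps)
      then show False using B[OF pow[OF P, of n]] by simp
    qed
    then have "\<Phi> \<subseteq> {0}" by blast
    then have "aff_dim \<Phi> \<le> aff_dim {0 :: real \<times> real}" by (rule aff_dim_subset)
    then show False using dim by simp
  qed
  then have "{\<Phi>. \<Phi> edge_of newton_polyhedron (1 :: 'k fps fps) \<and> compact \<Phi>} = {}" by blast
  then show ?thesis by (simp only: tropical_variety_def UN_empty)
qed

section \<open>Semi-lines and lattice points on rays\<close>

lemma semi_line_eq_ray:
  assumes "semi_line L" "v \<in> L" "v \<noteq> 0"
  shows "L = {s *\<^sub>R v |s. s \<ge> 0}"
proof -
  obtain a where a: "L = {s *\<^sub>R a |s. s \<ge> 0}" using assms(1) by (auto simp: semi_line_def)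
  then obtain r where r: "v = r *\<^sub>R a" "r \<ge> 0" using assms(2) by auto
  then have r0: "r > 0" using assms(3) by (cases "r = 0") auto
  show ?thesis
  proof (intro equalityI subsetI)
    fix x assume "x \<in> L"
    then obtain s where "x = s *\<^sub>R a" "s \<ge> 0" using a by auto
    then show "x \<in> {s *\<^sub>R v |s. s \<ge> 0}" using r r0 by (intro CollectI exI[of _ "s / r"]) auto
  next
    fix x assume "x \<in> {s *\<^sub>R v |s. s \<ge> 0}"
    then obtain s where "x = s *\<^sub>R v" "s \<ge> 0" by auto
    then show "x \<in> L" unfolding a using r by (intro CollectI exI[of _ "s * r"]) auto
  qed
qed

lemma mem_ray_iff:
  assumes "w \<in> pos_pairs"
  shows "real_pair \<alpha> \<in> {s *\<^sub>R real_pair w |s. s \<ge> 0} \<longleftrightarrow> fst \<alpha> * snd w = snd \<alpha> * fst w"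
proof
  assume "real_pair \<alpha> \<in> {s *\<^sub>R real_pair w |s. s \<ge> 0}"
  then obtain s where "real_pair \<alpha> = s *\<^sub>R real_pair w" by blast
  then have "real (fst \<alpha>) = s * real (fst w)" "real (snd \<alpha>) = s * real (snd w)"
    by (cases \<alpha>; cases w; simp)+
  then have "real (fst \<alpha> * snd w) = real (snd \<alpha> * fst w)" by simp
  then show "fst \<alpha> * snd w = snd \<alpha> * fst w" by (simp only: of_nat_eq_iff)
next
  assume eq: "fst \<alpha> * snd w = snd \<alpha> * fst w"
  have w0: "real (fst w) > 0" using assms by (auto simp: pos_pairs_def)
  have "real (fst \<alpha>) * real (snd w) = real (snd \<alpha>) * real (fst w)" using eq by (metis of_nat_mult)
  then have "real_pair \<alpha> = (real (fst \<alpha>) / real (fst w)) *\<^sub>R real_pair w"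
    using w0 by (cases \<alpha>; cases w) (auto simp: field_simps)
  then show "real_pair \<alpha> \<in> {s *\<^sub>R real_pair w |s. s \<ge> 0}" by (intro CollectI exI conjI) auto
qed

text \<open>A ray spans only a line, so its hull has empty interior and every point of it is a
  boundary point.\<close>

lemma frontier_ray:
  fixes v :: "real \<times> real"
  assumes "v \<noteq> 0"
  shows "v \<in> frontier (convex hull {s *\<^sub>R v |s. s \<ge> 0})"
proof -
  let ?L = "{s *\<^sub>R v |s. s \<ge> 0}"
  let ?n = "(- snd v, fst v)"
  have n0: "?n \<noteq> 0" using assms by (cases v) (auto simp: zero_prod_def)
  have "?L \<subseteq> {x. ?n \<bullet> x = 0}" by (cases v) (auto simp: inner_prod_def)
  then have "convex hull ?L \<subseteq> {x. ?n \<bullet> x = 0}" by (rule hull_minimal) (rule convex_hyperplane)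
  then have "interior (convex hull ?L) \<subseteq> interior {x. ?n \<bullet> x = 0}" by (rule interior_mono)
  then have "interior (convex hull ?L) = {}" using interior_hyperplane[OF n0, of 0] by simp
  moreover have "v \<in> ?L" by (intro CollectI exI[of _ 1]) auto
  then have "v \<in> closure (convex hull ?L)" by (intro subsetD[OF closure_subset] hull_inc)
  ultimately show ?thesis by (simp add: frontier_def)
qed

section \<open>From singularity and non-degeneracy to data on the branches\<close>

lemma dy_mult:
  fixes A B :: "'a::idom poly poly"
  shows "dy (A * B) = A * dy B + B * dy A"
proof (rule poly_eqI)
  fix n
  have pderiv_sum: "pderiv (\<Sum>i\<in>I. F i) = (\<Sum>i\<in>I. pderiv (F i))" for I :: "nat set" and F :: "nat \<Rightarrow> 'a poly"
    by (induction I rule: infinite_finite_induct) (simp_all add: pderiv_add)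
  show "coeff (dy (A * B)) n = coeff (A * dy B + B * dy A) n"
  proof -
    have "coeff (dy (A * B)) n = (\<Sum>i\<le>n. coeff A i * pderiv (coeff B (n - i)) + coeff B (n - i) * pderiv (coeff A i))"
      by (simp add: dy_def coeff_map_poly coeff_mult pderiv_sum pderiv_mult)
    moreover have "coeff (B * dy A) n = coeff (dy A * B) n" by (simp only: mult.commute)
    moreover have "\<dots> = (\<Sum>i\<le>n. coeff B (n - i) * pderiv (coeff A i))"
      unfolding coeff_mult by (intro sum.cong refl) (simp add: dy_def coeff_map_poly mult.commute)
    ultimately show ?thesis by (simp add: dy_def coeff_map_poly coeff_mult sum.distrib)
  qed
qed

text \<open>For the weight (1, 1) the order is the multiplicity at the origin; singularity kills the
  constant and linear terms.\<close>

lemma wt_order_singular: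
  fixes f :: "'k::idom poly poly"
  assumes "singular_at_origin f" "f \<noteq> 0"
  shows "2 \<le> wt_order (1, 1) (fps2_of_poly2 f)"
proof -
  have c: "coeff (coeff f 0) 0 = 0" "coeff (coeff f 1) 0 = 0" "coeff (coeff f 0) 1 = 0"
    using assms(1) by (simp_all add: singular_at_origin_def poly2_def dx_def dy_def poly_0_coeff_0 coeff_pderiv coeff_map_poly)
  have "fps2_of_poly2 f \<noteq> 0"
  proof
    assume "fps2_of_poly2 f = 0"
    then have "coeff (coeff f a) b = 0" for a b by (simp flip: fps2_of_poly2_nth)
    then show False using assms(2) by (auto simp: poly_eq_iff)
  qed
  then obtain a b where ab: "coeff (coeff f a) b \<noteq> 0" "wt (1, 1) (a, b) = wt_order (1, 1) (fps2_of_poly2 f)"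
    using wt_order_attained[of "(1, 1)" "fps2_of_poly2 f"] by (auto simp: pos_pairs_def)
  have "\<not> (a = 0 \<and> b = 0)" "\<not> (a = 1 \<and> b = 0)" "\<not> (a = 0 \<and> b = 1)"
    using ab(1) c by metis+
  then have "a + b \<ge> 2" by linarith
  then show ?thesis using ab(2) by (simp add: wt_def)
qed

context branches begin

text \<open>Evaluated through the arc (t^p, Y t^q), whose lowest coefficient in the branch is the
  value of the initial form, so the initial form need not be computed.\<close>

lemma init_form_vanishes:
  assumes j: "j \<in> J" and Y: "Y ^ p j = c j"
  shows "poly2 (init_form (p j, q j) (g j)) 1 Y = 0"
proof -
  let ?w = "(p j, q j)"
  have w: "?w \<in> pos_pairs" using p[OF j] q[OF j] by (simp add: pos_pairs_def)
  let ?P = "(fps_X ^ p j, fps_const Y * fps_X ^ q j) :: 'k arc"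
  have P: "?P \<in> H_inf ?w" by (simp add: H_inf_def)
  have "poly2 (init_form ?w (g j)) 1 Y = jet_coeff (g j) (\<mu> j ?w) ?P"
    using jet_coeff_initial[OF P w, of "g j"] wt_order_g[OF j w] by simp
  also have "\<dots> = 0"
    unfolding jet_coeff_g_initial[OF j w P] using Y by (simp add: \<mu>_def mult.commute)
  finally show ?thesis .
qed

text \<open>Equal constants on a common ray give two factors of the initial form of f with a common
  zero (1, Y) on the torus. By the product rule both derivatives vanish there too, against
  non-degeneracy on that compact face.\<close>

lemma nondegenerate_imp_distinct:
  assumes nd: "newton_nondegenerate f" and ij: "i \<in> J" "j \<in> J" "i \<noteq> j" "p i = p j" "q i = q j"
  shows "c i \<noteq> c j"
proof
  assume "c i = c j"
  let ?w = "(p j, q j)"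
  have w: "?w \<in> pos_pairs" using p[OF ij(2)] q[OF ij(2)] by (simp add: pos_pairs_def)
  obtain Y where Y: "Y ^ p j = c j" using nth_root_exists[of "p j" "c j"] p[OF ij(2)] by auto
  have Y0: "Y \<noteq> 0" using Y c[OF ij(2)] p[OF ij(2)] by (auto simp: power_0_left)
  define A where "A = init_form ?w (g i)"
  define B where "B = init_form ?w (g j)"
  have zero: "poly2 A 1 Y = 0" "poly2 B 1 Y = 0"
    using init_form_vanishes[OF ij(1), of Y] init_form_vanishes[OF ij(2) Y] ij Y \<open>c i = c j\<close> by (simp_all add: A_def B_def)
  let ?r = "\<Prod>k\<in>J - {i} - {j}. g k"
  have "f = g i * (g j * ?r)"
    unfolding f using finite_J ij by (subst prod.remove[of J i], simp, simp, subst prod.remove[of "J - {i}" j]) auto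
  moreover have "?r \<noteq> 0" using finite_J g_nonzero by simp
  ultimately have "init_form ?w f = A * (B * init_form ?w ?r)"
    using ij g_nonzero by (simp add: init_form_mult[OF w] A_def B_def)
  then have fp: "face_poly f (init_face ?w f) = A * (B * init_form ?w ?r)"
    by (simp add: face_poly_init_face[OF w])
  have "poly2 (face_poly f (init_face ?w f)) 1 Y = 0" "poly2 (dx (face_poly f (init_face ?w f))) 1 Y = 0"
    "poly2 (dy (face_poly f (init_face ?w f))) 1 Y = 0"
    unfolding fp dy_mult by (simp_all add: dx_def pderiv_mult zero)
  then show False
    using nd init_face_face_of[OF w, of f] init_face_compact[OF w, of f] init_face_nonempty[OF w f_nonzero] Y0
    unfolding newton_nondegenerate_def by (metis one_neq_zero)
qed

text \<open>One point per branch suffices: once T(f_i) is known to be a semi-line, a nonzero point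
  determines it.\<close>

lemma ray_subset_tropical_variety:
  assumes "K \<subseteq> J" "j \<in> K"
  shows "real_pair (p j, q j) \<in> tropical_variety (\<Prod>k\<in>K. g k)"
proof -
  have j: "j \<in> J" using assms by blast
  let ?w = "(p j, q j)"
  have w: "?w \<in> pos_pairs" using p[OF j] q[OF j] by (simp add: pos_pairs_def)
  obtain Y where Y: "Y ^ p j = c j" using nth_root_exists[of "p j" "c j"] p[OF j] by auto
  have Y0: "Y \<noteq> 0" using Y c[OF j] p[OF j] by (auto simp: power_0_left)
  have finK: "finite K" using assms(1) finite_J finite_subset by blast
  have nz: "(\<Prod>k\<in>L. g k) \<noteq> 0" if "L \<subseteq> K" for L
    using that assms(1) finK g_nonzero finite_subset[of L K] by auto
  have "(\<Prod>k\<in>K. g k) = g j * (\<Prod>k\<in>K - {j}. g k)" using finK assms(2) by (rule prod.remove)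
  then have "init_form ?w (\<Prod>k\<in>K. g k) = init_form ?w (g j) * init_form ?w (\<Prod>k\<in>K - {j}. g k)"
    using g_nonzero[OF j] nz[of "K - {j}"] by (simp add: init_form_mult[OF w])
  then have "poly2 (init_form ?w (\<Prod>k\<in>K. g k)) 1 Y = 0" using init_form_vanishes[OF j Y] by simp
  then show ?thesis by (rule mem_tropical_variety[OF w nz[OF order.refl] _ one_neq_zero Y0])
qed

end

lemma branch_formE:
  assumes "branch_form g"
  obtains u p q c R where "u $ 0 $ 0 \<noteq> 0" "p \<ge> 1" "q \<ge> 1" "coprime p q" "c \<noteq> 0"
    "\<And>a b. R $ a $ b \<noteq> 0 \<Longrightarrow> p * q < p * a + q * b"
    "g = u * (fps_const fps_X ^ p - fps_const (fps_const c) * fps_X ^ q + R)"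
proof -
  obtain u p q c R where *: "u dvd 1" "p \<ge> 1" "q \<ge> 1" "coprime p q" "c \<noteq> 0"
    "\<forall>(a, b)\<in>supp R. p * a + q * b > p * q"
    "g = u * (fps_const fps_X ^ p - fps_const (fps_const c) * fps_X ^ q + R)"
    using assms unfolding branch_form_def by blast
  obtain v where "1 = u * v" using *(1) by (auto elim: dvdE)
  then have "(1 :: 'a fps fps) $ 0 $ 0 = (u * v) $ 0 $ 0" by simp
  then have "u $ 0 $ 0 \<noteq> 0" by auto
  moreover have "p * q < p * a + q * b" if "R $ a $ b \<noteq> 0" for a b
    using *(6) that by (auto simp: supp_def)
  ultimately show thesis using that * by blast
qed

theorem theorem7:
  fixes f :: "'k::alg_closed_field poly poly"
    and t :: nat and r :: "nat \<Rightarrow> nat"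
    and fi :: "nat \<Rightarrow> 'k fps fps"
    and fij :: "nat \<Rightarrow> nat \<Rightarrow> 'k fps fps"
    and m :: nat
  assumes "newton_nondegenerate (fps2_of_poly2 f)"
    and "singular_at_origin f"
    and "tropical_decomposition (fps2_of_poly2 f) t fi"
    and "\<And>i. i \<in> {1..t} \<Longrightarrow> fi i = (\<Prod>j=1..r i. fij i j)"
    and "\<And>i j. i \<in> {1..t} \<Longrightarrow> j \<in> {1..r i} \<Longrightarrow> irreducible (fij i j)"
    and "\<And>i j. i \<in> {1..t} \<Longrightarrow> j \<in> {1..r i} \<Longrightarrow> branch_form (fij i j)"
    and "m \<ge> 1"
  shows "C0 (fps2_of_poly2 f) m =
           (\<Union>\<gamma>\<in>B_star (fps2_of_poly2 f) m. H_fin m \<gamma>) \<union>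
           (\<Union>i\<in>{1..t}. \<Union>\<alpha>\<in>A_idx (fps2_of_poly2 f) (fi i) m. \<Union>j\<in>{1..r i}.
              F_bar (fps2_of_poly2 f) (fij i j) m \<alpha>) \<and>
         bij_betw
           (case_sum (H_fin m) (\<lambda>(i, \<alpha>, j). F_bar (fps2_of_poly2 f) (fij i j) m \<alpha>))
           (B_star (fps2_of_poly2 f) m <+>
              (SIGMA i:{1..t}. A_idx (fps2_of_poly2 f) (fi i) m \<times> {1..r i}))
           (irreducible_components (zariski m) (C0 (fps2_of_poly2 f) m))"
proof -
  define F where "F = fps2_of_poly2 f"
  define J where "J = (SIGMA i:{1..t}. {1..r i})"
  define g where "g = (\<lambda>(i, j). fij i j)"
  have "\<forall>k\<in>J. \<exists>u p q c R. u $ 0 $ 0 \<noteq> 0 \<and> p \<ge> 1 \<and> q \<ge> 1 \<and> coprime p q \<and> c \<noteq> 0 \<and>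
    (\<forall>a b. R $ a $ b \<noteq> 0 \<longrightarrow> p * q < p * a + q * b) \<and>
    g k = u * (fps_const fps_X ^ p - fps_const (fps_const c) * fps_X ^ q + R)"
  proof
    fix k assume "k \<in> J"
    then have "branch_form (g k)" using assms(6) by (auto simp: J_def g_def)
    from branch_formE[OF this] show "\<exists>u p q c R. u $ 0 $ 0 \<noteq> 0 \<and> p \<ge> 1 \<and> q \<ge> 1 \<and> coprime p q \<and> c \<noteq> 0 \<and>
      (\<forall>a b. R $ a $ b \<noteq> 0 \<longrightarrow> p * q < p * a + q * b) \<and>
      g k = u * (fps_const fps_X ^ p - fps_const (fps_const c) * fps_X ^ q + R)" by metis
  qed
  then obtain u p q c R where data: "\<forall>k\<in>J. u k $ 0 $ 0 \<noteq> 0 \<and> p k \<ge> 1 \<and> q k \<ge> 1 \<and> coprime (p k) (q k) \<and> c k \<noteq> 0 \<and>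
    (\<forall>a b. R k $ a $ b \<noteq> 0 \<longrightarrow> p k * q k < p k * a + q k * b) \<and>
    g k = u k * (fps_const fps_X ^ p k - fps_const (fps_const (c k)) * fps_X ^ q k + R k)"
    by metis
  have td: "F = (\<Prod>i=1..t. fi i)" "\<And>i. i \<in> {1..t} \<Longrightarrow> semi_line (tropical_variety (fi i))"
    "\<And>i j. i \<in> {1..t} \<Longrightarrow> j \<in> {1..t} \<Longrightarrow> i < j \<Longrightarrow> tropical_variety (fi i) \<inter> tropical_variety (fi j) = {(0, 0)}"
    using assms(3) by (auto simp: tropical_decomposition_def F_def)
  have F: "F = (\<Prod>k\<in>J. g k)"
  proof -
    have "F = (\<Prod>i=1..t. \<Prod>j=1..r i. fij i j)" unfolding td(1) using assms(4) by (intro prod.cong) auto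
    also have "\<dots> = (\<Prod>k\<in>J. g k)" unfolding J_def g_def by (rule prod.Sigma) auto
    finally show ?thesis .
  qed
  interpret branches J g u R p q c F
    by unfold_locales (use data F in \<open>auto simp: J_def\<close>)
  have pos1: "(1, 1) \<in> pos_pairs" by (simp add: pos_pairs_def)
  have "f \<noteq> 0" using f_nonzero by (auto simp: F_def fps2_of_poly2_def)
  \<comment> \<open>At the weight (1, 1) the total order is the sum of the branch multiplicities min
    p q.\<close>
  then have "2 \<le> M J (1, 1)" using wt_order_singular[OF assms(2)] wt_order_f[OF pos1] by (simp add: F_def)
  then have sing: "2 \<le> (\<Sum>j\<in>J. min (p j) (q j))" by (simp add: M_def \<mu>_def min.commute)
  interpret curve J g u R p q c F m
    by unfold_locales (use nondegenerate_imp_distinct assms(1,7) sing in \<open>auto simp: F_def\<close>)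
  have pq_pos: "(p k, q k) \<in> pos_pairs" if "k \<in> J" for k
    using p[OF that] q[OF that] by (simp add: pos_pairs_def)
  have ray: "tropical_variety (fi i) = {s *\<^sub>R real_pair (p (i, j), q (i, j)) |s. s \<ge> 0}"
    if ij: "i \<in> {1..t}" "j \<in> {1..r i}" for i j
  proof (rule semi_line_eq_ray[OF td(2)[OF ij(1)]])
    have "fi i = (\<Prod>k\<in>Pair i ` {1..r i}. g k)"
      using assms(4)[OF ij(1)] by (simp add: prod.reindex inj_on_def g_def)
    then show "real_pair (p (i, j), q (i, j)) \<in> tropical_variety (fi i)"
      using ray_subset_tropical_variety[of "Pair i ` {1..r i}" "(i, j)"] ij by (simp add: J_def image_subset_iff)
    show "real_pair (p (i, j), q (i, j)) \<noteq> 0"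
      using pq_pos[of "(i, j)"] ij by (auto simp: J_def pos_pairs_def zero_prod_def)
  qed
  have on_ray_iff: "real_pair \<alpha> \<in> tropical_variety (fi i) \<longleftrightarrow> on_ray (i, j) \<alpha>"
    if "i \<in> {1..t}" "j \<in> {1..r i}" for i j \<alpha>
    using mem_ray_iff[OF pq_pos[of "(i, j)"], of \<alpha>] that
    by (simp add: ray[OF that] J_def on_ray_def del: map_prod_simp)
  have r1: "r i \<ge> 1" if "i \<in> {1..t}" for i
  proof (rule ccontr)
    assume "\<not> r i \<ge> 1"
    then have "fi i = 1" using assms(4)[OF that] by simp
    then show False using td(2)[OF that] by (auto simp: tropical_variety_1 semi_line_def)
  qed
  \<comment> \<open>A point on the rays of all branches lies in every T(f_i). Two of these meet only
    at the origin, so t = 1 and T(f) is a single ray.\<close>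
  have frontier: "real_pair \<alpha> \<in> frontier (convex hull (tropical_variety F))"
    if \<alpha>: "\<alpha> \<in> pos_pairs" "\<And>k. k \<in> J \<Longrightarrow> on_ray k \<alpha>" for \<alpha>
  proof -
    have \<alpha>0: "real_pair \<alpha> \<noteq> 0" using \<alpha>(1) by (cases \<alpha>) (auto simp: pos_pairs_def zero_prod_def)
    have mem: "real_pair \<alpha> \<in> tropical_variety (fi i)" if i: "i \<in> {1..t}" for i
      using on_ray_iff[OF i, of 1 \<alpha>] r1[OF i] \<alpha>(2)[of "(i, 1)"] i by (auto simp: J_def simp del: map_prod_simp)
    have "t \<noteq> 0" using J_nonempty by (auto simp: J_def)
    moreover have "\<not> t \<ge> 2"
    proof
      assume "t \<ge> 2"
      then have "real_pair \<alpha> \<in> tropical_variety (fi 1) \<inter> tropical_variety (fi 2)" using mem by auto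
      then have "real_pair \<alpha> = (0, 0)" using td(3)[of 1 2] \<open>t \<ge> 2\<close> by auto
      then show False using \<alpha>0 by (simp add: zero_prod_def)
    qed
    ultimately have t: "t = 1" by linarith
    then have "tropical_variety F = {s *\<^sub>R real_pair \<alpha> |s. s \<ge> 0}"
      using semi_line_eq_ray[OF td(2) mem \<alpha>0, of 1] td(1) by simp
    then show ?thesis using frontier_ray[OF \<alpha>0] by simp
  qed
  \<comment> \<open>Reorders (i, \<alpha>, j) as \<alpha> with the flat branch index (i, j),
    matching the index set of \<open>C0_decomposition\<close>.\<close>
  define h :: "(nat \<times> nat) + (nat \<times> (nat \<times> nat) \<times> nat) \<Rightarrow> (nat \<times> nat) + ((nat \<times> nat) \<times> nat \<times> nat)"
    where "h = map_sum id (\<lambda>(i, \<alpha>, j). (\<alpha>, (i, j)))"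
  let ?K = "B_star F m <+> (SIGMA i:{1..t}. A_idx F (fi i) m \<times> {1..r i})"
  let ?Z = "case_sum (H_fin m) (\<lambda>(\<alpha>, k). F_bar F (g k) m \<alpha>)"
  have idx_iff: "idx \<alpha> (i, j) \<longleftrightarrow> i \<in> {1..t} \<and> \<alpha> \<in> A_idx F (fi i) m \<and> j \<in> {1..r i}" for \<alpha> i j
  proof -
    have "(i, j) \<in> J \<longleftrightarrow> i \<in> {1..t} \<and> j \<in> {1..r i}" by (simp add: J_def)
    moreover have "nu (real_pair \<alpha>) F \<le> real m \<longleftrightarrow> M J \<alpha> \<le> m" if "\<alpha> \<in> pos_pairs"
      using nu_f[OF that] by simp
    ultimately show ?thesis
      using on_ray_iff[of i j \<alpha>] unfolding idx_def A_idx_def mem_Collect_eq by blast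
  qed
  have "bij_betw h ?K (B_star F m <+> {(\<alpha>, k). idx \<alpha> k})"
  proof (rule bij_betwI')
    show "h x = h y \<longleftrightarrow> x = y" for x y
      by (cases x; cases y) (auto simp: h_def)
    show "h x \<in> B_star F m <+> {(\<alpha>, k). idx \<alpha> k}" if "x \<in> ?K" for x
      using that idx_iff by (auto simp: h_def)
    show "\<exists>x\<in>?K. y = h x" if "y \<in> B_star F m <+> {(\<alpha>, k). idx \<alpha> k}" for y
    proof (cases y)
      case (Inl \<gamma>)
      then show ?thesis using that by (intro bexI[of _ "Inl \<gamma>"]) (auto simp: h_def)
    next
      case (Inr v)
      then obtain \<alpha> i j where "v = (\<alpha>, (i, j))" by (cases v) auto
      then show ?thesis using that Inr idx_iff[of \<alpha> i j]
        by (intro bexI[of _ "Inr (i, \<alpha>, j)"]) (auto simp: h_def)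
    qed
  qed
  then have "bij_betw (?Z \<circ> h) ?K (irreducible_components (zariski m) (C0 F m))"
    by (rule bij_betw_trans[OF _ C0_decomposition(2)[OF frontier]])
  moreover have Zh: "?Z \<circ> h = case_sum (H_fin m) (\<lambda>(i, \<alpha>, j). F_bar F (fij i j) m \<alpha>)"
    by (auto simp: fun_eq_iff h_def g_def split: sum.split)
  moreover have "C0 F m = (\<Union>\<gamma>\<in>B_star F m. H_fin m \<gamma>) \<union>
    (\<Union>i\<in>{1..t}. \<Union>\<alpha>\<in>A_idx F (fi i) m. \<Union>j\<in>{1..r i}. F_bar F (fij i j) m \<alpha>)"
  proof -
    have "C0 F m = (\<Union>k\<in>B_star F m <+> {(\<alpha>, k). idx \<alpha> k}. ?Z k)"
      by (rule C0_decomposition(1)[OF frontier])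
    also have "\<dots> = (\<Union>\<gamma>\<in>B_star F m. H_fin m \<gamma>) \<union> (\<Union>(\<alpha>, k)\<in>{(\<alpha>, k). idx \<alpha> k}. F_bar F (g k) m \<alpha>)"
      by (simp add: Plus_def image_image UN_Un)
    also have "(\<Union>(\<alpha>, k)\<in>{(\<alpha>, k). idx \<alpha> k}. F_bar F (g k) m \<alpha>) =
      (\<Union>i\<in>{1..t}. \<Union>\<alpha>\<in>A_idx F (fi i) m. \<Union>j\<in>{1..r i}. F_bar F (fij i j) m \<alpha>)"
      using idx_iff by (fastforce simp: g_def)
    finally show ?thesis .
  qed
  ultimately show ?thesis by (simp add: F_def)
qed

end
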